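(* Let $m$ be a fixed integer. Then, as $n\to\infty$, $$N_{C_1}(m,n)\sim \frac{\log 2}{4\pi\sqrt{n}}\,e^{\frac{\pi\sqrt{n}}{\sqrt{3}}}.$$
   Context: For $n\in\{0,1,2,\dots\}\cup\{\infty\}$ put $(a;q)_n:=\prod_{k=1}^{n}(1-aq^{k-1})$ and $(a)_n:=(a;q)_n$. The integers $N_{C_1}(m,n)$ ($m\in\mathbb{Z}$, $n\ge 0$) are defined by the generating function $$\sum_{n\ge 0}\sum_{m\in\mathbb{Z}}N_{C_1}(m,n)z^mq^n=\frac{(q;q^2)_\infty (q)_\infty}{(z)_\infty(z^{-1})_\infty}\sum_{n=1}^{\infty}\frac{q^n(z)_n(z^{-1})_n}{(q;q^2)_n(q)_n},$$ where, for each $n\geq 1$, the quotient $\frac{(z)_n(z^{-1})_n}{(z)_\infty(z^{-1})_\infty}$ is understood as $\frac{1}{(zq^n)_\infty(z^{-1}q^n)_\infty}$, expanded as a power series in $q$ with coefficients Laurent polynomials in $z$. *)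

theory Defs
  imports
    "HOL-Analysis.Analysis"
    "HOL-Computational_Algebra.Formal_Power_Series"
    "HOL-Library.Poly_Mapping"
    "HOL-Library.Landau_Symbols"
begin

text \<open>
  Integer Laurent polynomials in \<open>z\<close> are the finitely supported functions from exponents
  (in \<open>int\<close>) to coefficients; multiplication of \<^type>\<open>poly_mapping\<close> is convolution.
  Power series in \<open>q\<close> over this ring carry the usual topology of formal power series, in which
  a sequence converges iff each coefficient is eventually constant. The infinite product and the
  infinite sum below are taken in that topology.
\<close>

type_synonym laurent_poly = "(int, int) poly_mapping"

text \<open>
  The monomial \<open>z^i\<close> and the variable \<open>q\<close> as elements of the ring of power series.
\<close>

definition zpow :: "int \<Rightarrow> laurent_poly fps" where
  "zpow i = fps_const (Poly_Mapping.single i 1)"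

abbreviation qvar :: "laurent_poly fps" where
  "qvar \<equiv> fps_X"

definition qpoch :: "'a::comm_ring_1 \<Rightarrow> 'a \<Rightarrow> nat \<Rightarrow> 'a" where
  "qpoch a q n = (\<Prod>k=1..n. 1 - a * q ^ (k - 1))"

text \<open>\<^const>\<open>prodinf\<close> starts at index \<open>0\<close>, so its \<open>k\<close>-th factor is the one numbered \<open>k + 1\<close> in \<^const>\<open>qpoch\<close>.\<close>

definition qpoch_inf :: "'a::{t2_space,comm_ring_1} \<Rightarrow> 'a \<Rightarrow> 'a" where
  "qpoch_inf a q = prodinf (\<lambda>k. 1 - a * q ^ k)"

text \<open>
  The library's \<^const>\<open>inverse\<close> on power series needs an \<^const>\<open>inverse\<close> on the coefficients, which
  Laurent polynomials lack. All denominators below have constant term \<open>1\<close>, and for such series the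
  following is the multiplicative inverse.
\<close>

definition fps_recip :: "'a::comm_ring_1 fps \<Rightarrow> 'a fps" where
  "fps_recip f = fps_right_inverse f 1"

text \<open>
  The quotient of \<open>(z)_n (z^{-1})_n\<close> by \<open>(z)_\<infinity> (z^{-1})_\<infinity>\<close> is understood as the reciprocal of
  \<open>(z q^n)_\<infinity> (z^{-1} q^n)_\<infinity>\<close>, for each \<open>n \<ge> 1\<close>.
\<close>

definition C1_term :: "nat \<Rightarrow> laurent_poly fps" where
  "C1_term n =
     qvar ^ n
       * fps_recip (qpoch_inf (zpow 1 * qvar ^ n) qvar * qpoch_inf (zpow (-1) * qvar ^ n) qvar)
       * fps_recip (qpoch qvar (qvar ^ 2) n * qpoch qvar qvar n)"

definition C1_gen :: "laurent_poly fps" where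
  "C1_gen = qpoch_inf qvar (qvar ^ 2) * qpoch_inf qvar qvar * suminf (\<lambda>n. C1_term (Suc n))"

definition N_C1 :: "int \<Rightarrow> nat \<Rightarrow> int" where
  "N_C1 m n = Poly_Mapping.lookup (fps_nth C1_gen n) m"


text \<open>
  The products and the sum above converge, and the reciprocals are true inverses, so none of these
  operators takes an unspecified default value.
\<close>

lemma fps_recip_mult:
  fixes f :: "'a::comm_ring_1 fps"
  assumes "fps_nth f 0 = 1"
  shows "f * fps_recip f = 1"
  unfolding fps_recip_def by (rule fps_right_inverse) (simp add: assms)

lemma qpoch_inf_aux:
  fixes a q :: "'a::idom fps"
  assumes a: "fps_nth a 0 = 0" and q: "fps_nth q 0 = 0"
  shows "convergent_prod (\<lambda>k. 1 - a * q ^ k)" and "fps_nth (qpoch_inf a q) 0 = 1"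
proof -
  define P where "P n = (\<Prod>k\<le>n. 1 - a * q ^ k)" for n
  have small: "fps_nth (a * q ^ k) j = 0" if "j \<le> k" for j k
  proof -
    have "fps_nth a i * fps_nth (q ^ k) (j - i) = 0" if "i \<le> j" for i
    proof (cases "i = 0")
      case False
      then have "j - i < k" using \<open>i \<le> j\<close> \<open>j \<le> k\<close> by auto
      then show ?thesis using startsby_zero_power_prefix[OF q, of k] by auto
    qed (simp add: a)
    then show ?thesis unfolding fps_mult_nth by (intro sum.neutral) auto
  qed
  have step: "fps_nth (P (Suc n)) j = fps_nth (P n) j" if "j \<le> n" for j n
  proof -
    have "P (Suc n) = P n - P n * (a * q ^ Suc n)"
      by (simp add: P_def algebra_simps)
    moreover have "fps_nth (P n * (a * q ^ Suc n)) j = 0"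
      unfolding fps_mult_nth[of "P n"] using small[of _ "Suc n"] that by (intro sum.neutral) auto
    ultimately show ?thesis by simp
  qed
  have stable: "fps_nth (P n) j = fps_nth (P j) j" if "j \<le> n" for j n
    using that by (induction n rule: dec_induct) (auto simp: step)
  define L where "L = Abs_fps (\<lambda>j. fps_nth (P j) j)"
  have lim: "P \<longlonglongrightarrow> L"
  proof (rule tendsto_fpsI)
    show "eventually (\<lambda>n. fps_nth (P n) j = fps_nth L j) sequentially" for j
      using eventually_ge_at_top[of j] by eventually_elim (unfold L_def fps_nth_Abs_fps, rule stable)
  qed
  have L0: "fps_nth L 0 = 1"
    by (simp add: L_def P_def a)
  then have "L \<noteq> 0" by auto
  with lim have "raw_has_prod (\<lambda>k. 1 - a * q ^ k) 0 L"
    by (simp add: raw_has_prod_def P_def[abs_def])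
  then have hp: "(\<lambda>k. 1 - a * q ^ k) has_prod L"
    by (simp add: has_prod_def)
  then show "convergent_prod (\<lambda>k. 1 - a * q ^ k)"
    unfolding convergent_prod_def has_prod_def by blast
  have "qpoch_inf a q = L"
    unfolding qpoch_inf_def using hp by (rule has_prod_unique[symmetric])
  with L0 show "fps_nth (qpoch_inf a q) 0 = 1" by simp
qed

lemma qpoch_nth_0:
  fixes a q :: "'a::comm_ring_1 fps"
  assumes "fps_nth a 0 = 0"
  shows "fps_nth (qpoch a q n) 0 = 1"
  by (induction n) (simp_all add: qpoch_def assms)

lemma C1_denominators:
  assumes "n \<ge> 1"
  shows "fps_nth (qpoch_inf (zpow 1 * qvar ^ n) qvar * qpoch_inf (zpow (-1) * qvar ^ n) qvar) 0 = 1"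
    and "fps_nth (qpoch qvar (qvar ^ 2) n * qpoch qvar qvar n) 0 = 1"
  using assms by (simp_all add: qpoch_inf_aux qpoch_nth_0 fps_X_power_nth)

lemma summable_C1_term: "summable (\<lambda>n. C1_term (Suc n))"
proof -
  define S where "S n = (\<Sum>k<n. C1_term (Suc k))" for n
  have small: "fps_nth (C1_term n) j = 0" if "j < n" for j n
    using that by (simp add: C1_term_def mult.assoc fps_X_power_mult_nth)
  have stable: "fps_nth (S n) j = fps_nth (S j) j" if "j \<le> n" for j n
    using that by (induction n rule: dec_induct) (auto simp: S_def small)
  have "S \<longlonglongrightarrow> Abs_fps (\<lambda>j. fps_nth (S j) j)"
  proof (rule tendsto_fpsI)
    show "eventually (\<lambda>n. fps_nth (S n) j = fps_nth (Abs_fps (\<lambda>j. fps_nth (S j) j)) j) sequentially" for j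
      using eventually_ge_at_top[of j] by eventually_elim (unfold fps_nth_Abs_fps, rule stable)
  qed
  then show ?thesis
    unfolding summable_def sums_def S_def[abs_def] by blast
qed

end

theory Submission
  imports Defs "HOL-Probability.Sinc_Integral" "HOL-Real_Asymp.Real_Asymp"
begin

text \<open>
  Write $P(q)=\prod_{k\ge1}(1-q^k)^{-1}=\sum_n p(n)q^n$. The proof first finds the generating
  function of $N_{C_1}(m,\cdot)$ for fixed $m$ as a product $P(q^2)\,T_m(q)$ in which $T_m$ has small
  coefficients, and then compares the coefficients of the product with the partial sums of $p$.

  \<^bold>\<open>The generating function.\<close> The weight $1/((q;q^2)_n(q)_n)$ is the $\beta$-side of a Bailey pair of
  Slater with $\alpha_0=1$, $\alpha_{2s}=(-1)^sq^{s(3s-1)}(1+q^{2s})$ for $s\ge1$, and vanishing odd entries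
  (\<open>slater_sum\<close>). The term $n=0$
  is absent from the series, so the unit Bailey pair, whose $\beta_n$ vanishes for $n\ge1$, may be
  subtracted (\<open>bailey_alpha0_sum\<close>); this removes the only index at which division by $1-z$ would
  occur. Against the kernel $q^n(z)_n(z^{-1})_n$ each remaining index $r\ge1$ can be summed in closed form, by
  a telescoping case of the $q$-Gauss sum (\<open>bailey_kernel_sum\<close>), and what is left of $z$ is
  $1/((1-zq^r)(1-z^{-1}q^r))$, whose coefficient of $z^m$ is $q^{r|m|}/(1-q^{2r})$. Thus
  (\<open>N_C1_convolution\<close>) $N_{C_1}(m,n)=\sum_k p(k)\,t(n-2k)$ where
  \[ \sum_j t(j)q^j=\sum_{r\ge1}\frac{(-1)^{r+1}q^{r(r+1)/2+r|m|}}{1-q^r}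
     -\sum_{s\ge1}\frac{(-1)^{s+1}q^{s(3s+1)+2s|m|}}{1-q^{2s}}. \]

  \<^bold>\<open>Mean values.\<close> A partial sum of $t$ is a difference of two alternating sums of numbers of terms of arithmetic
  progressions. These numbers decrease with the index of the progression, so Leibniz' bound controls the tail and each
  series contributes a multiple of $\log 2$ (\<open>alternating_progression_density\<close>). The two residue classes
  modulo $2$ have to be treated separately, since $P(q^2)$ also has a singularity at $q=-1$; in both of
  them $t$ has the mean value $\frac12\log 2$ (\<open>numer_parity_mean\<close>). As $p$ is nondecreasing, summation by parts
  turns this into $N_{C_1}(m,n)\sim\frac12\log 2\cdot\sum_{k\le n/2}p(k)$ (\<open>convolution_with_mean_value\<close>).

  \<^bold>\<open>Partial sums of the partition function.\<close> The asymptotics of $\sum_{k\le M}p(k)$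
  (\<open>partition_sum_asymptotics\<close>) follow from the circle method with the weight $P(q)/(1-q)$ on the circle
  $|q|=e^{-t}$, $t=\pi/\sqrt{6M}$. With $\theta=t^{3/2}u$ the integrand converges to
  $e^{-\pi^2u^2/6}$, and it has an integrable majorant, which comes from the first term of the series
  $\log P(q)=\sum_m q^m/(m(1-q^m))$ alone (\<open>Re_euler_log_bound\<close>). The limit needs
  $\log P(e^{-w})$ on vertical segments only up to $o(1)$ relative to its value on the real axis
  (\<open>euler_log_vertical_difference\<close>), and on the real axis $\log P(e^{-t})=\frac{\pi^2}{6t}+\frac12\log\frac{t}{2\pi}+o(1)$
  (\<open>euler_log_real_asymptotics\<close>). This last expansion is derived without modular forms: it is
  determined by its leading term together with the behaviour of $P(q)^2/P(q^2)^4$, and that quotient is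
  a $q$-analogue of Wallis' product.
\<close>

section \<open>Reciprocals and coefficientwise agreement of power series\<close>

lemma power_cong_exponent: "k = l \<Longrightarrow> x ^ k = x ^ l"
  by simp

lemma qpoch_0 [simp]: "qpoch a q 0 = 1"
  by (simp add: qpoch_def)

lemma qpoch_Suc: "qpoch a q (Suc n) = qpoch a q n * (1 - a * q ^ n)"
  by (simp add: qpoch_def)

lemma fps_recip_unique:
  fixes f g :: "'a::comm_ring_1 fps"
  assumes "f * g = 1" "fps_nth f 0 = 1"
  shows "fps_recip f = g"
proof -
  have "fps_recip f = (f * g) * fps_recip f"
    by (simp add: assms)
  also have "\<dots> = g * (f * fps_recip f)"
    by (simp only: mult_ac)
  finally show ?thesis
    by (simp add: fps_recip_mult assms)
qed

lemma fps_recip_times: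
  fixes f g :: "'a::comm_ring_1 fps"
  assumes "fps_nth f 0 = 1" "fps_nth g 0 = 1"
  shows "fps_recip (f * g) = fps_recip f * fps_recip g"
proof (rule fps_recip_unique)
  have "f * g * (fps_recip f * fps_recip g) = (f * fps_recip f) * (g * fps_recip g)"
    by (simp add: algebra_simps)
  then show "f * g * (fps_recip f * fps_recip g) = 1"
    by (simp add: fps_recip_mult assms)
qed (simp add: assms)

lemma fps_recip_1 [simp]: "fps_recip (1 :: 'a::comm_ring_1 fps) = 1"
  by (rule fps_recip_unique) simp_all

text \<open>
  Agreement of the first $M+1$ coefficients. Infinite products and series are replaced by finite ones
  modulo $q^{M+1}$ throughout; this congruence is compatible with products and reciprocals.
\<close>

definition agree_upto :: "nat \<Rightarrow> 'a::comm_ring_1 fps \<Rightarrow> 'a fps \<Rightarrow> bool" where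
  "agree_upto M f g \<longleftrightarrow> (\<forall>j\<le>M. fps_nth f j = fps_nth g j)"

lemma agree_refl [simp]: "agree_upto M f f"
  by (simp add: agree_upto_def)

lemma agree_sym: "agree_upto M f g \<Longrightarrow> agree_upto M g f"
  by (simp add: agree_upto_def)

lemma agree_trans [trans]: "agree_upto M f g \<Longrightarrow> agree_upto M g h \<Longrightarrow> agree_upto M f h"
  by (simp add: agree_upto_def)

lemma agree_sum: "(\<And>i. i \<in> I \<Longrightarrow> agree_upto M (f i) (g i)) \<Longrightarrow> agree_upto M (sum f I) (sum g I)"
  by (auto simp: agree_upto_def fps_sum_nth intro!: sum.cong)

lemma agree_mult: "agree_upto M f f' \<Longrightarrow> agree_upto M g g' \<Longrightarrow> agree_upto M (f * g) (f' * g')"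
  unfolding agree_upto_def fps_mult_nth by (auto intro!: sum.cong)

lemma agree_recip:
  assumes "agree_upto M f g" "fps_nth f 0 = 1" "fps_nth g 0 = 1"
  shows "agree_upto M (fps_recip f) (fps_recip g)"
proof -
  have "agree_upto M (fps_recip f * (g * fps_recip g)) (fps_recip f * (f * fps_recip g))"
    by (intro agree_mult agree_refl agree_sym[OF assms(1)])
  moreover have "fps_recip f * (f * fps_recip g) = fps_recip g * (f * fps_recip f)"
    by (simp only: mult_ac)
  ultimately show ?thesis
    by (simp add: fps_recip_mult assms)
qed

text \<open>
  A factor $q^r$ compensates a loss of $r$ in the precision. It is what allows $1/(q)_{M-r}$ to be
  replaced by $1/(q)_M$ in the $r$-th term of a sum.
\<close>

lemma agree_X_power_mult:
  assumes "agree_upto (M - r) f g"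
  shows "agree_upto M (fps_X ^ r * f) (fps_X ^ r * g)"
  using assms by (simp add: agree_upto_def fps_X_power_mult_nth)

lemma agree_all_eq: "(\<And>M. agree_upto M f g) \<Longrightarrow> f = g"
  by (auto simp: agree_upto_def fps_eq_iff)

lemma fps_X_mult_fps_shift_1:
  fixes f :: "'a::comm_ring_1 fps"
  assumes "fps_nth f 0 = 0"
  shows "f = fps_X * fps_shift 1 f"
  using assms by (auto simp: fps_eq_iff)

lemma qpoch_agree:
  fixes a q :: "'a::comm_ring_1 fps"
  assumes a: "fps_nth a 0 = 0" and q: "fps_nth q 0 = 0" and "M \<le> n"
  shows "agree_upto M (qpoch a q n) (qpoch a q M)"
  using \<open>M \<le> n\<close>
proof (induction n rule: dec_induct)
  case (step n)
  obtain b where b: "a = fps_X * b"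
    using fps_X_mult_fps_shift_1[OF a] by metis
  obtain c where c: "q = fps_X * c"
    using fps_X_mult_fps_shift_1[OF q] by metis
  have "a * q ^ n = fps_X ^ Suc n * (b * c ^ n)"
    by (simp add: b c power_mult_distrib algebra_simps)
  then have "agree_upto M (a * q ^ n) 0"
    using step.hyps by (simp only: agree_upto_def fps_X_power_mult_nth) simp
  then have "agree_upto M (1 - a * q ^ n) 1"
    by (simp add: agree_upto_def)
  then have "agree_upto M (qpoch a q n * (1 - a * q ^ n)) (qpoch a q n * 1)"
    by (intro agree_mult agree_refl)
  then show ?case
    using step.IH agree_trans by (auto simp: qpoch_Suc)
qed simp

text \<open>
  The $k$-th factor of the product is $1+O(q^{k+1})$, so that the coefficients of the partial
  products are eventually constant.
\<close>

lemma qpoch_inf_agree: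
  fixes a q :: "'a::idom fps"
  assumes a: "fps_nth a 0 = 0" and q: "fps_nth q 0 = 0" and "M \<le> n"
  shows "agree_upto M (qpoch_inf a q) (qpoch a q n)"
proof -
  define L where "L = Abs_fps (\<lambda>j. fps_nth (qpoch a q j) j)"
  have lim: "(\<lambda>n. qpoch a q (Suc n)) \<longlonglongrightarrow> L"
  proof (rule tendsto_fpsI)
    show "eventually (\<lambda>n. fps_nth (qpoch a q (Suc n)) j = fps_nth L j) sequentially" for j
      using eventually_ge_at_top[of j]
    proof eventually_elim
      case (elim n)
      then show ?case
        using qpoch_agree[OF a q, of j "Suc n"] by (simp add: L_def agree_upto_def)
    qed
  qed
  have "qpoch a q (Suc n) = (\<Prod>k\<le>n. 1 - a * q ^ k)" for n
    by (induction n) (simp_all add: qpoch_Suc)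
  moreover have "fps_nth L 0 = 1"
    by (simp add: L_def)
  then have "L \<noteq> 0"
    by auto
  ultimately have "raw_has_prod (\<lambda>k. 1 - a * q ^ k) 0 L"
    using lim by (simp add: raw_has_prod_def)
  then have "(\<lambda>k. 1 - a * q ^ k) has_prod L"
    by (simp add: has_prod_def)
  then have "qpoch_inf a q = L"
    unfolding qpoch_inf_def by (rule has_prod_unique[symmetric])
  then show ?thesis
    using qpoch_agree[OF a q] \<open>M \<le> n\<close> by (simp add: agree_upto_def L_def)
qed

lemma qpoch_add: "qpoch a q (m + n) = qpoch a q m * qpoch (a * q ^ m) q n"
  by (induction n) (simp_all add: qpoch_Suc power_add mult_ac)

lemma qpoch_inf_split:
  fixes a q :: "'a::idom fps"
  assumes a: "fps_nth a 0 = 0" and q: "fps_nth q 0 = 0"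
  shows "qpoch_inf a q = qpoch a q n * qpoch_inf (a * q ^ n) q"
proof (rule agree_all_eq)
  fix M
  have "agree_upto M (qpoch_inf a q) (qpoch a q n * qpoch (a * q ^ n) q M)"
    unfolding qpoch_add[symmetric] by (intro qpoch_inf_agree a q) simp
  moreover have "agree_upto M (qpoch a q n * qpoch_inf (a * q ^ n) q) (qpoch a q n * qpoch (a * q ^ n) q M)"
    by (intro agree_mult agree_refl qpoch_inf_agree) (simp_all add: a q)
  ultimately show "agree_upto M (qpoch_inf a q) (qpoch a q n * qpoch_inf (a * q ^ n) q)"
    using agree_sym agree_trans by blast
qed

section \<open>Telescoping the Bailey kernel\<close>

definition inv_qfact :: "nat \<Rightarrow> 'a::comm_ring_1 fps" where
  "inv_qfact n = fps_recip (qpoch fps_X fps_X n)"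

lemma inv_qfact_0 [simp]: "inv_qfact 0 = 1"
  by (simp add: inv_qfact_def)

lemma qpoch_X_nth_0: "fps_nth (qpoch fps_X q n :: 'a::comm_ring_1 fps) 0 = 1"
  by (simp add: qpoch_nth_0)

lemma inv_qfact_Suc: "inv_qfact n = (1 - fps_X ^ Suc n) * inv_qfact (Suc n)"
proof -
  have "(qpoch fps_X fps_X n :: 'a fps) * ((1 - fps_X ^ Suc n) * inv_qfact (Suc n)) = 1"
    using fps_recip_mult[OF qpoch_X_nth_0[of fps_X "Suc n"]]
    by (simp add: inv_qfact_def qpoch_Suc mult.assoc)
  then show ?thesis
    using fps_recip_unique qpoch_X_nth_0 unfolding inv_qfact_def by metis
qed

text \<open>
  The telescoping case of the $q$-Gauss sum,
  $\sum_{k\le K}\frac{(a)_k(b)_k}{(q)_k(abq)_k}q^k=\frac{(aq)_K(bq)_K}{(q)_K(abq)_K}$,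
  for $a=zq^r$, $b=z^{-1}q^r$ (here $r$ is \<open>Suc r\<close>). The factors $1-z$ and $1-z^{-1}$ of $(z)_n(z^{-1})_n$ are left out on both
  sides, because they are not invertible.
\<close>

lemma bailey_kernel_sum:
  fixes u v :: "'a::comm_ring_1 fps"
  assumes uv: "u * v = 1"
  defines "A \<equiv> \<lambda>n. qpoch (u * fps_X) fps_X n * qpoch (v * fps_X) fps_X n"
  shows "(1 - u * fps_X ^ Suc r) * (1 - v * fps_X ^ Suc r) *
           (\<Sum>k\<le>K. fps_X ^ (Suc r + k) * A (r + k) * inv_qfact k * inv_qfact (2 * Suc r + k))
         = fps_X ^ Suc r * A (Suc r + K) * inv_qfact K * inv_qfact (2 * Suc r + K)"
proof (induction K)
  case 0
  show ?case by (simp add: A_def qpoch_Suc algebra_simps)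
next
  case (Suc K)
  define x y :: "'a fps" where "x = fps_X ^ Suc r" and "y = fps_X ^ Suc K"
  define a where "a = A (Suc r + K)"
  define i j :: "'a fps" where "i = inv_qfact (Suc K)" and "j = inv_qfact (2 * Suc r + Suc K)"
  have A': "A (Suc r + Suc K) = a * (1 - u * (x * y)) * (1 - v * (x * y))"
    by (simp add: A_def a_def qpoch_Suc x_def y_def power_add algebra_simps)
  have i': "inv_qfact K = (1 - y) * i" and j': "inv_qfact (2 * Suc r + K) = (1 - x * x * y) * j"
  proof -
    have "x * x * y = fps_X ^ Suc (2 * Suc r + K)"
      unfolding x_def y_def power_add[symmetric] by (rule power_cong_exponent) simp
    then show "inv_qfact (2 * Suc r + K) = (1 - x * x * y) * j"
      unfolding j_def using inv_qfact_Suc[of "2 * Suc r + K"] by (simp only: add_Suc_right)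
    show "inv_qfact K = (1 - y) * i"
      unfolding i_def y_def by (rule inv_qfact_Suc)
  qed
  have xy: "fps_X ^ (Suc r + Suc K) = x * y"
    by (simp add: x_def y_def power_add)
  have eq: "(1 - y) * (1 - x * x * y) + y * ((1 - u * x) * (1 - v * x)) = (1 - u * (x * y)) * (1 - v * (x * y))"
  proof -
    have "(1 - u * w) * (1 - v * w) = 1 - u * w - v * w + (u * v) * (w * w)" for w
      by (simp add: algebra_simps)
    then show ?thesis
      by (simp add: uv) (simp add: algebra_simps)
  qed
  have "(1 - u * x) * (1 - v * x) *
     (\<Sum>k\<le>Suc K. fps_X ^ (Suc r + k) * A (r + k) * inv_qfact k * inv_qfact (2 * Suc r + k))
     = x * a * ((1 - y) * i) * ((1 - x * x * y) * j) + (1 - u * x) * (1 - v * x) * (x * y * a * i * j)"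
    using Suc.IH unfolding x_def[symmetric] a_def[symmetric] i' j' sum.atMost_Suc distrib_left xy i_def[symmetric] j_def[symmetric]
    by (simp only: a_def add_Suc add_Suc_right)
  also have "\<dots> = x * a * i * j * ((1 - y) * (1 - x * x * y) + y * ((1 - u * x) * (1 - v * x)))"
    by (simp add: right_diff_distrib distrib_left mult_ac)
  also have "\<dots> = x * (a * (1 - u * (x * y)) * (1 - v * (x * y))) * i * j"
    unfolding eq by (simp only: mult_ac)
  finally show ?case
    unfolding x_def[symmetric] A' i_def j_def by simp
qed

section \<open>Two Bailey pairs\<close>

text \<open>
  The unit Bailey pair relative to $1$: its $\beta_n$ is $1$ for $n=0$ and $0$ otherwise.
\<close>

definition bailey_alpha0 :: "nat \<Rightarrow> 'a::comm_ring_1 fps" where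
  "bailey_alpha0 r = (if r = 0 then 1 else (-1) ^ r * fps_X ^ (r choose 2) * (1 + fps_X ^ r))"

text \<open>
  The partial sums have a closed form once the sum is multiplied by $1-q^n$. The factor
  $1-q^{n-R}$ on the right makes the last one, $R=n$, vanish.
\<close>

lemma bailey_alpha0_partial:
  assumes "R \<le> n"
  shows "(1 - fps_X ^ n) * (\<Sum>r\<le>R. bailey_alpha0 r * inv_qfact (n - r) * inv_qfact (n + r))
         = ((-1) ^ R * fps_X ^ (Suc R choose 2) * (1 - fps_X ^ (n - R)) * inv_qfact (n - R) * inv_qfact (n + R) :: 'a::comm_ring_1 fps)"
  using assms
proof (induction R)
  case 0
  then show ?case by (simp add: bailey_alpha0_def numeral_2_eq_2)
next
  case (Suc R)
  define a b :: "'a fps" where "a = fps_X ^ (n - Suc R)" and "b = fps_X ^ Suc R"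
  have n: "fps_X ^ n = a * b" and nR: "fps_X ^ (n - R) = a * fps_X" and nR': "fps_X ^ Suc (n + R) = a * b * b"
    unfolding a_def b_def power_add[symmetric] power_Suc2[symmetric]
    by (rule power_cong_exponent, use Suc.prems in simp)+
  have r1: "inv_qfact (n - Suc R) = (1 - a * fps_X) * (inv_qfact (n - R) :: 'a fps)"
    using inv_qfact_Suc[of "n - Suc R", where 'a='a] nR Suc.prems by (simp only: Suc_diff_Suc Suc_le_eq)
  have r2: "inv_qfact (n + R) = (1 - a * b * b) * (inv_qfact (n + Suc R) :: 'a fps)"
    using inv_qfact_Suc[of "n + R", where 'a='a] unfolding nR' by simp
  have ch: "Suc (Suc R) choose 2 = (Suc R choose 2) + Suc R"
    by (simp add: numeral_2_eq_2)
  have "(1 - a * b) * (\<Sum>r\<le>Suc R. bailey_alpha0 r * inv_qfact (n - r) * inv_qfact (n + r)) =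
     (-1) ^ R * fps_X ^ (Suc R choose 2) * inv_qfact (n - Suc R) * inv_qfact (n + R) +
     (1 - a * b) * ((-1) ^ Suc R * fps_X ^ (Suc R choose 2) * (1 + b) * inv_qfact (n - Suc R) * inv_qfact (n + Suc R))"
  proof -
    have "Suc R \<noteq> 0" by simp
    then have al: "bailey_alpha0 (Suc R) = (-1) ^ Suc R * fps_X ^ (Suc R choose 2) * (1 + b)"
      unfolding bailey_alpha0_def b_def by (simp only: if_False)
    have "R \<le> n" using Suc.prems by simp
    note IH = Suc.IH[OF this, unfolded n nR]
    show ?thesis
      unfolding sum.atMost_Suc distrib_left IH al r1 by (simp only: mult_ac)
  qed
  also have "\<dots> = (-1) ^ Suc R * (fps_X ^ (Suc R choose 2) * b) * (1 - a) * inv_qfact (n - Suc R) * inv_qfact (n + Suc R)"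
    unfolding r2 by (simp add: algebra_simps)
  finally show ?case
    unfolding n a_def[symmetric] ch power_add b_def by simp
qed

lemma bailey_alpha0_sum:
  assumes "n \<ge> 1"
  shows "(\<Sum>r\<le>n. bailey_alpha0 r * inv_qfact (n - r) * inv_qfact (n + r)) = (0 :: 'a::idom fps)"
proof -
  have "(1 - fps_X ^ n) * (\<Sum>r\<le>n. bailey_alpha0 r * inv_qfact (n - r) * inv_qfact (n + r)) = (0 :: 'a fps)"
    unfolding bailey_alpha0_partial[OF order_refl] by simp
  moreover have "fps_nth (1 - fps_X ^ n :: 'a fps) 0 \<noteq> 0"
    using assms by (simp add: fps_X_power_nth)
  then have "(1 - fps_X ^ n :: 'a fps) \<noteq> 0"
    by (metis fps_zero_nth)
  ultimately show ?thesis by (simp only: mult_eq_0_iff simp_thms)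
qed

text \<open>
  The even-indexed entries $\alpha_{2s}$ of Slater's Bailey pair relative to $1$ with
  $\beta_n=1/((q;q^2)_n(q)_n)$; its odd-indexed entries are $0$.
\<close>

definition slater_alpha :: "nat \<Rightarrow> 'a::comm_ring_1 fps" where
  "slater_alpha s = (if s = 0 then 1 else (-1) ^ s * fps_X ^ (s * (3 * s - 1)) * (1 + fps_X ^ (2 * s)))"

text \<open>
  The polynomial identity behind one step of the telescoping below, with $a=q^{n-2s-2}$, $b=q^{2s}$ and $x=q$.
\<close>

lemma slater_telescope_identity:
  fixes a b x :: "'a::comm_ring_1"
  shows "a * (1 - a * b * b * x * x * x) * (1 - a * b * b * x * x * x * x) -
         (1 + b * x * x) * ((1 - a * b * x * x) * (1 - a * a * b * b * x * x * x) - (1 - a) * (1 - a * b * b * x * x * x * x))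
       = - (a * (b * (b * (b * (x*x*x*x*x)))) * ((1 - a) * (x - a)))"
  by (simp add: algebra_simps)

text \<open>
  This is the certificate for the recurrence $(1-q^n)(1-q^{2n-1})\beta_n=\beta_{n-1}$. The term
  $\alpha_{2s}/((q)_{n-1-2s}(q)_{n-1+2s})$ of $\beta_{n-1}$ is $(1-q^{n-2s})(1-q^{n+2s})$ times the corresponding
  term of $\beta_n$, and the resulting differences telescope. The right-hand side vanishes at $S=\lfloor n/2\rfloor$.
\<close>

lemma slater_partial:
  assumes "2 * S \<le> n" "n \<ge> 1"
  shows "(\<Sum>s\<le>S. slater_alpha s * inv_qfact (n - 2 * s) * inv_qfact (n + 2 * s) *
             ((1 - fps_X ^ n) * (1 - fps_X ^ (2*n - 1)) - (1 - fps_X ^ (n - 2 * s)) * (1 - fps_X ^ (n + 2 * s))))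
         = ((-1) ^ S * fps_X ^ (n + 3 * S * (S + 1)) * (1 - fps_X ^ (n - 2*S)) * (1 - fps_X ^ (n - 2*S - 1))
             * inv_qfact (n - 2*S) * inv_qfact (n + 2*S) :: 'a::comm_ring_1 fps)"
  using assms(1)
proof (induction S)
  case 0
  have "2 * n - 1 = n + (n - 1)" using assms(2) by simp
  then have e: "fps_X ^ (2 * n - 1) = fps_X ^ n * (fps_X ^ (n - 1) :: 'a fps)" by (simp add: power_add)
  define y where "y = (fps_X ^ n :: 'a fps)"
  show ?case
    unfolding e by (simp add: slater_alpha_def flip: y_def) (simp add: algebra_simps)
next
  case (Suc S)
  define k where "k = n - 2 * Suc S"
  have nk: "n = k + 2 * S + 2" using Suc.prems by (simp add: k_def)
  define a b :: "'a fps" where "a = fps_X ^ k" and "b = fps_X ^ (2 * S)"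
  let ?X = "fps_X :: 'a fps"
  have r1: "inv_qfact k = (1 - ?X * a) * ((1 - ?X * (?X * a)) * inv_qfact (Suc (Suc k)))"
    using inv_qfact_Suc[of k, where 'a='a] inv_qfact_Suc[of "Suc k", where 'a='a] unfolding a_def power_Suc by (simp only:)
  have r2: "inv_qfact (n + 2 * S) = (1 - a * b * b * ?X * ?X * ?X) * ((1 - a * b * b * ?X * ?X * ?X * ?X) * inv_qfact (Suc (Suc (n + 2 * S))))"
  proof -
    have e: "Suc (n + 2 * S) = k + (2 * S + (2 * S + (1 + 1 + 1)))" 
       "Suc (Suc (n + 2 * S)) = k + (2 * S + (2 * S + (1 + 1 + 1 + 1)))"
      using nk by auto
    have "?X ^ Suc (n + 2 * S) = a * b * b * ?X * ?X * ?X"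
      unfolding e(1) power_add a_def b_def power_one_right by (simp only: mult_ac)
    moreover have "?X ^ Suc (Suc (n + 2 * S)) = a * b * b * ?X * ?X * ?X * ?X"
      unfolding e(2) power_add a_def b_def power_one_right by (simp only: mult_ac)
    ultimately show ?thesis
      using inv_qfact_Suc[of "n + 2 * S", where 'a='a] inv_qfact_Suc[of "Suc (n + 2 * S)", where 'a='a] by metis
  qed
  have p1: "?X ^ n = a * b * ?X * ?X" "?X ^ (2 * n - 1) = a * a * b * b * ?X * ?X * ?X"
    "?X ^ (n - 2 * Suc S) = a" "?X ^ (n + 2 * Suc S) = a * b * b * ?X * ?X * ?X * ?X"
  proof -
    have e: "n = k + (2 * S + (1 + 1))" "2 * n - 1 = k + (k + (2 * S + (2 * S + (1 + 1 + 1))))" 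
      "n + 2 * Suc S = k + (2 * S + (2 * S + (1 + 1 + 1 + 1)))"
      using nk by auto
    show "?X ^ n = a * b * ?X * ?X"
      unfolding e(1) power_add a_def b_def power_one_right by (simp only: mult_ac)
    show "?X ^ (2 * n - 1) = a * a * b * b * ?X * ?X * ?X"
      unfolding e(2) power_add a_def b_def power_one_right by (simp only: mult_ac)
    show "?X ^ (n + 2 * Suc S) = a * b * b * ?X * ?X * ?X * ?X"
      unfolding e(3) power_add a_def b_def power_one_right by (simp only: mult_ac)
    show "?X ^ (n - 2 * Suc S) = a"
      unfolding a_def k_def ..
  qed
  have e0: "Suc S * (3 * Suc S - 1) = 3 * S * (S + 1) + 2 * S + 2"
    by (simp add: algebra_simps)
  define c :: "'a fps" where "c = ?X ^ (3 * S * (S + 1))"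
  have sl: "slater_alpha (Suc S) = - ((-1) ^ S) * (c * b * ?X * ?X) * (1 + b * ?X * ?X)"
  proof -
    have e: "3 * S * (S + 1) + 2 * S + 2 = 3 * S * (S + 1) + (2 * S + (1 + 1))" "2 * Suc S = 2 * S + (1 + 1)"
      by auto
    have p: "?X ^ (3 * S * (S + 1) + 2 * S + 2) = c * b * ?X * ?X" "?X ^ (2 * Suc S) = b * ?X * ?X"
      unfolding e power_add c_def b_def power_one_right by (simp_all only: mult_ac)
    show ?thesis
      unfolding slater_alpha_def e0 p by (simp only: power_Suc) simp
  qed
  have e1: "n + 3 * Suc S * (Suc S + 1) = n + (3 * S * (S + 1) + (2 * S + 2 * S + (2 * S + (1 + 1 + 1 + 1 + 1 + 1))))"
    by (simp add: algebra_simps)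
  have pw: "?X ^ (n + 3 * Suc S * (Suc S + 1)) = a * b * ?X * ?X * (c * (b * b * (b * (?X*?X*?X*?X*?X*?X))))"
    unfolding e1 power_add c_def b_def[symmetric] p1 power_one_right by (simp only: mult_ac)
  have pc: "?X ^ (n + 3 * S * (S + 1)) = a * b * ?X * ?X * c"
    unfolding power_add c_def p1 ..
  have nn: "n - 2 * S = Suc (Suc k)" "n - 2 * S - 1 = Suc k" "n - 2 * Suc S = k" "n + 2 * Suc S = Suc (Suc (n + 2 * S))"
    using nk by auto
  define i j :: "'a fps" where "i = inv_qfact (Suc (Suc k))" and "j = inv_qfact (Suc (Suc (n + 2 * S)))"
  have bounded_partitions: "a * (1 - ?X ^ (k - 1)) * (1 - a) = (a - ?X ^ (k - 1) * a) * (1 - a)"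
    by (simp add: algebra_simps)
  define d where "d = ?X ^ (k - 1)"
  \<comment> \<open>For \<open>k = 0\<close> the truncated exponent \<open>k - 1\<close> is harmless, because then $1-a=0$.\<close>
  have ad: "(1 - a) * ?X * d = (1 - a) * a"
    by (cases k) (simp_all add: a_def d_def)
  have ad': "(1 - a) * (1 - d) * ?X = (1 - a) * (?X - a)"
  proof -
    have "(1 - a) * (1 - d) * ?X = (1 - a) * ?X - (1 - a) * ?X * d"
      by (simp add: algebra_simps)
    then show ?thesis
      unfolding ad by (simp only: right_diff_distrib)
  qed
  have factor_out: "sg * (a * b * ?X * ?X * c) * P1 * P2 * i * (Q1 * (Q2 * j)) + (- sg * (c * b * ?X * ?X) * R) * (P2 * (P1 * i)) * j * W
    = sg * (c * b * ?X * ?X) * (P2 * (P1 * i)) * j * (a * Q1 * Q2 - R * W)" for sg P1 P2 Q1 Q2 R W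
    by (simp add: right_diff_distrib mult_ac)
  note core = slater_telescope_identity[of a b ?X]
  show ?case
  proof -
    have IH: "(\<Sum>s\<le>S. slater_alpha s * inv_qfact (n - 2 * s) * inv_qfact (n + 2 * s) *
             ((1 - ?X ^ n) * (1 - ?X ^ (2*n - 1)) - (1 - ?X ^ (n - 2 * s)) * (1 - ?X ^ (n + 2 * s))))
       = (-1) ^ S * (a * b * ?X * ?X * c) * (1 - ?X * (?X * a)) * (1 - ?X * a) * i *
         ((1 - a * b * b * ?X * ?X * ?X) * ((1 - a * b * b * ?X * ?X * ?X * ?X) * j))"
    proof -
      have le: "2 * S \<le> n" using Suc.prems by simp
      have q: "?X ^ Suc (Suc k) = ?X * (?X * a)" "?X ^ Suc k = ?X * a"
        by (simp_all only: a_def power_Suc)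
      show ?thesis
        unfolding Suc.IH[OF le] unfolding pc nn diff_Suc_1 q r2 i_def j_def ..
    qed
    have "(\<Sum>s\<le>Suc S. slater_alpha s * inv_qfact (n - 2 * s) * inv_qfact (n + 2 * s) *
             ((1 - ?X ^ n) * (1 - ?X ^ (2*n - 1)) - (1 - ?X ^ (n - 2 * s)) * (1 - ?X ^ (n + 2 * s))))
      = (-1) ^ S * (a * b * ?X * ?X * c) * (1 - ?X * (?X * a)) * (1 - ?X * a) * i *
         ((1 - a * b * b * ?X * ?X * ?X) * ((1 - a * b * b * ?X * ?X * ?X * ?X) * j))
        + (- ((-1) ^ S) * (c * b * ?X * ?X) * (1 + b * ?X * ?X)) * ((1 - ?X * a) * ((1 - ?X * (?X * a)) * i)) * j *
          ((1 - a * b * ?X * ?X) * (1 - a * a * b * b * ?X * ?X * ?X) - (1 - a) * (1 - a * b * b * ?X * ?X * ?X * ?X))"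
      unfolding sum.atMost_Suc IH unfolding sl p1 unfolding nn r1 i_def j_def ..
    also have "\<dots> = (-1) ^ S * (c * b * ?X * ?X) * ((1 - ?X * a) * ((1 - ?X * (?X * a)) * i)) * j *
        (a * (1 - a * b * b * ?X * ?X * ?X) * (1 - a * b * b * ?X * ?X * ?X * ?X) -
         (1 + b * ?X * ?X) * ((1 - a * b * ?X * ?X) * (1 - a * a * b * b * ?X * ?X * ?X) - (1 - a) * (1 - a * b * b * ?X * ?X * ?X * ?X)))"
      by (rule factor_out)
    also have "\<dots> = (-1) ^ S * (c * b * ?X * ?X) * ((1 - ?X * a) * ((1 - ?X * (?X * a)) * i)) * j *
        (- (a * (b * (b * (b * (?X*?X*?X*?X*?X)))) * ((1 - a) * (?X - a))))"
      unfolding core ..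
    also have "\<dots> = (-1) ^ Suc S * (a * b * ?X * ?X * (c * (b * b * (b * (?X*?X*?X*?X*?X))))) *
           ((1 - a) * (?X - a)) * ((1 - ?X * a) * ((1 - ?X * (?X * a)) * i)) * j"
      by (simp add: mult_ac)
    also have "\<dots> = (-1) ^ Suc S * (a * b * ?X * ?X * (c * (b * b * (b * (?X*?X*?X*?X*?X*?X))))) *
           (1 - a) * (1 - d) * ((1 - ?X * a) * ((1 - ?X * (?X * a)) * i)) * j"
      unfolding ad'[symmetric] by (simp add: mult_ac)
    finally show ?case
      unfolding pw p1(3) unfolding nn r1 i_def j_def d_def by simp
  qed
qed

text \<open>
  Both sides satisfy the same first-order recurrence in $n$.
\<close>

lemma slater_sum:
  "(\<Sum>s\<le>n div 2. slater_alpha s * inv_qfact (n - 2 * s) * inv_qfact (n + 2 * s))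
     = (fps_recip (qpoch fps_X (fps_X ^ 2) n * qpoch fps_X fps_X n) :: 'a::idom fps)"
proof (induction n)
  case 0
  then show ?case by (simp add: slater_alpha_def)
next
  case (Suc n)
  define B where "B n = (\<Sum>s\<le>n div 2. slater_alpha s * inv_qfact (n - 2 * s) * inv_qfact (n + 2 * s) :: 'a fps)" for n
  define D where "D n = (qpoch fps_X (fps_X ^ 2) n * qpoch fps_X fps_X n :: 'a fps)" for n
  let ?X = "fps_X :: 'a fps"
  define w where "w = (1 - ?X ^ Suc n) * (1 - ?X ^ (2 * Suc n - 1))"
  define S where "S = Suc n div 2"
  have "(?X ^ (Suc n - 2 * S) - 1) * (?X ^ (Suc n - 2 * S - 1) - 1) = 0"
    unfolding S_def by (cases "even n") (auto elim!: evenE oddE)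
  then have "(1 - ?X ^ (Suc n - 2 * S)) * (1 - ?X ^ (Suc n - 2 * S - 1)) = 0"
    by (simp add: algebra_simps)
  then have 0: "(\<Sum>s\<le>S. slater_alpha s * inv_qfact (Suc n - 2 * s) * inv_qfact (Suc n + 2 * s) *
     (w - (1 - ?X ^ (Suc n - 2 * s)) * (1 - ?X ^ (Suc n + 2 * s)))) = 0"
    unfolding w_def by (subst slater_partial) (auto simp: S_def mult.assoc)
  have "B n = (\<Sum>s\<le>S. slater_alpha s * inv_qfact (Suc n - 2 * s) * inv_qfact (Suc n + 2 * s) *
     ((1 - ?X ^ (Suc n - 2 * s)) * (1 - ?X ^ (Suc n + 2 * s))))"
    unfolding B_def
  proof (rule sum.mono_neutral_cong_left)
    fix s assume "s \<in> {..n div 2}"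
    then have s: "Suc n - 2 * s = Suc (n - 2 * s)" by auto
    show "slater_alpha s * inv_qfact (n - 2 * s) * inv_qfact (n + 2 * s) = slater_alpha s * inv_qfact (Suc n - 2 * s) * inv_qfact (Suc n + 2 * s) *
     ((1 - ?X ^ (Suc n - 2 * s)) * (1 - ?X ^ (Suc n + 2 * s)))"
      unfolding s using inv_qfact_Suc[of "n - 2 * s", where 'a='a] inv_qfact_Suc[of "n + 2 * s", where 'a='a] by (simp add: mult_ac)
  next
    show "\<forall>i\<in>{..S} - {..n div 2}. slater_alpha i * inv_qfact (Suc n - 2 * i) * inv_qfact (Suc n + 2 * i) *
       ((1 - ?X ^ (Suc n - 2 * i)) * (1 - ?X ^ (Suc n + 2 * i))) = 0"
    proof
      fix i assume "i \<in> {..S} - {..n div 2}"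
      then have "Suc n - 2 * i = 0" by (auto simp: S_def)
      then show "slater_alpha i * inv_qfact (Suc n - 2 * i) * inv_qfact (Suc n + 2 * i) *
       ((1 - ?X ^ (Suc n - 2 * i)) * (1 - ?X ^ (Suc n + 2 * i))) = 0" by simp
    qed
  qed (auto simp: S_def)
  also have "\<dots> = w * B (Suc n)"
    using 0 unfolding B_def S_def[symmetric] by (simp add: right_diff_distrib sum_subtractf sum_distrib_left mult_ac)
  finally have Bw: "w * B (Suc n) = B n" ..
  have "?X * (?X ^ 2) ^ n = ?X ^ (2 * Suc n - 1)"
    unfolding power_mult[symmetric] power_Suc[symmetric] by (rule power_cong_exponent) simp
  then have D: "D (Suc n) = D n * w"
    by (simp add: D_def w_def qpoch_Suc mult_ac)
  have "D (Suc n) * B (Suc n) = D n * B n"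
    unfolding D Bw[symmetric] by (simp add: mult_ac)
  also have "\<dots> = 1"
    using Suc.IH unfolding B_def D_def by (simp add: fps_recip_mult qpoch_X_nth_0)
  finally show ?case
    unfolding B_def[symmetric] D_def[symmetric]
    by (intro fps_recip_unique[symmetric]) (simp_all add: D_def qpoch_X_nth_0)
qed

text \<open>
  The difference of the two $\alpha$-sequences. It vanishes at $r=0$.
\<close>

definition bailey_gamma :: "nat \<Rightarrow> 'a::comm_ring_1 fps" where
  "bailey_gamma r = (if even r then slater_alpha (r div 2) else 0) - bailey_alpha0 r"

text \<open>
  For $n\ge1$ the unit pair contributes nothing to $\beta_n$, so it can be subtracted to remove the index $0$.
\<close>

lemma bailey_gamma_sum:
  assumes "n \<ge> 1"
  shows "fps_recip (qpoch fps_X (fps_X ^ 2) n * qpoch fps_X fps_X n)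
    = (\<Sum>r=1..n. bailey_gamma r * inv_qfact (n - r) * inv_qfact (n + r) :: 'a::idom fps)"
proof -
  define f where "f r = ((if even r then slater_alpha (r div 2) else 0) * inv_qfact (n - r) * inv_qfact (n + r) :: 'a fps)" for r
  have "(\<Sum>s\<le>n div 2. slater_alpha s * inv_qfact (n - 2 * s) * inv_qfact (n + 2 * s)) = (\<Sum>s\<in>{..n div 2}. f (2 * s))"
    by (simp add: f_def)
  also have "\<dots> = sum f ((\<lambda>s. 2 * s) ` {..n div 2})"
    by (subst sum.reindex) (auto simp: inj_on_def)
  also have "\<dots> = sum f {..n}"
  proof (rule sum.mono_neutral_left)
    show "\<forall>i\<in>{..n} - (\<lambda>s. 2 * s) ` {..n div 2}. f i = 0"
    proof
      fix i assume i: "i \<in> {..n} - (\<lambda>s. 2 * s) ` {..n div 2}"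
      have "odd i"
      proof
        assume "even i"
        then have "i = 2 * (i div 2)" "i div 2 \<in> {..n div 2}" using i by auto
        then show False using i by blast
      qed
      then show "f i = 0" by (simp add: f_def)
    qed
  qed auto
  finally have "fps_recip (qpoch fps_X (fps_X ^ 2) n * qpoch fps_X fps_X n) = sum f {..n}"
    using slater_sum[of n, where 'a='a] by simp
  also have "\<dots> = sum f {..n} - (\<Sum>r\<le>n. bailey_alpha0 r * inv_qfact (n - r) * inv_qfact (n + r))"
    using bailey_alpha0_sum[OF assms, where 'a='a] by simp
  also have "\<dots> = (\<Sum>r\<le>n. bailey_gamma r * inv_qfact (n - r) * inv_qfact (n + r))"
    by (simp add: f_def bailey_gamma_def left_diff_distrib sum_subtractf)
  also have "{..n} = insert 0 {1..n}" by auto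
  also have "(\<Sum>r\<in>insert 0 {1..n}. bailey_gamma r * inv_qfact (n - r) * inv_qfact (n + r)) = (\<Sum>r=1..n. bailey_gamma r * inv_qfact (n - r) * inv_qfact (n + r) :: 'a fps)"
    by (subst sum.insert) (simp_all add: bailey_gamma_def slater_alpha_def bailey_alpha0_def)
  finally show ?thesis .
qed

section \<open>The generating function as a Lambert-type series\<close>

lemma fps_divide_unit:
  fixes f g h :: "'a::comm_ring_1 fps"
  assumes "f * g = h" "fps_nth f 0 = 1"
  shows "g = h * fps_recip f"
proof -
  have "h * fps_recip f = (f * fps_recip f) * g"
    unfolding assms(1)[symmetric] by (simp only: mult_ac)
  then show ?thesis
    by (simp add: fps_recip_mult[OF assms(2)])
qed

text \<open>
  The denominator that carries the dependence on $z$ after summation over $n$.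
\<close>

definition crank_factor :: "nat \<Rightarrow> laurent_poly fps" where
  "crank_factor r = (1 - zpow 1 * qvar ^ r) * (1 - zpow (-1) * qvar ^ r)"

lemma zpow_inverse: "zpow 1 * zpow (-1) = 1"
  by (simp add: zpow_def fps_const_mult[symmetric] Poly_Mapping.mult_single flip: single_one)

abbreviation zfactors :: "nat \<Rightarrow> laurent_poly fps" where
  "zfactors n \<equiv> qpoch (zpow 1 * qvar) qvar n * qpoch (zpow (-1) * qvar) qvar n"

abbreviation zfactors_inf :: "laurent_poly fps" where
  "zfactors_inf \<equiv> qpoch_inf (zpow 1 * qvar) qvar * qpoch_inf (zpow (-1) * qvar) qvar"

lemma zfactors_inf_nth_0: "fps_nth zfactors_inf 0 = 1"
  by (simp add: qpoch_inf_aux)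

lemma zfactors_nth_0: "fps_nth (zfactors n) 0 = 1"
  by (simp add: qpoch_nth_0)

lemma crank_factor_nth_0: "r \<ge> 1 \<Longrightarrow> fps_nth (crank_factor r) 0 = 1"
  by (cases r) (simp_all add: crank_factor_def)

text \<open>
  The tails of the products in the $n$-th term are written as a common reciprocal times a finite
  product, to which \<open>bailey_kernel_sum\<close> applies.
\<close>

lemma C1_term_Suc:
  "C1_term (Suc n) = qvar ^ Suc n * (zfactors n * fps_recip zfactors_inf)
     * fps_recip (qpoch qvar (qvar ^ 2) (Suc n) * qpoch qvar qvar (Suc n))"
proof -
  define P where "P = qpoch_inf (zpow 1 * qvar ^ Suc n) qvar * qpoch_inf (zpow (-1) * qvar ^ Suc n) qvar"
  have P0: "fps_nth P 0 = 1"
    unfolding P_def by (rule C1_denominators) simp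
  have s: "qpoch_inf (zpow i * qvar) qvar = qpoch (zpow i * qvar) qvar n * qpoch_inf (zpow i * qvar ^ Suc n) qvar" for i
    by (subst qpoch_inf_split[where n = n]) (simp_all add: mult_ac)
  have "zfactors_inf = zfactors n * P"
    unfolding s P_def by (simp only: mult_ac)
  then have "fps_recip zfactors_inf = fps_recip (zfactors n) * fps_recip P"
    by (simp only: fps_recip_times[OF zfactors_nth_0 P0])
  then have "zfactors n * fps_recip zfactors_inf = (zfactors n * fps_recip (zfactors n)) * fps_recip P"
    by (simp only: mult_ac)
  then have "fps_recip P = zfactors n * fps_recip zfactors_inf"
    by (simp only: fps_recip_mult[OF zfactors_nth_0] mult_1)
  then show ?thesis
    unfolding C1_term_def P_def by (simp only:)
qed

text \<open>
  The order of summation over $n$ and the index $r$ of the Bailey pair is exchanged, and the inner sum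
  is evaluated by \<open>bailey_kernel_sum\<close>. For the finite sum this is still an exact identity.
\<close>

lemma C1_sum_finite:
  "(\<Sum>n<M. C1_term (Suc n)) = fps_recip zfactors_inf *
     (\<Sum>r=1..M. bailey_gamma r * qvar ^ r * zfactors M * inv_qfact (M - r) * inv_qfact (M + r) * fps_recip (crank_factor r))"
proof -
  let ?S = "\<lambda>r. \<Sum>n=r..M. qvar ^ n * zfactors (n - 1) * inv_qfact (n - r) * inv_qfact (n + r)"
  have inner: "(?S r)
      = qvar ^ r * zfactors M * inv_qfact (M - r) * inv_qfact (M + r) * fps_recip (crank_factor r)"
    if r: "1 \<le> r" "r \<le> M" for r
  proof -
    obtain r' where r': "r = Suc r'" using r by (cases r) auto
    have "(?S r)
       = (\<Sum>k\<in>{..M - r}. qvar ^ (Suc r' + k) * zfactors (r' + k) * inv_qfact k * inv_qfact (2 * Suc r' + k))"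
      by (rule sum.reindex_bij_witness[of _ "\<lambda>k. r + k" "\<lambda>n. n - r"])
         (use r in \<open>auto simp: r' mult_2 algebra_simps\<close>)
    moreover have "crank_factor r * (\<Sum>k\<in>{..M - r}. qvar ^ (Suc r' + k) * zfactors (r' + k) * inv_qfact k * inv_qfact (2 * Suc r' + k))
       = qvar ^ Suc r' * zfactors (Suc r' + (M - r)) * inv_qfact (M - r) * inv_qfact (2 * Suc r' + (M - r))"
      unfolding crank_factor_def r' by (rule bailey_kernel_sum[OF zpow_inverse])
    moreover have "Suc r' + (M - r) = M" "2 * Suc r' + (M - r) = M + r" "Suc r' = r"
      using r r' by auto
    ultimately have "crank_factor r * (?S r)
       = qvar ^ r * zfactors M * inv_qfact (M - r) * inv_qfact (M + r)"
      by (simp only:)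
    then show ?thesis
      by (rule fps_divide_unit) (rule crank_factor_nth_0[OF r(1)])
  qed
  have "(\<Sum>n<M. C1_term (Suc n)) = (\<Sum>n=1..M. C1_term n)"
    by (rule sum.reindex_bij_witness[of _ "\<lambda>n. n - 1" Suc]) auto
  also have "\<dots> = (\<Sum>n=1..M. \<Sum>r=1..n. fps_recip zfactors_inf * (bailey_gamma r * (qvar ^ n * zfactors (n - 1) * inv_qfact (n - r) * inv_qfact (n + r))))"
  proof (rule sum.cong)
    fix n assume n: "n \<in> {1..M}"
    then obtain n' where n': "n = Suc n'" by (cases n) auto
    have "C1_term n = qvar ^ n * (zfactors (n - 1) * fps_recip zfactors_inf) * (\<Sum>r=1..n. bailey_gamma r * inv_qfact (n - r) * inv_qfact (n + r))"
      using C1_term_Suc[of n'] bailey_gamma_sum[of n, where 'a=laurent_poly] n' by (simp only: diff_Suc_1)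
    then show "C1_term n = (\<Sum>r=1..n. fps_recip zfactors_inf * (bailey_gamma r * (qvar ^ n * zfactors (n - 1) * inv_qfact (n - r) * inv_qfact (n + r))))"
      by (simp only: sum_distrib_left mult_ac)
  qed simp
  also have "\<dots> = (\<Sum>r=1..M. \<Sum>n=r..M. fps_recip zfactors_inf * (bailey_gamma r * (qvar ^ n * zfactors (n - 1) * inv_qfact (n - r) * inv_qfact (n + r))))"
    unfolding sum.Sigma[OF finite_atLeastAtMost ballI[OF finite_atLeastAtMost]]
    by (rule sum.reindex_bij_witness[of _ "\<lambda>(r, n). (n, r)" "\<lambda>(n, r). (r, n)"]) auto
  also have "\<dots> = (\<Sum>r=1..M. fps_recip zfactors_inf * (bailey_gamma r * (?S r)))"
    by (simp only: sum_distrib_left)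
  also have "\<dots> = (\<Sum>r=1..M. fps_recip zfactors_inf * (bailey_gamma r * (qvar ^ r * zfactors M * inv_qfact (M - r) * inv_qfact (M + r) * fps_recip (crank_factor r))))"
    by (intro sum.cong refl) (simp only: inner atLeastAtMost_iff)
  finally show ?thesis
    by (simp only: sum_distrib_left mult_ac)
qed

lemma C1_series_agree: "agree_upto M (suminf (\<lambda>n. C1_term (Suc n))) (\<Sum>n<M. C1_term (Suc n))"
proof -
  have small: "fps_nth (C1_term n) j = 0" if "j < n" for j n
    using that by (simp add: C1_term_def mult.assoc fps_X_power_mult_nth)
  define S where "S n = (\<Sum>k<n. C1_term (Suc k))" for n
  have stable: "fps_nth (S n) j = fps_nth (S j) j" if "j \<le> n" for j n
    using that by (induction n rule: dec_induct) (auto simp: S_def small)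
  have "S \<longlonglongrightarrow> suminf (\<lambda>n. C1_term (Suc n))"
    unfolding S_def[abs_def] by (rule summable_LIMSEQ[OF summable_C1_term])
  moreover have "S \<longlonglongrightarrow> Abs_fps (\<lambda>j. fps_nth (S j) j)"
  proof (rule tendsto_fpsI)
    show "eventually (\<lambda>n. fps_nth (S n) j = fps_nth (Abs_fps (\<lambda>j. fps_nth (S j) j)) j) sequentially" for j
      using eventually_ge_at_top[of j] by eventually_elim (unfold fps_nth_Abs_fps, rule stable)
  qed
  ultimately have "suminf (\<lambda>n. C1_term (Suc n)) = Abs_fps (\<lambda>j. fps_nth (S j) j)"
    by (rule LIMSEQ_unique)
  then show ?thesis
    unfolding agree_upto_def S_def[symmetric, of M] by (auto simp: stable[of _ M])
qed

lemma qpoch_even_odd: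
  "qpoch x (x ^ 2) n * qpoch (x ^ 2) (x ^ 2) n = qpoch x x (2 * n)"
proof (induction n)
  case (Suc n)
  have "qpoch x (x ^ 2) (Suc n) * qpoch (x ^ 2) (x ^ 2) (Suc n)
      = (qpoch x (x ^ 2) n * qpoch (x ^ 2) (x ^ 2) n) * ((1 - x * (x ^ 2) ^ n) * (1 - x ^ 2 * (x ^ 2) ^ n))"
    by (simp only: qpoch_Suc mult_ac)
  moreover have "(x ^ 2) ^ n = x ^ (2 * n)" "x ^ 2 * (x ^ 2) ^ n = x * x ^ Suc (2 * n)"
    by (simp_all add: power_mult power2_eq_square mult.assoc)
  moreover have "2 * Suc n = Suc (Suc (2 * n))"
    by simp
  ultimately show ?case
    by (simp only: Suc.IH qpoch_Suc mult.assoc)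
qed simp

text \<open>
  Modulo $q^{M+1}$ the products that contain $z$ cancel, and the remaining prefactor is
  $(q;q^2)_\infty(q)_\infty/(q)_\infty^2=1/(q^2;q^2)_\infty$.
\<close>

lemma C1_gen_agree:
  "agree_upto M C1_gen (fps_recip (qpoch (qvar ^ 2) (qvar ^ 2) M) *
     (\<Sum>r=1..M. bailey_gamma r * qvar ^ r * fps_recip (crank_factor r)))"
proof -
  let ?T = "\<Sum>r=1..M. bailey_gamma r * qvar ^ r * fps_recip (crank_factor r)"
  let ?I = "qpoch qvar qvar M :: laurent_poly fps"
  let ?inv_qfact = "inv_qfact M :: laurent_poly fps"
  let ?A = "qpoch qvar (qvar ^ 2) M :: laurent_poly fps" and ?B = "qpoch (qvar ^ 2) (qvar ^ 2) M :: laurent_poly fps"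
  have rqa: "agree_upto M' (inv_qfact n) (inv_qfact M' :: laurent_poly fps)" if "M' \<le> n" for M' n
    unfolding inv_qfact_def by (intro agree_recip qpoch_agree qpoch_nth_0) (simp_all add: that)
  have terms: "agree_upto M (bailey_gamma r * qvar ^ r * zfactors M * inv_qfact (M - r) * inv_qfact (M + r) * fps_recip (crank_factor r))
      (bailey_gamma r * qvar ^ r * zfactors_inf * ?inv_qfact * ?inv_qfact * fps_recip (crank_factor r))" if "r \<in> {1..M}" for r
  proof -
    have Z: "agree_upto M (zfactors M) zfactors_inf"
      by (intro agree_mult agree_sym[OF qpoch_inf_agree]) simp_all
    have "agree_upto (M - r) (inv_qfact (M - r)) ?inv_qfact"
      by (rule agree_sym[OF rqa]) simp
    then have "agree_upto M (qvar ^ r * inv_qfact (M - r)) (qvar ^ r * ?inv_qfact)"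
      by (rule agree_X_power_mult)
    from agree_mult[OF agree_mult[OF agree_mult[OF this Z] rqa[of M "M + r"]] agree_refl[of M "bailey_gamma r * fps_recip (crank_factor r)"]]
    show ?thesis by (simp add: mult_ac)
  qed
  have "agree_upto M (\<Sum>n<M. C1_term (Suc n)) (fps_recip zfactors_inf * (\<Sum>r=1..M. bailey_gamma r * qvar ^ r * zfactors_inf * ?inv_qfact * ?inv_qfact * fps_recip (crank_factor r)))"
    unfolding C1_sum_finite by (rule agree_mult[OF agree_refl agree_sum[OF terms]])
  also have "fps_recip zfactors_inf * (\<Sum>r=1..M. bailey_gamma r * qvar ^ r * zfactors_inf * ?inv_qfact * ?inv_qfact * fps_recip (crank_factor r))
     = (zfactors_inf * fps_recip zfactors_inf) * (?inv_qfact * ?inv_qfact * ?T)"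
    by (simp only: sum_distrib_left mult_ac)
  also have "zfactors_inf * fps_recip zfactors_inf = 1"
    by (rule fps_recip_mult[OF zfactors_inf_nth_0])
  finally have 1: "agree_upto M (suminf (\<lambda>n. C1_term (Suc n))) (?inv_qfact * ?inv_qfact * ?T)"
    using C1_series_agree agree_trans by (simp only: mult_1) blast
  have 2: "agree_upto M (qpoch_inf qvar (qvar ^ 2) * qpoch_inf qvar qvar) (?A * ?I)"
    by (intro agree_mult qpoch_inf_agree) simp_all
  have I: "?I * ?inv_qfact = 1"
    unfolding inv_qfact_def by (rule fps_recip_mult[OF qpoch_X_nth_0])
  have "agree_upto M ?I (qpoch qvar qvar (2 * M))"
    by (intro agree_sym[OF qpoch_agree]) simp_all
  then have "agree_upto M ?I (?A * ?B)"
    by (simp add: qpoch_even_odd)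
  then have "agree_upto M (?inv_qfact * fps_recip ?B * ?I) (?inv_qfact * fps_recip ?B * (?A * ?B))"
    by (intro agree_mult agree_refl)
  moreover have "?inv_qfact * fps_recip ?B * ?I = fps_recip ?B * (?I * ?inv_qfact)"
    by (simp only: mult_ac)
  moreover have "?inv_qfact * fps_recip ?B * (?A * ?B) = ?A * ?inv_qfact * (?B * fps_recip ?B)"
    by (simp only: mult_ac)
  moreover have "?B * fps_recip ?B = 1"
    by (rule fps_recip_mult) (simp add: qpoch_nth_0)
  ultimately have 3: "agree_upto M (?A * ?inv_qfact) (fps_recip ?B)"
    using I agree_sym by (simp only: mult_1_right) blast
  have "agree_upto M C1_gen (?A * ?I * (?inv_qfact * ?inv_qfact * ?T))"
    unfolding C1_gen_def by (rule agree_mult[OF 2 1])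
  also have "?A * ?I * (?inv_qfact * ?inv_qfact * ?T)
     = (?A * ?inv_qfact) * (?I * ?inv_qfact) * ?T"
    by (simp only: mult_ac)
  also have "agree_upto M \<dots> (fps_recip ?B * 1 * ?T)"
    unfolding I by (intro agree_mult agree_refl 3)
  finally show ?thesis by simp
qed

section \<open>Coefficients of powers of $z$\<close>

definition zcoeff :: "int \<Rightarrow> laurent_poly fps \<Rightarrow> int fps" where
  "zcoeff m f = Abs_fps (\<lambda>n. Poly_Mapping.lookup (fps_nth f n) m)"

text \<open>
  The embedding of the power series in $q$ with integer coefficients as the series of degree $0$ in $z$.
\<close>

definition lift_q :: "int fps \<Rightarrow> laurent_poly fps" where
  "lift_q g = Abs_fps (\<lambda>n. Poly_Mapping.single 0 (fps_nth g n))"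

lemma lookup_single_mult:
  "Poly_Mapping.lookup (Poly_Mapping.single i a * p) m = a * Poly_Mapping.lookup p (m - i)"
  for p :: laurent_poly
proof -
  have "Sum_any (\<lambda>q. Poly_Mapping.lookup p q when m = i + q) = Poly_Mapping.lookup p (m - i)"
  proof -
    have "(m = i + q) = (q = m - i)" for q by auto
    then show ?thesis by simp
  qed
  then show ?thesis
    by (simp add: lookup_mult lookup_single when_mult)
qed

lemma lift_q_1: "lift_q 1 = 1"
  by (auto simp: lift_q_def fps_eq_iff)

lemma lift_q_X: "lift_q fps_X = fps_X"
  by (auto simp: lift_q_def fps_eq_iff)

lemma lift_q_diff: "lift_q (f - g) = lift_q f - lift_q g"
  by (auto simp: lift_q_def fps_eq_iff single_diff)

lemma lift_q_add: "lift_q (f + g) = lift_q f + lift_q g"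
  by (auto simp: lift_q_def fps_eq_iff single_add)

lemma lift_q_mult: "lift_q (f * g) = lift_q f * lift_q g"
proof -
  have "Poly_Mapping.single (0::int) (sum h {0..n}) = (\<Sum>i=0..n. Poly_Mapping.single 0 (h i :: int))" for h and n :: nat
    by (induction n) (simp_all add: single_add)
  then show ?thesis
    by (auto simp: lift_q_def fps_eq_iff fps_mult_nth mult_single)
qed

lemma zcoeff_sum: "zcoeff m (sum f I) = (\<Sum>i\<in>I. zcoeff m (f i))"
  by (induction I rule: infinite_finite_induct) (auto simp: zcoeff_def fps_eq_iff lookup_add)

lemma zcoeff_lift_q_mult: "zcoeff m (lift_q g * f) = g * zcoeff m f"
proof -
  have "Poly_Mapping.lookup (\<Sum>i=0..n. Poly_Mapping.single 0 (fps_nth g i) * fps_nth f (n - i)) m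
     = (\<Sum>i=0..n. fps_nth g i * Poly_Mapping.lookup (fps_nth f (n - i)) m)" for n
    by (simp add: lookup_sum lookup_single_mult)
  then show ?thesis
    by (simp add: zcoeff_def lift_q_def fps_eq_iff fps_mult_nth)
qed

lemma zcoeff_zpow_mult: "zcoeff m (zpow i * f) = zcoeff (m - i) f"
  by (simp add: zcoeff_def zpow_def fps_eq_iff lookup_single_mult)

lemma zcoeff_eqI: "(\<And>m. zcoeff m f = zcoeff m g) \<Longrightarrow> f = g"
  by (simp add: zcoeff_def fps_eq_iff poly_mapping_eqI)

lemma zcoeff_diff: "zcoeff m (f - g) = zcoeff m f - zcoeff m g"
  by (simp add: zcoeff_def fps_eq_iff lookup_minus)

lemma zcoeff_1: "zcoeff m 1 = (if m = 0 then 1 else 0)"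
  by (auto simp: zcoeff_def fps_eq_iff lookup_one when_def)

lemma zcoeff_agree: "agree_upto M f g \<Longrightarrow> agree_upto M (zcoeff m f) (zcoeff m g)"
  by (simp add: agree_upto_def zcoeff_def)

lemma lift_q_power: "lift_q (f ^ n) = lift_q f ^ n"
  by (induction n) (simp_all add: lift_q_1 lift_q_mult)

lemma lift_q_qpoch: "lift_q (qpoch a q n) = qpoch (lift_q a) (lift_q q) n"
  by (induction n) (simp_all add: qpoch_Suc lift_q_1 lift_q_mult lift_q_diff lift_q_power)

lemma lift_q_recip: "fps_nth f 0 = 1 \<Longrightarrow> lift_q (fps_recip f) = fps_recip (lift_q f)"
proof -
  assume f: "fps_nth f 0 = 1"
  have "lift_q f * lift_q (fps_recip f) = 1"
    by (simp add: lift_q_mult[symmetric] fps_recip_mult[OF f] lift_q_1)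
  moreover have "fps_nth (lift_q f) 0 = 1"
    by (simp add: lift_q_def f)
  ultimately show ?thesis
    using fps_recip_unique by metis
qed

text \<open>
  The partial fraction expansion $\frac{1}{(1-zx)(1-z^{-1}x)}=\frac{1}{1-x^2}\sum_{m\in\mathbb{Z}}z^mx^{|m|}$ at
  $x=q^r$. The right-hand side is multiplied out to $1$, and this is checked for each power of $z$: the coefficients satisfy the
  recurrence $(1+x^2)h_m-xh_{m-1}-xh_{m+1}=\delta_{m,0}$.
\<close>

lemma zcoeff_recip_crank_factor:
  assumes "r \<ge> 1"
  shows "zcoeff m (fps_recip (crank_factor r))
    = fps_X ^ (r * nat \<bar>m\<bar>) * fps_recip (1 - fps_X ^ (2 * r))"
proof -
  define g :: "int fps" where "g = fps_recip (1 - fps_X ^ (2 * r))"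
  define x :: "int fps" where "x = fps_X ^ r"
  define h where "h m = x ^ nat \<bar>m\<bar> * g" for m :: int
  define H :: "laurent_poly fps" where
    "H = Abs_fps (\<lambda>n. \<Sum>m\<in>{- int n..int n}. Poly_Mapping.single m (fps_nth (h m) n))"
  have g: "(1 - x * x) * g = 1"
  proof -
    have "fps_nth (1 - fps_X ^ (2 * r) :: int fps) 0 = 1"
      using assms by (simp add: fps_X_power_nth)
    from fps_recip_mult[OF this] show ?thesis
      by (simp only: g_def x_def mult_2 power_add)
  qed
  have h0: "fps_nth (h m) n = 0" if "m \<notin> {- int n..int n}" for m n
  proof -
    have "n < nat \<bar>m\<bar>" using that by auto
    also have "\<dots> \<le> r * nat \<bar>m\<bar>" using assms by simp
    finally show ?thesis
      by (simp only: h_def x_def power_mult[symmetric] fps_X_power_mult_nth if_True)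
  qed
  have H: "zcoeff m H = h m" for m
    using h0[of m] by (auto simp: zcoeff_def H_def fps_eq_iff lookup_sum lookup_single when_def)
  have rec: "zcoeff m (crank_factor r * H) = (1 + x * x) * h m - x * h (m - 1) - x * h (m + 1)" for m
  proof -
    have "crank_factor r * H = lift_q (1 + x * x) * H - lift_q x * (zpow 1 * H) - lift_q x * (zpow (-1) * H)"
    proof -
      have e: "lift_q x = qvar ^ r"
        by (simp add: x_def lift_q_power lift_q_X)
      have "crank_factor r = 1 + (zpow 1 * zpow (-1)) * (qvar ^ r * qvar ^ r) - qvar ^ r * zpow 1 - qvar ^ r * zpow (-1)"
        unfolding crank_factor_def by (simp add: algebra_simps)
      then have "crank_factor r = lift_q (1 + x * x) - lift_q x * zpow 1 - lift_q x * zpow (-1)"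
        by (simp only: zpow_inverse e lift_q_add lift_q_mult lift_q_1 mult_1)
      then show ?thesis
        by (simp only: left_diff_distrib mult.assoc)
    qed
    then show ?thesis
      by (simp only: zcoeff_diff zcoeff_lift_q_mult zcoeff_zpow_mult H diff_minus_eq_add)
  qed
  have "crank_factor r * H = 1"
  proof (rule zcoeff_eqI)
    fix m :: int
    show "zcoeff m (crank_factor r * H) = zcoeff m 1"
    proof (cases "m = 0")
      case True
      have "(1 + x * x) * h 0 - x * h (-1) - x * h 1 = (1 - x * x) * g"
        by (simp add: h_def algebra_simps)
      then show ?thesis
        using True by (simp add: rec g zcoeff_1)
    next
      case False
      have "(1 + x * x) * x ^ Suc k - x * x ^ k - x * x ^ Suc (Suc k) = 0" for k
        by (simp add: algebra_simps)
      then have *: "(1 + x * x) * (x ^ Suc k * g) - x * (x ^ k * g) - x * (x ^ Suc (Suc k) * g) = 0" for k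
        by (metis (no_types, lifting) left_diff_distrib mult.assoc mult_zero_left)
      show ?thesis
      proof (cases "m > 0")
        case True
        define k where "k = nat (m - 1)"
        have "nat \<bar>m\<bar> = Suc k" "nat \<bar>m - 1\<bar> = k" "nat \<bar>m + 1\<bar> = Suc (Suc k)"
          using True by (auto simp: k_def)
        then show ?thesis
          using *[of k] False by (simp only: rec h_def zcoeff_1 if_False)
      next
        case neg: False
        define k where "k = nat (- m - 1)"
        have "nat \<bar>m\<bar> = Suc k" "nat \<bar>m - 1\<bar> = Suc (Suc k)" "nat \<bar>m + 1\<bar> = k"
          using neg False by (auto simp: k_def)
        moreover have "a - b - c = a - c - b" for a b c :: "int fps"
          by simp
        ultimately show ?thesis
          using *[of k] False by (simp only: rec h_def zcoeff_1 if_False)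
      qed
    qed
  qed
  then have "fps_recip (crank_factor r) = H"
    by (rule fps_recip_unique) (rule crank_factor_nth_0[OF assms])
  then show ?thesis
    by (simp only: H h_def x_def power_mult g_def)
qed

lemma lift_q_bailey_gamma: "lift_q (bailey_gamma r) = bailey_gamma r"
proof -
  have "lift_q 0 = 0" by (simp add: lift_q_def fps_eq_iff)
  moreover have "lift_q (- 1) = - 1" using lift_q_diff[of 0 1] \<open>lift_q 0 = 0\<close> by (simp add: lift_q_1)
  ultimately show ?thesis
    by (simp add: bailey_gamma_def slater_alpha_def bailey_alpha0_def lift_q_diff lift_q_mult lift_q_power lift_q_X lift_q_add lift_q_1)
qed

lemma N_C1_agree:
  "agree_upto M (Abs_fps (N_C1 m)) (fps_recip (qpoch (fps_X ^ 2) (fps_X ^ 2) M) *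
     (\<Sum>r=1..M. bailey_gamma r * fps_X ^ r * (fps_X ^ (r * nat \<bar>m\<bar>) * fps_recip (1 - fps_X ^ (2 * r)))))"
proof -
  have z: "Abs_fps (N_C1 m) = zcoeff m C1_gen"
    by (simp add: zcoeff_def N_C1_def fps_eq_iff)
  have b: "fps_recip (qpoch (qvar ^ 2) (qvar ^ 2) M) = lift_q (fps_recip (qpoch (fps_X ^ 2) (fps_X ^ 2) M))"
    by (subst lift_q_recip) (simp_all add: qpoch_nth_0 lift_q_qpoch lift_q_power lift_q_X)
  have c: "bailey_gamma r * qvar ^ r = lift_q (bailey_gamma r * fps_X ^ r)" for r
    by (simp only: lift_q_bailey_gamma lift_q_mult lift_q_power lift_q_X)
  have "zcoeff m (fps_recip (qpoch (qvar ^ 2) (qvar ^ 2) M) *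
     (\<Sum>r=1..M. bailey_gamma r * qvar ^ r * fps_recip (crank_factor r)))
    = fps_recip (qpoch (fps_X ^ 2) (fps_X ^ 2) M) *
     (\<Sum>r=1..M. bailey_gamma r * fps_X ^ r * (zcoeff m (fps_recip (crank_factor r))))"
    unfolding b c zcoeff_lift_q_mult zcoeff_sum ..
  also have "(\<Sum>r=1..M. bailey_gamma r * fps_X ^ r * (zcoeff m (fps_recip (crank_factor r))))
      = (\<Sum>r=1..M. bailey_gamma r * fps_X ^ r * (fps_X ^ (r * nat \<bar>m\<bar>) * fps_recip (1 - fps_X ^ (2 * r))))"
    by (intro sum.cong refl) (simp only: zcoeff_recip_crank_factor atLeastAtMost_iff)
  finally show ?thesis
    unfolding z using zcoeff_agree[OF C1_gen_agree, of M m] by (simp only:)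
qed

section \<open>Partition numbers and the convolution formula\<close>

text \<open>
  The number of partitions of the second argument into parts that are at most the first. The recursion splits off a largest possible part.
\<close>

fun bounded_partitions :: "nat \<Rightarrow> nat \<Rightarrow> nat" where
  "bounded_partitions 0 n = (if n = 0 then 1 else 0)"
| "bounded_partitions (Suc K) n = bounded_partitions K n + (if Suc K \<le> n then bounded_partitions (Suc K) (n - Suc K) else 0)"

declare bounded_partitions.simps [simp del]

definition partitions :: "nat \<Rightarrow> nat" where
  "partitions n = bounded_partitions n n"

lemma bounded_partitions_stable: "n \<le> K \<Longrightarrow> bounded_partitions K n = partitions n"
proof (induction K rule: dec_induct)
  case (step K)
  then show ?case by (simp add: bounded_partitions.simps)
qed (simp add: partitions_def)

text \<open>
  The recursion of the coefficients is that of \<open>bounded_partitions\<close>, with $q^2$ in place of $q$.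
\<close>

lemma fps_recip_qpoch_square_nth:
  "fps_nth (fps_recip (qpoch (fps_X ^ 2) (fps_X ^ 2) K)) n = (if even n then int (bounded_partitions K (n div 2)) else 0)"
proof (induction K arbitrary: n)
  case 0
  then show ?case by (auto simp: bounded_partitions.simps elim!: evenE)
next
  case (Suc K)
  define f :: "nat \<Rightarrow> int fps" where "f K = fps_recip (qpoch (fps_X ^ 2) (fps_X ^ 2) K)" for K
  have q0: "fps_nth (qpoch (fps_X ^ 2) (fps_X ^ 2) n :: int fps) 0 = 1" for n
    by (simp add: qpoch_nth_0)
  have r0: "fps_nth (1 - fps_X ^ (2 * Suc K) :: int fps) 0 = 1"
    by (simp add: fps_X_power_nth)
  have e: "fps_X ^ 2 * (fps_X ^ 2) ^ K = (fps_X ^ (2 * Suc K) :: int fps)"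
    by (simp only: power_mult power_Suc)
  have "f (Suc K) = f K * fps_recip (1 - fps_X ^ (2 * Suc K))"
    unfolding f_def qpoch_Suc e by (rule fps_recip_times[OF q0 r0])
  then have "(1 - fps_X ^ (2 * Suc K)) * f (Suc K) = f K * ((1 - fps_X ^ (2 * Suc K)) * fps_recip (1 - fps_X ^ (2 * Suc K)))"
    by (simp only: mult_ac)
  then have rec: "f (Suc K) = f K + fps_X ^ (2 * Suc K) * f (Suc K)"
    unfolding fps_recip_mult[OF r0] by (simp only: left_diff_distrib mult_1 mult_1_right) (simp only: diff_eq_eq)
  have "fps_nth (f (Suc K)) n = (if even n then int (bounded_partitions (Suc K) (n div 2)) else 0)"
  proof (induction n rule: less_induct)
    case (less n)
    have "fps_nth (f (Suc K)) n = fps_nth (f K) n + (if n < 2 * Suc K then 0 else fps_nth (f (Suc K)) (n - 2 * Suc K))"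
      by (subst rec) (simp only: fps_add_nth fps_X_power_mult_nth)
    also have "fps_nth (f K) n = (if even n then int (bounded_partitions K (n div 2)) else 0)"
      unfolding f_def by (rule Suc.IH)
    also have "(if n < 2 * Suc K then 0 else fps_nth (f (Suc K)) (n - 2 * Suc K))
       = (if even n \<and> Suc K \<le> n div 2 then int (bounded_partitions (Suc K) (n div 2 - Suc K)) else 0)"
    proof (cases "n < 2 * Suc K")
      case False
      have "(n - 2 * Suc K) div 2 = n div 2 - Suc K" by auto
      moreover have "Suc K \<le> n div 2" "even (n - 2 * Suc K) = even n" using False by auto
      ultimately show ?thesis
        using False less.IH[of "n - 2 * Suc K"] by simp
    qed auto
    finally show ?case
      by (auto simp: bounded_partitions.simps(2)[of K "n div 2"])
  qed
  then show ?case by (simp only: f_def)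
qed

text \<open>
  The coefficient of $q^n$ in $q^e/(1-q^d)$.
\<close>

definition progression :: "nat \<Rightarrow> nat \<Rightarrow> nat \<Rightarrow> int" where
  "progression e d n = (if e \<le> n \<and> d dvd (n - e) then 1 else 0)"

lemma fps_recip_geometric_nth:
  assumes "d \<ge> 1"
  shows "fps_nth (fps_X ^ e * fps_recip (1 - fps_X ^ d)) n = progression e d n"
proof -
  define g :: "int fps" where "g = Abs_fps (\<lambda>n. if d dvd n then 1 else 0)"
  have "(1 - fps_X ^ d) * g = 1"
  proof (rule fps_ext)
    fix n
    have "fps_nth ((1 - fps_X ^ d) * g) n = fps_nth g n - (if n < d then 0 else fps_nth g (n - d))"
      by (simp only: left_diff_distrib mult_1 fps_sub_nth fps_X_power_mult_nth)
    also have "\<dots> = fps_nth 1 n"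
      using assms by (auto simp: g_def dvd_imp_le dvd_minus_self)
    finally show "fps_nth ((1 - fps_X ^ d) * g) n = fps_nth 1 n" .
  qed
  moreover have "fps_nth (1 - fps_X ^ d :: int fps) 0 = 1"
    using assms by (simp add: fps_X_power_nth)
  ultimately have "fps_recip (1 - fps_X ^ d) = g"
    by (rule fps_recip_unique)
  then show ?thesis
    by (simp only: fps_X_power_mult_nth progression_def) (auto simp: g_def)
qed

text \<open>
  The exponents $r(r+1)/2+r|m|$ and (below) $s(3s+1)+2s|m|$ at which the geometric progressions start.
\<close>

definition crank_start :: "int \<Rightarrow> nat \<Rightarrow> nat" where
  "crank_start m r = (Suc r choose 2) + r * nat \<bar>m\<bar>"

definition slater_start :: "int \<Rightarrow> nat \<Rightarrow> nat" where
  "slater_start m s = s * (3 * s + 1) + 2 * s * nat \<bar>m\<bar>"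

text \<open>
  The coefficients $t(n)$ of the Lambert-type factor $T_m(q)$ of the generating function.
\<close>

definition C1_numer :: "int \<Rightarrow> nat \<Rightarrow> int" where
  "C1_numer m n = (\<Sum>r=1..n. (-1) ^ Suc r * progression (crank_start m r) r n)
     - (\<Sum>s=1..n. (-1) ^ Suc s * progression (slater_start m s) (2 * s) n)"

lemma crank_start_ge: "crank_start m r \<ge> r"
  by (simp add: crank_start_def numeral_2_eq_2)

lemma slater_start_ge: "slater_start m s \<ge> 2 * s"
  by (cases s) (simp_all add: slater_start_def)

lemma C1_numer_eq:
  assumes "n \<le> M"
  shows "C1_numer m n = (\<Sum>r=1..M. (-1) ^ Suc r * progression (crank_start m r) r n)
     - (\<Sum>s=1..M. (-1) ^ Suc s * progression (slater_start m s) (2 * s) n)"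
proof -
  have "progression (crank_start m r) r n = 0" if "r > n" for r
    using that crank_start_ge[of r m] by (simp add: progression_def)
  moreover have "progression (slater_start m s) (2 * s) n = 0" if "s > n" for s
    using that slater_start_ge[of s m] by (simp add: progression_def)
  ultimately show ?thesis
    unfolding C1_numer_def using assms
    by (intro arg_cong2[of _ _ _ _ "(-)"] sum.mono_neutral_left) auto
qed

text \<open>
  The unit pair gives the first sum because $(1+q^r)/(1-q^{2r})=1/(1-q^r)$, and Slater's pair the second one because
  $(1+q^{2s})/(1-q^{4s})=1/(1-q^{2s})$. The indices $s$ between $M/2$ and $M$ contribute only beyond $q^M$.
\<close>

lemma C1_numer_generating:
  assumes "n \<le> M"
  shows "fps_nth (\<Sum>r=1..M. bailey_gamma r * fps_X ^ r * (fps_X ^ (r * nat \<bar>m\<bar>) * fps_recip (1 - fps_X ^ (2 * r)))) n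
    = C1_numer m n"
proof -
  have half: "(1 + fps_X ^ d) * fps_recip (1 - fps_X ^ (2 * d)) = (fps_recip (1 - fps_X ^ d) :: int fps)" if "d \<ge> 1" for d
  proof (rule fps_recip_unique[symmetric])
    have 0: "fps_nth (1 - fps_X ^ (2 * d) :: int fps) 0 = 1"
      using that by (simp add: fps_X_power_nth)
    have "(1 - fps_X ^ d) * (1 + fps_X ^ d) = (1 - fps_X ^ (2 * d) :: int fps)"
      unfolding mult_2 power_add by (simp only: distrib_left left_diff_distrib mult_1 mult_1_right) (simp only: add_diff_eq diff_add_cancel)
    then show "(1 - fps_X ^ d) * ((1 + fps_X ^ d) * fps_recip (1 - fps_X ^ (2 * d))) = (1 :: int fps)"
      unfolding mult.assoc[symmetric] by (simp only: fps_recip_mult[OF 0])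
    show "fps_nth (1 - fps_X ^ d :: int fps) 0 = 1"
      using that by (simp add: fps_X_power_nth)
  qed
  have sgn: "(-1) ^ k * f = of_int ((-1) ^ k) * f" for k and f :: "int fps"
    by simp
  have nthsgn: "fps_nth ((-1) ^ k * f) n = (-1) ^ k * fps_nth f n" for k and f :: "int fps"
    by (cases "even k") simp_all
  define c where "c s = (-1) ^ s * progression (slater_start m s) (2 * s) n" for s
  have one: "fps_nth (bailey_gamma r * fps_X ^ r * (fps_X ^ (r * nat \<bar>m\<bar>) * fps_recip (1 - fps_X ^ (2 * r)))) n
     = (-1) ^ Suc r * progression (crank_start m r) r n + (if even r then c (r div 2) else 0)" if r: "r \<ge> 1" for r
  proof -
    define R :: "int fps" where "R = fps_X ^ r * (fps_X ^ (r * nat \<bar>m\<bar>) * fps_recip (1 - fps_X ^ (2 * r)))"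
    have "bailey_alpha0 r * R = (-1) ^ r * (fps_X ^ (r choose 2) * fps_X ^ r * fps_X ^ (r * nat \<bar>m\<bar>) * ((1 + fps_X ^ r) * fps_recip (1 - fps_X ^ (2 * r))))"
      using r unfolding R_def bailey_alpha0_def by (simp only: mult_ac) simp
    also have "\<dots> = (-1) ^ r * (fps_X ^ (crank_start m r) * fps_recip (1 - fps_X ^ r))"
    proof -
      have "crank_start m r = (r choose 2) + r + r * nat \<bar>m\<bar>"
        by (simp add: crank_start_def numeral_2_eq_2)
      then show ?thesis
        unfolding half[OF r] by (simp only: power_add)
    qed
    finally have a0: "fps_nth (bailey_alpha0 r * R) n = (-1) ^ r * progression (crank_start m r) r n"
      by (simp only: nthsgn fps_recip_geometric_nth[OF r])
    have sl: "fps_nth (slater_alpha (r div 2) * R) n = c (r div 2)" if ev: "even r"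
    proof -
      obtain s where s: "r = 2 * s" using ev by (elim evenE)
      then have s1: "s \<ge> 1" "2 * s \<ge> 1" using r by auto
      have "slater_alpha s * R = (-1) ^ s * (fps_X ^ (s * (3 * s - 1)) * fps_X ^ (2 * s) * fps_X ^ (2 * s * nat \<bar>m\<bar>) * ((1 + fps_X ^ (2 * s)) * fps_recip (1 - fps_X ^ (2 * (2 * s)))))"
        using s1 unfolding R_def slater_alpha_def s by (simp only: mult_ac) simp
      also have "\<dots> = (-1) ^ s * (fps_X ^ (slater_start m s) * fps_recip (1 - fps_X ^ (2 * s)))"
      proof -
        have "slater_start m s = s * (3 * s - 1) + 2 * s + 2 * s * nat \<bar>m\<bar>"
          using s1 by (cases s) (simp_all add: slater_start_def algebra_simps)
        then show ?thesis
          unfolding half[OF s1(2)] by (simp only: power_add)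
      qed
      moreover have "r div 2 = s"
        using s by simp
      ultimately show ?thesis
        by (simp only: nthsgn fps_recip_geometric_nth[OF s1(2)] c_def)
    qed
    have "bailey_gamma r * fps_X ^ r * (fps_X ^ (r * nat \<bar>m\<bar>) * fps_recip (1 - fps_X ^ (2 * r)))
        = (if even r then slater_alpha (r div 2) * R else 0) - bailey_alpha0 r * R"
      unfolding bailey_gamma_def R_def by (simp only: left_diff_distrib mult.assoc) simp
    then show ?thesis
      using sl by (simp only: fps_sub_nth a0) simp
  qed
  have even_part: "(\<Sum>r=1..M. if even r then c (r div 2) else 0) = (\<Sum>s=1..M. c s)"
  proof -
    have "(\<Sum>r=1..M. if even r then c (r div 2) else 0) = (\<Sum>r | r \<in> {1..M} \<and> even r. c (r div 2))"
      by (simp add: sum.If_cases Int_def)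
    also have "\<dots> = (\<Sum>s=1..M div 2. c s)"
      by (rule sum.reindex_bij_witness[of _ "\<lambda>s. 2 * s" "\<lambda>r. r div 2"]) (auto elim!: evenE)
    also have "\<dots> = (\<Sum>s=1..M. c s)"
    proof (rule sum.mono_neutral_left)
      show "\<forall>s\<in>{1..M} - {1..M div 2}. c s = 0"
      proof
        fix s assume "s \<in> {1..M} - {1..M div 2}"
        then have "n < 2 * s" using assms by auto
        then show "c s = 0"
          using slater_start_ge[of s m] by (simp add: c_def progression_def)
      qed
    qed auto
    finally show ?thesis .
  qed
  have "fps_nth (\<Sum>r=1..M. bailey_gamma r * fps_X ^ r * (fps_X ^ (r * nat \<bar>m\<bar>) * fps_recip (1 - fps_X ^ (2 * r)))) n
     = (\<Sum>r=1..M. (-1) ^ Suc r * progression (crank_start m r) r n + (if even r then c (r div 2) else 0))"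
    unfolding fps_sum_nth by (intro sum.cong refl one) simp
  also have "\<dots> = (\<Sum>r=1..M. (-1) ^ Suc r * progression (crank_start m r) r n) + (\<Sum>s=1..M. c s)"
    unfolding sum.distrib even_part ..
  also have "(\<Sum>s=1..M. c s) = - (\<Sum>s=1..M. (-1) ^ Suc s * progression (slater_start m s) (2 * s) n)"
    unfolding sum_negf[symmetric] c_def by simp
  finally show ?thesis
    unfolding C1_numer_eq[OF assms] by simp
qed

theorem N_C1_convolution:
  "N_C1 m n = (\<Sum>k\<le>n div 2. int (partitions k) * C1_numer m (n - 2 * k))"
proof -
  define T where "T = (\<Sum>r=1..n. bailey_gamma r * fps_X ^ r * (fps_X ^ (r * nat \<bar>m\<bar>) * fps_recip (1 - fps_X ^ (2 * r))) :: int fps)"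
  define h where "h i = (if even i then int (bounded_partitions n (i div 2)) else 0) * C1_numer m (n - i)" for i
  have "N_C1 m n = fps_nth (fps_recip (qpoch (fps_X ^ 2) (fps_X ^ 2) n) * T) n"
    using N_C1_agree[of n m] by (simp add: agree_upto_def T_def)
  also have "\<dots> = (\<Sum>i=0..n. h i)"
    unfolding fps_mult_nth fps_recip_qpoch_square_nth T_def
    by (intro sum.cong refl) (simp only: C1_numer_generating[OF diff_le_self] h_def)
  also have "\<dots> = (\<Sum>i | i \<le> n \<and> even i. h i)"
    by (rule sum.mono_neutral_right) (auto simp: h_def)
  also have "\<dots> = (\<Sum>k\<le>n div 2. h (2 * k))"
    by (rule sum.reindex_bij_witness[of _ "\<lambda>k. 2 * k" "\<lambda>i. i div 2"]) (auto elim!: evenE)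
  also have "\<dots> = (\<Sum>k\<le>n div 2. int (partitions k) * C1_numer m (n - 2 * k))"
    by (intro sum.cong refl) (auto simp: h_def bounded_partitions_stable)
  finally show ?thesis .
qed

section \<open>The generating function of the partition numbers\<close>

lemma sums_delay:
  fixes f :: "nat \<Rightarrow> 'a::real_normed_vector"
  assumes "f sums s"
  shows "(\<lambda>n. if d \<le> n then f (n - d) else 0) sums s"
  using sums_iff_shift[of "\<lambda>n. if d \<le> n then f (n - d) else 0" d s] assms by simp

text \<open>
  A nonnegative partial sum $s$ of the series for $K+1$ satisfies $s\le A+r^{K+1}s$, where $A$ is the full sum for $K$.
\<close>

lemma bounded_partitions_summable:
  fixes r :: real
  assumes "0 \<le> r" "r < 1"
  shows "summable (\<lambda>n. real (bounded_partitions K n) * r ^ n)"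
proof (induction K)
  case 0
  have "summable (\<lambda>n. real (bounded_partitions 0 n) * r ^ n) \<longleftrightarrow> summable (\<lambda>n. if n = 0 then (1::real) else 0)"
    by (intro summable_cong) (auto simp: bounded_partitions.simps)
  then show ?case by simp
next
  case (Suc K)
  define A where "A = (suminf (\<lambda>n. real (bounded_partitions K n) * r ^ n))"
  have r1: "r ^ Suc K < 1" using assms by (metis power_Suc_less_one power_0 power_strict_decreasing_iff zero_less_Suc power_0_Suc less_eq_real_def zero_less_one)
  have bound: "(\<Sum>n<N. real (bounded_partitions (Suc K) n) * r ^ n) \<le> A / (1 - r ^ Suc K)" for N
  proof -
    define s where "s = (\<Sum>n<N. real (bounded_partitions (Suc K) n) * r ^ n)"
    have "s = (\<Sum>n<N. real (bounded_partitions K n) * r ^ n) + (\<Sum>n<N. if Suc K \<le> n then real (bounded_partitions (Suc K) (n - Suc K)) * r ^ n else 0)"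
      unfolding s_def sum.distrib[symmetric] by (intro sum.cong refl) (simp add: bounded_partitions.simps(2) algebra_simps)
    also have "(\<Sum>n<N. if Suc K \<le> n then real (bounded_partitions (Suc K) (n - Suc K)) * r ^ n else 0) =
        (\<Sum>n\<in>{Suc K..<N}. real (bounded_partitions (Suc K) (n - Suc K)) * r ^ n)"
      by (rule sum.mono_neutral_cong_right) auto
    also have "\<dots> = (\<Sum>n<N - Suc K. real (bounded_partitions (Suc K) n) * r ^ (n + Suc K))"
      by (rule sum.reindex_bij_witness[of _ "\<lambda>n. n + Suc K" "\<lambda>n. n - Suc K"]) auto
    also have "\<dots> \<le> (\<Sum>n<N. real (bounded_partitions (Suc K) n) * r ^ (n + Suc K))"
      by (rule sum_mono2) (use assms in auto)
    also have "\<dots> = r ^ Suc K * s"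
      by (simp add: s_def sum_distrib_left power_add mult_ac)
    finally have "s \<le> (\<Sum>n<N. real (bounded_partitions K n) * r ^ n) + r ^ Suc K * s" by simp
    also have "(\<Sum>n<N. real (bounded_partitions K n) * r ^ n) \<le> A"
      unfolding A_def by (rule sum_le_suminf) (use assms Suc.IH in auto)
    finally have "(1 - r ^ Suc K) * s \<le> A" by (simp add: algebra_simps)
    then show ?thesis
      using r1 unfolding s_def[symmetric] by (simp add: field_simps)
  qed
  show ?case
    by (rule bounded_imp_summable[OF _ bound[unfolded lessThan_Suc_atMost, of "Suc _", unfolded lessThan_Suc_atMost]]) (use assms in auto)
qed

lemma bounded_partitions_sums:
  fixes q :: complex
  assumes "norm q < 1"
  shows "(\<lambda>n. of_nat (bounded_partitions K n) * q ^ n) sums (\<Prod>k=1..K. 1 / (1 - q ^ k))"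
proof (induction K)
  case 0
  have "(\<lambda>n. of_nat (bounded_partitions 0 n) * q ^ n) = (\<lambda>n. if n = 0 then 1 else 0)"
    by (auto simp: bounded_partitions.simps)
  then show ?case using sums_single[of 0 "\<lambda>_. 1::complex"] by simp
next
  case (Suc K)
  define f where "f n = of_nat (bounded_partitions (Suc K) n) * q ^ n" for n
  have "summable (\<lambda>n. norm (f n))"
    using bounded_partitions_summable[of "norm q" "Suc K"] assms by (simp add: f_def norm_mult norm_power)
  then have f: "f sums suminf f"
    using summable_norm_cancel summable_sums by blast
  have "(\<lambda>n. of_nat (bounded_partitions K n) * q ^ n + q ^ Suc K * (if Suc K \<le> n then f (n - Suc K) else 0))
     sums ((\<Prod>k=1..K. 1 / (1 - q ^ k)) + q ^ Suc K * suminf f)"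
    by (intro sums_add Suc.IH sums_mult sums_delay f)
  also have "(\<lambda>n. of_nat (bounded_partitions K n) * q ^ n + q ^ Suc K * (if Suc K \<le> n then f (n - Suc K) else 0)) = f"
  proof
    fix n
    have "q ^ Suc K * q ^ (n - Suc K) = q ^ n" if "Suc K \<le> n"
      using that by (simp only: power_add[symmetric] le_add_diff_inverse)
    then show "of_nat (bounded_partitions K n) * q ^ n + q ^ Suc K * (if Suc K \<le> n then f (n - Suc K) else 0) = f n"
      by (simp only: f_def bounded_partitions.simps(2)[of K n]) (simp add: algebra_simps)
  qed
  finally have "suminf f = (\<Prod>k=1..K. 1 / (1 - q ^ k)) + q ^ Suc K * suminf f"
    using f sums_unique2 by blast
  moreover have "1 - q ^ Suc K \<noteq> 0"
  proof
    assume "1 - q ^ Suc K = 0"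
    then have "norm q ^ Suc K = 1" by (metis eq_iff_diff_eq_0 norm_one norm_power)
    then show False using assms
      by (metis less_irrefl norm_ge_zero power_Suc_less_one power_one_right power_eq_1_iff zero_less_Suc nat.distinct(1) real_norm_def abs_norm_cancel)
  qed
  ultimately have "suminf f = (\<Prod>k=1..Suc K. 1 / (1 - q ^ k))"
    by (simp add: field_simps)
  then show ?case using f unfolding f_def[abs_def] by (simp only:)
qed

text \<open>
  The logarithm of Euler's product, $\log P(q)=\sum_{m\ge1}\frac{q^m}{m(1-q^m)}$, as it results from expanding
  $-\log(1-q^k)$ and summing over $k$ first.
\<close>

definition lambert_log :: "complex \<Rightarrow> complex" where
  "lambert_log q = (suminf (\<lambda>m. q ^ Suc m / (of_nat (Suc m) * (1 - q ^ Suc m))))"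

lemma one_minus_power_bound:
  fixes q :: complex
  assumes "norm q < 1"
  shows "1 - norm q \<le> norm (1 - q ^ Suc m)"
proof -
  have "norm (q ^ Suc m) \<le> norm q"
    using assms by (simp add: norm_mult norm_power mult_left_le power_le_one)
  then show ?thesis
    using norm_triangle_ineq2[of 1 "q ^ Suc m"] by simp
qed

lemma lambert_term_bound:
  fixes q :: complex
  assumes "norm q < 1"
  shows "norm (q ^ Suc m / (of_nat (Suc m) * (1 - q ^ Suc m))) \<le> norm q ^ Suc m / (1 - norm q)"
proof -
  have "(1 - norm q) * 1 \<le> norm (1 - q ^ Suc m) * real (Suc m)"
    using one_minus_power_bound[OF assms, of m] assms by (intro mult_mono) auto
  then have "norm q ^ Suc m / (real (Suc m) * norm (1 - q ^ Suc m)) \<le> norm q ^ Suc m / (1 - norm q)"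
    using assms by (intro divide_left_mono mult_pos_pos) (auto simp: mult.commute intro!: mult_pos_pos dest: order.strict_trans2)
  then show ?thesis
    by (simp only: norm_divide norm_mult norm_power norm_of_nat)
qed

lemma lambert_summable:
  fixes q :: complex
  assumes "norm q < 1"
  shows "summable (\<lambda>m. norm (q ^ Suc m / (of_nat (Suc m) * (1 - q ^ Suc m))))"
proof (rule summable_comparison_test)
  show "\<exists>N. \<forall>m\<ge>N. norm (norm (q ^ Suc m / (of_nat (Suc m) * (1 - q ^ Suc m)))) \<le> norm q ^ Suc m / (1 - norm q)"
    using lambert_term_bound[OF assms] by auto
  show "summable (\<lambda>m. norm q ^ Suc m / (1 - norm q))"
    using assms by (intro summable_divide summable_Suc_iff[THEN iffD2] summable_geometric) simp
qed

lemma geometric_log_sums: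
  fixes z :: complex
  assumes "norm z < 1"
  shows "(\<lambda>m. z ^ Suc m / of_nat (Suc m)) sums (- Ln (1 - z))"
proof -
  have "(\<lambda>n. (-1) ^ Suc n / of_nat n * (- z) ^ n) sums Ln (1 + (- z))"
    by (rule Ln_series) (use assms in simp)
  then have "(\<lambda>n. - ((-1) ^ Suc n / of_nat n * (- z) ^ n)) sums (- Ln (1 - z))"
    by (intro sums_minus) simp
  also have "(\<lambda>n. - ((-1) ^ Suc n / of_nat n * (- z) ^ n)) = (\<lambda>n. z ^ n / of_nat n)"
    by (auto simp: power_minus[of z])
  finally show ?thesis
    by (subst sums_Suc_iff) simp
qed

text \<open>
  The logarithm of a finite product is $\sum_m\frac1m\sum_{k\le K}q^{mk}$, and the limit $K\to\infty$ can be taken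
  termwise by dominated convergence.
\<close>

lemma euler_prod_tendsto:
  fixes q :: complex
  assumes "norm q < 1"
  shows "(\<lambda>K. \<Prod>k=1..K. 1 / (1 - q ^ k)) \<longlonglongrightarrow> exp (lambert_log q)"
proof -
  define a where "a m K = q ^ Suc m * (1 - (q ^ Suc m) ^ K) / (of_nat (Suc m) * (1 - q ^ Suc m))" for m K
  have nz: "1 - q ^ k \<noteq> 0" if "k \<ge> 1" for k
    using one_minus_power_bound[OF assms, of "k - 1"] assms that by auto
  have ap: "(\<Prod>k=1..K. 1 / (1 - q ^ k)) = exp (suminf (\<lambda>m. a m K))" for K
  proof -
    have "(\<lambda>m. \<Sum>k=1..K. (q ^ k) ^ Suc m / of_nat (Suc m)) sums (\<Sum>k=1..K. - Ln (1 - q ^ k))"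
    proof (intro sums_sum geometric_log_sums)
      fix k assume "k \<in> {1..K}"
      then show "norm (q ^ k) < 1"
        using assms by (cases k) (auto simp: norm_mult norm_power power_less_one_iff simp del: power_Suc)
    qed
    also have "(\<lambda>m. \<Sum>k=1..K. (q ^ k) ^ Suc m / of_nat (Suc m)) = (\<lambda>m. a m K)"
    proof
      fix m
      have "(\<Sum>k=1..K. (q ^ k) ^ Suc m) = (\<Sum>k=1..K. (q ^ Suc m) ^ k)"
        by (intro sum.cong refl) (simp only: power_mult[symmetric] mult.commute)
      also have "\<dots> = (\<Sum>k<K. (q ^ Suc m) ^ Suc k)"
        by (rule sum.reindex_bij_witness[of _ Suc "\<lambda>k. k - 1"]) auto
      also have "\<dots> = q ^ Suc m * (\<Sum>k<K. (q ^ Suc m) ^ k)"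
        by (simp only: sum_distrib_left power_Suc[of "q ^ Suc m"])
      also have "\<dots> = q ^ Suc m * (1 - (q ^ Suc m) ^ K) / (1 - q ^ Suc m)"
        using nz[of "Suc m"] by (subst sum_gp_strict) auto
      finally show "(\<Sum>k=1..K. (q ^ k) ^ Suc m / of_nat (Suc m)) = a m K"
        unfolding a_def sum_divide_distrib[symmetric] by (simp only: divide_divide_eq_left mult.commute)
    qed
    finally have "exp (suminf (\<lambda>m. a m K)) = exp (\<Sum>k=1..K. - Ln (1 - q ^ k))"
      by (simp only: sums_iff)
    also have "\<dots> = (\<Prod>k=1..K. 1 / (1 - q ^ k))"
      unfolding exp_sum[OF finite_atLeastAtMost] by (intro prod.cong refl) (simp only: exp_minus divide_inverse mult_1 exp_Ln[OF nz] atLeastAtMost_iff)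
    finally show ?thesis ..
  qed
  have "(\<lambda>K. suminf (\<lambda>m. a m K)) \<longlonglongrightarrow> (suminf (\<lambda>m. q ^ Suc m / (of_nat (Suc m) * (1 - q ^ Suc m))))"
  proof (rule tannerys_theorem[THEN conjunct2, THEN conjunct2])
    fix m
    have "norm (q ^ Suc m) < 1"
      using assms by (simp only: norm_power power_less_one_iff norm_ge_zero) simp
    then have "(\<lambda>K. q ^ Suc m * (1 - (q ^ Suc m) ^ K) / (of_nat (Suc m) * (1 - q ^ Suc m))) \<longlonglongrightarrow> q ^ Suc m * (1 - 0) / (of_nat (Suc m) * (1 - q ^ Suc m))"
      using nz[of "Suc m"] by (intro tendsto_intros LIMSEQ_power_zero) (simp_all del: power_Suc of_nat_Suc)
    then show "(\<lambda>K. a m K) \<longlonglongrightarrow> q ^ Suc m / (of_nat (Suc m) * (1 - q ^ Suc m))"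
      by (simp only: a_def diff_zero mult_1_right)
  next
    have "norm (a m K) \<le> 2 * (norm q ^ Suc m / (1 - norm q))" for m K
    proof -
      have "norm (1 - (q ^ Suc m) ^ K) \<le> norm (1::complex) + norm ((q ^ Suc m) ^ K)"
        by (rule norm_triangle_ineq4)
      also have "\<dots> \<le> 1 + 1"
        using assms by (simp add: norm_power power_le_one del: power_Suc)
      finally have "norm (1 - (q ^ Suc m) ^ K) * norm (q ^ Suc m / (of_nat (Suc m) * (1 - q ^ Suc m))) \<le> 2 * (norm q ^ Suc m / (1 - norm q))"
        using lambert_term_bound[OF assms, of m] by (intro mult_mono) (simp_all del: power_Suc of_nat_Suc)
      moreover have "a m K = (1 - (q ^ Suc m) ^ K) * (q ^ Suc m / (of_nat (Suc m) * (1 - q ^ Suc m)))"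
        by (simp only: a_def times_divide_eq_right mult.commute)
      ultimately show ?thesis
        by (simp only: norm_mult)
    qed
    then show "\<forall>\<^sub>F (m, K) in at_top \<times>\<^sub>F sequentially. norm (a m K) \<le> 2 * (norm q ^ Suc m / (1 - norm q))"
      by (auto intro: always_eventually)
    show "summable (\<lambda>m. 2 * (norm q ^ Suc m / (1 - norm q)))"
      using assms by (intro summable_mult summable_divide summable_Suc_iff[THEN iffD2] summable_geometric) simp
  qed simp
  then show ?thesis
    unfolding ap lambert_log_def by (rule tendsto_exp)
qed

lemma bounded_partitions_mono: "K \<le> L \<Longrightarrow> bounded_partitions K n \<le> bounded_partitions L n"
  by (induction L rule: dec_induct) (auto simp: bounded_partitions.simps(2) intro: order_trans)

lemma bounded_partitions_le_partitions: "bounded_partitions K n \<le> partitions n"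
  using bounded_partitions_mono[of K "max K n" n] bounded_partitions_stable[of n "max K n"] by simp

text \<open>
  A partial sum up to $N$ involves parts of size at most $N$ only, and is bounded by the convergent finite products.
\<close>

lemma partitions_summable:
  fixes r :: real
  assumes "0 \<le> r" "r < 1"
  shows "summable (\<lambda>n. real (partitions n) * r ^ n)"
proof -
  have "Bseq (\<lambda>K. \<Prod>k=1..K. 1 / (1 - complex_of_real r ^ k))"
    by (rule convergent_imp_Bseq, rule convergentI, rule euler_prod_tendsto) (use assms in simp)
  then obtain B where B: "\<And>K. norm (\<Prod>k=1..K. 1 / (1 - complex_of_real r ^ k)) \<le> B"
    by (auto simp: Bseq_def)
  show ?thesis
  proof (rule bounded_imp_summable)
    fix N
    have "(\<Sum>n\<le>N. real (partitions n) * r ^ n) = (\<Sum>n\<le>N. real (bounded_partitions N n) * r ^ n)"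
      by (intro sum.cong refl) (simp add: bounded_partitions_stable)
    also have "\<dots> \<le> (suminf (\<lambda>n. real (bounded_partitions N n) * r ^ n))"
      by (rule sum_le_suminf) (use assms bounded_partitions_summable in auto)
    also have "complex_of_real (suminf (\<lambda>n. real (bounded_partitions N n) * r ^ n)) = (\<Prod>k=1..N. 1 / (1 - complex_of_real r ^ k))"
    proof -
      have "(\<lambda>n. complex_of_real (real (bounded_partitions N n) * r ^ n)) sums complex_of_real (suminf (\<lambda>n. real (bounded_partitions N n) * r ^ n))"
        by (intro sums_of_real summable_sums bounded_partitions_summable assms)
      moreover have "(\<lambda>n. complex_of_real (real (bounded_partitions N n) * r ^ n)) sums (\<Prod>k=1..N. 1 / (1 - complex_of_real r ^ k))"
        using bounded_partitions_sums[of "complex_of_real r" N] assms by simp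
      ultimately show ?thesis
        by (rule sums_unique2)
    qed
    then have "(suminf (\<lambda>n. real (bounded_partitions N n) * r ^ n)) \<le> B"
      using B[of N] by (metis abs_le_D1 norm_of_real)
    finally show "(\<Sum>n\<le>N. real (partitions n) * r ^ n) \<le> B" .
  qed (use assms in auto)
qed

lemma partitions_sums:
  fixes q :: complex
  assumes "norm q < 1"
  shows "(\<lambda>n. of_nat (partitions n) * q ^ n) sums exp (lambert_log q)"
proof -
  have "(\<lambda>K. suminf (\<lambda>n. of_nat (bounded_partitions K n) * q ^ n)) \<longlonglongrightarrow> (suminf (\<lambda>n. of_nat (partitions n) * q ^ n))"
  proof (rule tannerys_theorem[THEN conjunct2, THEN conjunct2])
    fix n
    have "eventually (\<lambda>K. of_nat (bounded_partitions K n) * q ^ n = of_nat (partitions n) * q ^ n) sequentially"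
      using eventually_ge_at_top[of n] by eventually_elim (simp add: bounded_partitions_stable)
    then show "(\<lambda>K. of_nat (bounded_partitions K n) * q ^ n) \<longlonglongrightarrow> of_nat (partitions n) * q ^ n"
      by (rule tendsto_eventually)
  next
    show "\<forall>\<^sub>F (n, K) in at_top \<times>\<^sub>F sequentially. norm (of_nat (bounded_partitions K n) * q ^ n) \<le> real (partitions n) * norm q ^ n"
      by (intro always_eventually) (auto simp: norm_mult norm_power bounded_partitions_le_partitions mult_right_mono)
    show "summable (\<lambda>n. real (partitions n) * norm q ^ n)"
      by (rule partitions_summable) (use assms in auto)
  qed simp
  moreover have "(suminf (\<lambda>n. of_nat (bounded_partitions K n) * q ^ n)) = (\<Prod>k=1..K. 1 / (1 - q ^ k))" for K
    using bounded_partitions_sums[OF assms, of K] by (simp add: sums_iff)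
  ultimately have "(\<lambda>K. \<Prod>k=1..K. 1 / (1 - q ^ k)) \<longlonglongrightarrow> (suminf (\<lambda>n. of_nat (partitions n) * q ^ n))"
    by (simp only:)
  then have "(suminf (\<lambda>n. of_nat (partitions n) * q ^ n)) = exp (lambert_log q)"
    using euler_prod_tendsto[OF assms] by (rule LIMSEQ_unique)
  moreover have "summable (\<lambda>n. of_nat (partitions n) * q ^ n)"
    by (rule summable_norm_cancel)
       (use partitions_summable[of "norm q"] assms in \<open>simp add: norm_mult norm_power\<close>)
  ultimately show ?thesis
    by (simp add: sums_iff)
qed

definition partition_sum :: "nat \<Rightarrow> nat" where
  "partition_sum n = (\<Sum>k\<le>n. partitions k)"

lemma partition_sum_sums:
  fixes q :: complex
  assumes "norm q < 1"
  shows "(\<lambda>n. of_nat (partition_sum n) * q ^ n) sums (exp (lambert_log q) / (1 - q))"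
proof -
  have "(\<lambda>n. \<Sum>i\<le>n. (of_nat (partitions i) * q ^ i) * q ^ (n - i)) sums
      ((suminf (\<lambda>n. of_nat (partitions n) * q ^ n)) * (suminf (\<lambda>n. q ^ n)))"
    by (rule Cauchy_product_sums)
       (use partitions_summable[of "norm q"] assms in \<open>simp_all add: norm_mult norm_power\<close>)
  also have "(\<lambda>n. \<Sum>i\<le>n. (of_nat (partitions i) * q ^ i) * q ^ (n - i)) = (\<lambda>n. of_nat (partition_sum n) * q ^ n)"
  proof
    fix n
    have "(\<Sum>i\<le>n. (of_nat (partitions i) * q ^ i) * q ^ (n - i)) = (\<Sum>i\<le>n. of_nat (partitions i) * q ^ n)"
      by (intro sum.cong refl) (simp add: mult.assoc flip: power_add)
    then show "(\<Sum>i\<le>n. (of_nat (partitions i) * q ^ i) * q ^ (n - i)) = of_nat (partition_sum n) * q ^ n"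
      by (simp add: partition_sum_def sum_distrib_right)
  qed
  finally show ?thesis
    using partitions_sums[OF assms] assms by (simp add: sums_iff suminf_geometric divide_inverse)
qed

section \<open>The logarithm of Euler's product near $q=1$\<close>

text \<open>
  The logarithm of $P(e^{-w})$ is $\sum_m\frac{1}{m}\cdot\frac{1}{e^{mw}-1}$. Removing the pole $1/(mw)$ of each term at $w=0$
  splits off $\frac{\pi^2}{6w}$ and leaves this function.
\<close>

definition polar_remainder :: "complex \<Rightarrow> complex" where
  "polar_remainder w = 1 / (exp w - 1) - 1 / w"

definition polar_remainder_deriv :: "complex \<Rightarrow> complex" where
  "polar_remainder_deriv w = 1 / w ^ 2 - 1 / (exp (w / 2) - exp (- (w / 2))) ^ 2"

lemma exp_minus_one_half: "exp w - 1 = exp (w / 2) * (exp (w / 2) - exp (- (w / 2)))" for w :: complex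
  by (simp add: algebra_simps flip: exp_add)

lemma sinh_half_lower:
  assumes "Re w > 0"
  shows "Re w \<le> norm (exp (w / 2) - exp (- (w / 2)))"
proof -
  have "Re w / 2 \<le> sinh (Re w / 2)"
  proof -
    have "sinh 0 - 0 \<le> sinh (Re w / 2) - Re w / 2"
    proof (rule DERIV_nonneg_imp_nondecreasing[where f = "\<lambda>y. sinh y - y" and a = 0 and b = "Re w / 2"])
      fix y :: real
      have "((\<lambda>y. sinh y - y) has_real_derivative cosh y - 1) (at y)"
        by (auto intro!: derivative_eq_intros)
      then show "\<exists>d. ((\<lambda>y. sinh y - y) has_real_derivative d) (at y) \<and> 0 \<le> d"
        using cosh_real_ge_1[of y] by auto
    qed (use assms in simp)
    then show ?thesis by simp
  qed
  then have "Re w \<le> exp (Re w / 2) - exp (- (Re w / 2))"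
    by (simp add: sinh_def)
  also have "\<dots> = norm (exp (w / 2)) - norm (exp (- (w / 2)))"
    by simp
  also have "\<dots> \<le> norm (exp (w / 2) - exp (- (w / 2)))"
    by (rule norm_triangle_ineq2)
  finally show ?thesis .
qed

lemma polar_remainder_has_derivative:
  assumes "Re w > 0"
  shows "(polar_remainder has_field_derivative polar_remainder_deriv w) (at w within A)"
proof -
  have w0: "w \<noteq> 0" using assms by auto
  have s0: "exp (w / 2) - exp (- (w / 2)) \<noteq> 0"
    using sinh_half_lower[OF assms] assms by auto
  then have e0: "exp w - 1 \<noteq> 0"
    unfolding exp_minus_one_half[of w] by simp
  have "(polar_remainder has_field_derivative (- exp w / (exp w - 1) ^ 2 + 1 / w ^ 2)) (at w within A)"
    unfolding polar_remainder_def[abs_def] using w0 e0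
    by (auto intro!: derivative_eq_intros simp: power2_eq_square field_simps)
  moreover have "exp w / (exp w - 1) ^ 2 = 1 / (exp (w / 2) - exp (- (w / 2))) ^ 2"
  proof -
    have "exp w = exp (w / 2) ^ 2"
      by (simp add: power2_eq_square flip: exp_add)
    then show ?thesis
      unfolding exp_minus_one_half[of w] power_mult_distrib by simp
  qed
  ultimately show ?thesis
    by (simp add: polar_remainder_deriv_def)
qed

text \<open>
  With $s=2\sinh(w/2)$ the derivative is $1/w^2-1/s^2$. For $|w|\le1$ the third-order Taylor remainder $|s-w|\le|w|^3/4$
  bounds it by $1$. For $|w|>1$ both $|s|$ and $|w|$ are at least $\mathrm{Re}\,w$, which exceeds $1/2$ in the cone, and
  $2x^{-2}\le18(1+x)^{-2}$ for $x\ge1/2$.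
\<close>

lemma polar_remainder_deriv_bound:
  assumes x: "Re w > 0" and cone: "norm w \<le> 2 * Re w"
  shows "norm (polar_remainder_deriv w) \<le> 18 / (1 + Re w) ^ 2"
proof -
  define s where "s = exp (w / 2) - exp (- (w / 2))"
  have s: "Re w \<le> norm s" unfolding s_def by (rule sinh_half_lower[OF x])
  have w: "Re w \<le> norm w" by (rule complex_Re_le_cmod)
  show ?thesis
  proof (cases "norm w \<le> 1")
    case True
    have half: "norm (exp z - (1 + z + z ^ 2 / 2)) \<le> norm w ^ 3 / 8" if "norm z = norm w / 2" for z :: complex
    proof -
      have "norm (exp z - (\<Sum>k\<le>2. z ^ k / fact k)) \<le> exp \<bar>Re z\<bar> * norm z ^ Suc 2 / fact 2"
        by (rule Taylor_exp)
      also have "(\<Sum>k\<le>2. z ^ k / fact k) = 1 + z + z ^ 2 / 2"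
        by (simp add: numeral_2_eq_2)
      also have "exp \<bar>Re z\<bar> * norm z ^ Suc 2 / fact 2 \<le> 2 * norm z ^ Suc 2 / fact 2"
      proof -
        have "\<bar>Re z\<bar> \<le> 1 / 2" using abs_Re_le_cmod[of z] that True by simp
        then have "exp \<bar>Re z\<bar> \<le> exp (1 / 2)" by simp
        also have "exp (1 / 2 :: real) \<le> 2"
          using exp_bound[of "1 / 2 :: real"] by (simp add: power2_eq_square)
        finally show ?thesis by (intro divide_right_mono mult_right_mono) auto
      qed
      also have "\<dots> = norm w ^ 3 / 8"
        by (simp add: that power3_eq_cube power2_eq_square)
      finally show ?thesis .
    qed
    have "s - w = (exp (w / 2) - (1 + w / 2 + (w / 2) ^ 2 / 2)) - (exp (- (w / 2)) - (1 + (- (w / 2)) + (- (w / 2)) ^ 2 / 2))"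
      by (simp add: s_def field_simps)
    also have "norm \<dots> \<le> norm w ^ 3 / 8 + norm w ^ 3 / 8"
      by (rule order_trans[OF norm_triangle_ineq4]) (intro add_mono half; simp add: norm_divide)
    finally have d: "norm (s - w) \<le> norm w ^ 3 / 4" by simp
    also have "norm w ^ 3 \<le> norm w"
      using True power_decreasing[of 1 3 "norm w"] by simp
    finally have d': "norm (s - w) \<le> norm w / 4" by simp
    have s1: "3 / 4 * norm w \<le> norm s"
      using norm_triangle_ineq2[of w "w - s"] d' by (simp add: norm_minus_commute)
    have s2: "norm (s + w) \<le> 9 / 4 * norm w"
    proof -
      have "s + w = (s - w) + 2 * w" by simp
      then have "norm (s + w) \<le> norm (s - w) + 2 * norm w"
        by (metis norm_mult norm_numeral norm_triangle_ineq)
      then show ?thesis using d' by simp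
    qed
    have n0: "norm w > 0" "norm s > 0" using x w s by auto
    then have nz: "w \<noteq> 0" "s \<noteq> 0" by auto
    have "polar_remainder_deriv w = (s - w) * (s + w) / (w ^ 2 * s ^ 2)"
      unfolding polar_remainder_deriv_def s_def[symmetric] using nz by (simp add: field_simps power2_eq_square)
    then have "norm (polar_remainder_deriv w) = norm (s - w) * norm (s + w) / (norm w ^ 2 * norm s ^ 2)"
      by (simp add: norm_divide norm_mult norm_power)
    also have "\<dots> \<le> (norm w ^ 3 / 4 * (9 / 4 * norm w)) / (norm w ^ 2 * (3 / 4 * norm w) ^ 2)"
      using d s1 s2 n0 by (intro frac_le mult_mono power_mono mult_nonneg_nonneg mult_pos_pos zero_less_power) auto
    also have "\<dots> = 1"
      using n0 by (simp add: field_simps power2_eq_square power3_eq_cube)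
    also have "1 \<le> 18 / (1 + Re w) ^ 2"
    proof -
      have "(1 + Re w) ^ 2 \<le> 2 ^ 2" using x w True by (intro power_mono) auto
      then show ?thesis using x by (simp add: field_simps)
    qed
    finally show ?thesis .
  next
    case False
    then have x2: "Re w \<ge> 1 / 2" using cone by simp
    have "norm (polar_remainder_deriv w) \<le> 1 / norm w ^ 2 + 1 / norm s ^ 2"
      unfolding polar_remainder_deriv_def s_def[symmetric]
      by (rule order_trans[OF norm_triangle_ineq4]) (simp add: norm_divide norm_power)
    also have "\<dots> \<le> 1 / Re w ^ 2 + 1 / Re w ^ 2"
      using s w x by (intro add_mono divide_left_mono power_mono mult_pos_pos zero_less_power) auto
    also have "\<dots> = 18 / (3 * Re w) ^ 2"
      by (simp add: power2_eq_square)
    also have "\<dots> \<le> 18 / (1 + Re w) ^ 2"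
      using x2 by (intro divide_left_mono power_mono mult_pos_pos zero_less_power) auto
    finally show ?thesis .
  qed
qed

lemma polar_remainder_difference:
  assumes t: "t > 0" and th: "\<bar>\<theta>\<bar> \<le> t"
  shows "norm (polar_remainder (Complex t (-\<theta>)) - polar_remainder (of_real t)) \<le> 18 / (1 + t) ^ 2 * \<bar>\<theta>\<bar>"
proof -
  define S where "S = closed_segment (complex_of_real t) (Complex t (-\<theta>))"
  have S: "Re z = t \<and> \<bar>Im z\<bar> \<le> t" if z: "z \<in> S" for z
  proof -
    obtain u where u: "z = (1 - u) *\<^sub>R complex_of_real t + u *\<^sub>R Complex t (-\<theta>)" "0 \<le> u" "u \<le> 1"
      using z by (auto simp: S_def closed_segment_def)
    have "Re z = t" by (simp add: u(1) algebra_simps)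
    moreover have "\<bar>Im z\<bar> = u * \<bar>\<theta>\<bar>" using u(2) by (simp add: u(1) abs_mult)
    moreover have "u * \<bar>\<theta>\<bar> \<le> 1 * \<bar>\<theta>\<bar>" using u by (intro mult_right_mono) auto
    ultimately show ?thesis using th by auto
  qed
  have "norm (polar_remainder (Complex t (-\<theta>)) - polar_remainder (of_real t)) \<le> 18 / (1 + t) ^ 2 * norm (Complex t (-\<theta>) - of_real t)"
  proof (rule field_differentiable_bound[of S])
    fix z assume z: "z \<in> S"
    show "(polar_remainder has_field_derivative polar_remainder_deriv z) (at z within S)"
      by (rule polar_remainder_has_derivative) (use S[OF z] t in auto)
    have "norm z \<le> \<bar>Re z\<bar> + \<bar>Im z\<bar>" by (rule cmod_le)
    then show "norm (polar_remainder_deriv z) \<le> 18 / (1 + t) ^ 2"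
      using polar_remainder_deriv_bound[of z] S[OF z] t by simp
  qed (simp_all add: S_def)
  also have "Complex t (-\<theta>) - of_real t = Complex 0 (-\<theta>)"
    by (simp add: complex_eq_iff)
  also have "norm (Complex 0 (-\<theta>)) = \<bar>\<theta>\<bar>"
    by (simp add: complex_norm)
  finally show ?thesis .
qed

text \<open>
  The summand is at most $\frac1t\left(\frac{1}{1+mt}-\frac{1}{1+(m+1)t}\right)$, which telescopes.
\<close>

lemma sum_inverse_square_bound:
  fixes t :: real
  assumes "t > 0"
  shows "summable (\<lambda>m. 1 / (1 + real (Suc m) * t) ^ 2)"
    and "suminf (\<lambda>m. 1 / (1 + real (Suc m) * t) ^ 2) \<le> 1 / t"
proof -
  define g where "g m = (1 / t) * (1 / (1 + real m * t))" for m
  have tel: "(\<lambda>m. g m - g (Suc m)) sums (g 0 - 0)"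
  proof (rule telescope_sums')
    show "g \<longlonglongrightarrow> 0" unfolding g_def[abs_def] using assms by real_asymp
  qed
  have le: "1 / (1 + real (Suc m) * t) ^ 2 \<le> g m - g (Suc m)" for m
  proof -
    define a where "a = 1 + real m * t"
    have a: "a > 0" using assms by (simp add: a_def add_pos_nonneg)
    have b: "1 + real (Suc m) * t = a + t" by (simp add: a_def algebra_simps)
    have "g m - g (Suc m) = 1 / (a * (a + t))"
    proof -
      have "1 / a - 1 / (a + t) = t / (a * (a + t))"
        using a assms by (subst diff_frac_eq) auto
      then have "(1 / t) * (1 / a) - (1 / t) * (1 / (a + t)) = (1 / t) * (t / (a * (a + t)))"
        by (simp only: right_diff_distrib[symmetric])
      then show ?thesis
        unfolding g_def b a_def[symmetric] using assms by simp
    qed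
    also have "\<dots> \<ge> 1 / (a + t) ^ 2"
      unfolding power2_eq_square using a assms by (intro divide_left_mono mult_right_mono mult_pos_pos) auto
    finally show ?thesis unfolding b .
  qed
  show s: "summable (\<lambda>m. 1 / (1 + real (Suc m) * t) ^ 2)"
    by (rule summable_comparison_test[OF _ sums_summable[OF tel]]) (use le in auto)
  have "suminf (\<lambda>m. 1 / (1 + real (Suc m) * t) ^ 2) \<le> suminf (\<lambda>m. g m - g (Suc m))"
    by (rule suminf_le[OF le s sums_summable[OF tel]])
  then show "suminf (\<lambda>m. 1 / (1 + real (Suc m) * t) ^ 2) \<le> 1 / t"
    using tel by (simp add: sums_iff g_def)
qed

definition euler_log :: "complex \<Rightarrow> complex" where
  "euler_log w = lambert_log (exp (- w))"

lemma euler_log_sums: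
  assumes "Re w > 0"
  shows "(\<lambda>m. 1 / (of_nat (Suc m) * (exp (of_nat (Suc m) * w) - 1))) sums euler_log w"
proof -
  have "norm (exp (- w)) < 1" using assms by simp
  from summable_sums[OF summable_norm_cancel[OF lambert_summable[OF this]]]
  have "(\<lambda>m. exp (- w) ^ Suc m / (of_nat (Suc m) * (1 - exp (- w) ^ Suc m))) sums euler_log w"
    by (simp only: euler_log_def lambert_log_def)
  also have "(\<lambda>m. exp (- w) ^ Suc m / (of_nat (Suc m) * (1 - exp (- w) ^ Suc m)))
     = (\<lambda>m. 1 / (of_nat (Suc m) * (exp (of_nat (Suc m) * w) - 1)))"
  proof
    fix m
    define E where "E = exp (of_nat (Suc m) * w)"
    have e: "exp (- w) ^ Suc m = 1 / E"
      unfolding E_def by (metis exp_minus exp_of_nat_mult inverse_eq_divide power_inverse)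
    have E0: "E \<noteq> 0" by (simp add: E_def)
    show "exp (- w) ^ Suc m / (of_nat (Suc m) * (1 - exp (- w) ^ Suc m)) = 1 / (of_nat (Suc m) * (exp (of_nat (Suc m) * w) - 1))"
      unfolding e E_def[symmetric] using E0 by (simp add: divide_simps del: of_nat_Suc)
  qed
  finally show ?thesis .
qed

lemma euler_log_minus_pole_sums:
  assumes "Re w > 0"
  shows "(\<lambda>m. polar_remainder (of_nat (Suc m) * w) / of_nat (Suc m)) sums (euler_log w - of_real (pi ^ 2 / 6) / w)"
proof -
  have "(\<lambda>m. complex_of_real (1 / (real m + 1) ^ 2)) sums of_real (pi ^ 2 / 6)"
    using sums_of_real[OF inverse_squares_sums, where 'a=complex] by (simp add: add.commute)
  then have "(\<lambda>m. complex_of_real (1 / (real m + 1) ^ 2) / w) sums (of_real (pi ^ 2 / 6) / w)"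
    by (rule sums_divide)
  from sums_diff[OF euler_log_sums[OF assms] this]
  show ?thesis
    unfolding polar_remainder_def by (simp add: diff_divide_distrib power2_eq_square mult_ac add.commute)
qed

text \<open>
  After removal of the poles, the $m$-th term changes by at most $18|\theta|/(1+mt)^2$ along the vertical segment, by
  the mean value inequality; the bounds sum to $18|\theta|/t$.
\<close>

lemma euler_log_vertical_difference:
  assumes t: "t > 0" and th: "\<bar>\<theta>\<bar> \<le> t"
  defines "w \<equiv> Complex t (-\<theta>)"
  shows "norm ((euler_log w - of_real (pi ^ 2 / 6) / w) - (euler_log (of_real t) - of_real (pi ^ 2 / 6) / of_real t)) \<le> 18 * \<bar>\<theta>\<bar> / t"
proof -
  define f where "f m = polar_remainder (of_nat (Suc m) * w) / of_nat (Suc m) - polar_remainder (of_nat (Suc m) * of_real t) / of_nat (Suc m)" for m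
  have f: "f sums ((euler_log w - of_real (pi ^ 2 / 6) / w) - (euler_log (of_real t) - of_real (pi ^ 2 / 6) / of_real t))"
    unfolding f_def[abs_def] by (intro sums_diff euler_log_minus_pole_sums) (use t in \<open>simp_all add: w_def\<close>)
  have bound: "norm (f m) \<le> 18 * \<bar>\<theta>\<bar> * (1 / (1 + real (Suc m) * t) ^ 2)" for m
  proof -
    define k where "k = real (Suc m)"
    have k: "k > 0" by (simp add: k_def)
    have kw: "of_nat (Suc m) * w = Complex (k * t) (- (k * \<theta>))" "of_nat (Suc m) * complex_of_real t = of_real (k * t)"
      by (simp_all add: w_def k_def complex_eq_iff)
    have "norm (f m) = norm (polar_remainder (Complex (k * t) (- (k * \<theta>))) - polar_remainder (of_real (k * t))) / k"
      unfolding f_def kw diff_divide_distrib[symmetric] norm_divide norm_of_nat k_def ..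
    also have "\<dots> \<le> (18 / (1 + k * t) ^ 2 * \<bar>k * \<theta>\<bar>) / k"
      by (intro divide_right_mono polar_remainder_difference) (use k t th in \<open>simp_all add: abs_mult\<close>)
    also have "\<dots> = 18 * \<bar>\<theta>\<bar> * (1 / (1 + k * t) ^ 2)"
      using k by (simp add: abs_mult)
    finally show ?thesis by (simp only: k_def)
  qed
  note S = summable_mult[OF sum_inverse_square_bound(1)[OF t], of "18 * \<bar>\<theta>\<bar>"]
  have "norm (suminf f) \<le> suminf (\<lambda>m. 18 * \<bar>\<theta>\<bar> * (1 / (1 + real (Suc m) * t) ^ 2))"
    by (rule order_trans[OF summable_norm suminf_le[OF bound]])
       (use S summable_comparison_test'[OF S, of 0 f] summable_comparison_test'[OF S, of 0 "\<lambda>m. norm (f m)"] bound in auto)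
  also have "\<dots> = 18 * \<bar>\<theta>\<bar> * suminf (\<lambda>m. 1 / (1 + real (Suc m) * t) ^ 2)"
    by (rule suminf_mult[OF sum_inverse_square_bound(1)[OF t]])
  also have "\<dots> \<le> 18 * \<bar>\<theta>\<bar> * (1 / t)"
    by (intro mult_left_mono sum_inverse_square_bound(2)[OF t]) simp
  finally show ?thesis
    using f by (simp add: sums_iff)
qed

section \<open>Real asymptotics of Euler's product\<close>

definition euler_log_real :: "real \<Rightarrow> real" where
  "euler_log_real t = suminf (\<lambda>m. 1 / (real (Suc m) * (exp (real (Suc m) * t) - 1)))"

lemma euler_log_real_sums:
  assumes "t > 0"
  shows "(\<lambda>m. 1 / (real (Suc m) * (exp (real (Suc m) * t) - 1))) sums euler_log_real t"
    and "euler_log (of_real t) = of_real (euler_log_real t)"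
proof -
  have e: "(\<lambda>m. 1 / (of_nat (Suc m) * (exp (of_nat (Suc m) * complex_of_real t) - 1)))
     = (\<lambda>m. complex_of_real (1 / (real (Suc m) * (exp (real (Suc m) * t) - 1))))"
  proof
    fix m
    have "exp (of_nat (Suc m) * complex_of_real t) = of_real (exp (real (Suc m) * t))"
      by (simp only: exp_of_real[symmetric] of_real_mult of_real_of_nat_eq)
    then show "1 / (of_nat (Suc m) * (exp (of_nat (Suc m) * complex_of_real t) - 1))
      = complex_of_real (1 / (real (Suc m) * (exp (real (Suc m) * t) - 1)))"
      by (simp only: of_real_divide of_real_mult of_real_diff of_real_1 of_real_of_nat_eq)
  qed
  have *: "(\<lambda>m. complex_of_real (1 / (real (Suc m) * (exp (real (Suc m) * t) - 1)))) sums euler_log (of_real t)"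
    using euler_log_sums[of "of_real t"] assms unfolding e by simp
  then have "summable (\<lambda>m. 1 / (real (Suc m) * (exp (real (Suc m) * t) - 1)))"
    using sums_summable summable_complex_of_real by blast
  then show "(\<lambda>m. 1 / (real (Suc m) * (exp (real (Suc m) * t) - 1))) sums euler_log_real t"
    unfolding euler_log_real_def by (rule summable_sums)
  then show "euler_log (of_real t) = of_real (euler_log_real t)"
    using sums_of_real * sums_unique2 by blast
qed

text \<open>
  Dominated convergence with the majorant $1/m^2$, since $e^{mt}-1\ge mt$.
\<close>

lemma euler_log_real_times_tendsto: "((\<lambda>t. t * euler_log_real t) \<longlongrightarrow> pi ^ 2 / 6) (at_right 0)"
proof -
  define a where "a m t = t / (real (Suc m) * (exp (real (Suc m) * t) - 1))" for m t
  have "((\<lambda>t. suminf (\<lambda>m. a m t)) \<longlongrightarrow> suminf (\<lambda>m. 1 / (real m + 1) ^ 2)) (at_right 0)"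
  proof (rule tannerys_theorem[THEN conjunct2, THEN conjunct2])
    fix m
    define c where "c = real (Suc m)"
    have c: "c > 0" by (simp add: c_def)
    have "((\<lambda>t. t / (c * (exp (c * t) - 1))) \<longlongrightarrow> inverse c * inverse c) (at_right 0)"
      using c by real_asymp
    also have "inverse c * inverse c = 1 / c ^ 2"
      by (simp add: power2_eq_square divide_inverse)
    finally have "((\<lambda>t. t / (c * (exp (c * t) - 1))) \<longlongrightarrow> 1 / c ^ 2) (at_right 0)" .
    then show "(a m \<longlongrightarrow> 1 / (real m + 1) ^ 2) (at_right 0)"
      by (simp add: a_def[abs_def] c_def add.commute)
  next
    have bound: "norm (a m t) \<le> 1 / (real m + 1) ^ 2" if "t > 0" for m t
    proof -
      define c where "c = real (Suc m)"
      have c: "c > 0" by (simp add: c_def)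
      have "c * t \<le> exp (c * t) - 1" using exp_ge_add_one_self[of "c * t"] by linarith
      then have "c * (c * t) \<le> c * (exp (c * t) - 1)" using c by simp
      then have "t / (c * (exp (c * t) - 1)) \<le> t / (c * (c * t))"
        using c that by (intro divide_left_mono mult_pos_pos) auto
      also have "\<dots> = 1 / c ^ 2" using that c by (simp add: power2_eq_square)
      finally have "t / (c * (exp (c * t) - 1)) \<le> 1 / c ^ 2" .
      moreover have "t / (c * (exp (c * t) - 1)) \<ge> 0" using that c by simp
      ultimately have "norm (a m t) \<le> 1 / c ^ 2"
        unfolding a_def c_def[symmetric] by (simp only: real_norm_def abs_of_nonneg)
      then show ?thesis by (simp add: c_def add.commute)
    qed
    show "\<forall>\<^sub>F (m, t) in at_top \<times>\<^sub>F at_right 0. norm (a m t) \<le> 1 / (real m + 1) ^ 2"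
      using eventually_prodI[OF eventually_True eventually_at_right_less[of "0::real"]]
      by (rule eventually_mono) (auto intro: bound[unfolded real_norm_def])
    show "summable (\<lambda>m. 1 / (real m + 1) ^ 2)"
      using inverse_squares_sums by (simp add: sums_iff add.commute)
  qed simp
  also have "suminf (\<lambda>m. 1 / (real m + 1) ^ 2) = pi ^ 2 / 6"
    using inverse_squares_sums by (simp add: sums_iff add.commute)
  finally show ?thesis
  proof (rule Lim_transform_eventually)
    show "\<forall>\<^sub>F t in at_right 0. suminf (\<lambda>m. a m t) = t * euler_log_real t"
      using eventually_at_right_less[of "0::real"]
    proof eventually_elim
      case (elim t)
      have "(\<lambda>m. a m t) sums (t * euler_log_real t)"
        using sums_mult[OF euler_log_real_sums(1)[OF elim], of t] by (simp add: a_def)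
      then show ?case by (simp add: sums_iff)
    qed
  qed
qed

lemma sinh_mult_ge:
  fixes x :: real
  assumes "x \<ge> 0"
  shows "real n * sinh x \<le> sinh (real n * x)"
proof (induction n)
  case (Suc n)
  have "real (Suc n) * sinh x \<le> sinh (real n * x) * 1 + 1 * sinh x"
    using Suc by (simp add: algebra_simps)
  also have "\<dots> \<le> sinh (real n * x) * cosh x + cosh (real n * x) * sinh x"
    using assms cosh_real_ge_1 by (intro add_mono mult_left_mono mult_right_mono) auto
  also have "\<dots> = sinh (real (Suc n) * x)"
    unfolding sinh_add[symmetric] by (simp add: distrib_right add.commute)
  finally show ?case .
qed simp

text \<open>
  The $(k+1)$-st factor of the $q$-analogue of Wallis' product is $1$ plus this term, where $q=e^{-2x}$. It tends to $1/((2k+1)(2k+3))$ as $x\to0$.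
\<close>

definition wallis_term :: "nat \<Rightarrow> real \<Rightarrow> real" where
  "wallis_term k x = sinh x ^ 2 / (sinh (real (2 * k + 1) * x) * sinh (real (2 * k + 3) * x))"

text \<open>
  The bound is uniform in $x$ because $\sinh(nx)\ge n\sinh x$.
\<close>

lemma wallis_term_bounds:
  assumes "x > 0"
  shows "0 \<le> wallis_term k x" "wallis_term k x \<le> 1 / (real (2 * k + 1) * real (2 * k + 3))"
proof -
  define a b where "a = real (2 * k + 1)" and "b = real (2 * k + 3)"
  have ab: "a > 0" "b > 0" by (simp_all add: a_def b_def)
  have s: "sinh x > 0" "sinh (a * x) > 0" "sinh (b * x) > 0" using assms ab by simp_all
  show "0 \<le> wallis_term k x"
    unfolding wallis_term_def a_def[symmetric] b_def[symmetric] using s by simp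
  have "(a * sinh x) * (b * sinh x) \<le> sinh (a * x) * sinh (b * x)"
    unfolding a_def b_def using assms by (intro mult_mono sinh_mult_ge) auto
  then have "sinh x ^ 2 / (sinh (a * x) * sinh (b * x)) \<le> sinh x ^ 2 / ((a * sinh x) * (b * sinh x))"
    using s ab by (intro divide_left_mono mult_pos_pos zero_le_power2) auto
  also have "\<dots> = 1 / (a * b)"
    using s by (simp add: power2_eq_square)
  finally show "wallis_term k x \<le> 1 / (real (2 * k + 1) * real (2 * k + 3))"
    unfolding wallis_term_def a_def b_def .
qed

text \<open>
  This is $\sinh^2c=\sinh(c-x)\sinh(c+x)+\sinh^2x$, written with $1-q^n=2e^{-nx}\sinh(nx)$.
\<close>

lemma wallis_factor:
  fixes t :: real
  assumes "t > 0"
  defines "q \<equiv> exp (- t)"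
  shows "1 + wallis_term k (t / 2) = (1 - q ^ (2 * k + 2)) ^ 2 / ((1 - q ^ (2 * k + 1)) * (1 - q ^ (2 * k + 3)))"
proof -
  define x where "x = t / 2"
  have x: "x > 0" using assms by (simp add: x_def)
  have q: "1 - q ^ n = 2 * exp (- (real n * x)) * sinh (real n * x)" for n
  proof -
    have "exp (- (real n * x)) * exp (real n * x) = 1" "exp (- (real n * x)) * exp (- (real n * x)) = q ^ n"
      by (simp_all add: q_def x_def flip: exp_add exp_of_nat_mult)
    then show ?thesis by (simp add: sinh_def algebra_simps)
  qed
  define a b c where "a = real (2 * k + 1) * x" and "b = real (2 * k + 3) * x" and "c = real (2 * k + 2) * x"
  have pos: "sinh a > 0" "sinh b > 0" using x by (simp_all add: a_def b_def)
  have abc: "a = c - x" "b = c + x" "- a + - b = - c + - c"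
    by (simp_all add: a_def b_def c_def algebra_simps)
  have "sinh a * sinh b + sinh x ^ 2 = sinh c ^ 2"
  proof -
    have "sinh a * sinh b = (sinh c * cosh x) ^ 2 - (cosh c * sinh x) ^ 2"
      unfolding abc sinh_add sinh_diff by (simp add: algebra_simps power2_eq_square)
    also have "\<dots> = sinh c ^ 2 * (1 + sinh x ^ 2) - (1 + sinh c ^ 2) * sinh x ^ 2"
      by (simp add: power_mult_distrib cosh_square_eq add.commute)
    finally show ?thesis by (simp add: algebra_simps)
  qed
  then have "1 + wallis_term k x = sinh c ^ 2 / (sinh a * sinh b)"
    unfolding wallis_term_def a_def[symmetric] b_def[symmetric] using pos by (simp add: field_simps)
  also have "\<dots> = (2 * exp (- c) * sinh c) ^ 2 / ((2 * exp (- a) * sinh a) * (2 * exp (- b) * sinh b))"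
  proof -
    have "(2 * exp (- a) * sinh a) * (2 * exp (- b) * sinh b) = 4 * exp (- a + - b) * (sinh a * sinh b)"
      by (simp only: exp_add) simp
    moreover have "(2 * exp (- c) * sinh c) ^ 2 = 4 * exp (- c + - c) * sinh c ^ 2"
      by (simp only: exp_add) (simp add: power2_eq_square)
    ultimately show ?thesis
      unfolding abc(3) by (simp only:) simp
  qed
  finally show ?thesis
    unfolding q x_def[symmetric] a_def b_def c_def .
qed

text \<open>
  The finite form of $\prod_k\frac{(1-q^{2k})^2}{(1-q^{2k-1})(1-q^{2k+1})}=(1-q)\,\frac{P(q)^2}{P(q^2)^4}$.
\<close>

lemma wallis_product:
  fixes t :: real
  assumes "t > 0"
  defines "q \<equiv> exp (- t)"
  shows "(\<Prod>k<K. 1 + wallis_term k (t / 2)) =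
     ((\<Prod>k=1..2 * K. 1 / (1 - q ^ k)) / (\<Prod>k=1..K. 1 / (1 - (q ^ 2) ^ k)) ^ 2) ^ 2 * (1 - q) / (1 - q ^ (2 * K + 1))"
proof (induction K)
  case 0
  have "q < 1" using assms by (simp add: q_def)
  then show ?case by simp
next
  case (Suc K)
  have nz: "1 - q ^ k \<noteq> 0" if "k \<ge> 1" for k
    using assms that by (auto simp: q_def simp flip: exp_of_nat_mult)
  define a b c where "a = 1 - q ^ (2 * K + 1)" and "b = 1 - q ^ (2 * K + 2)" and "c = 1 - q ^ (2 * K + 3)"
  have abc: "a \<noteq> 0" "b \<noteq> 0" "c \<noteq> 0" unfolding a_def b_def c_def by (intro nz; simp)+
  define P R where "P = (\<Prod>k=1..2 * K. 1 / (1 - q ^ k))" and "R = (\<Prod>k=1..K. 1 / (1 - (q ^ 2) ^ k))"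
  have R0: "R \<noteq> 0"
    unfolding R_def using nz by (auto simp: power_mult[symmetric])
  have P': "(\<Prod>k=1..2 * Suc K. 1 / (1 - q ^ k)) = P / (a * b)"
    unfolding P_def a_def b_def by (simp add: numeral_eq_Suc)
  have R': "(\<Prod>k=1..Suc K. 1 / (1 - (q ^ 2) ^ k)) = R / b"
    unfolding R_def b_def by (simp add: power_mult power2_eq_square mult.assoc power_add)
  have c': "1 - q ^ (2 * Suc K + 1) = c" by (simp add: c_def numeral_3_eq_3)
  have "(\<Prod>k<Suc K. 1 + wallis_term k (t / 2)) = ((P / R ^ 2) ^ 2 * (1 - q) / a) * (b ^ 2 / (a * c))"
    unfolding prod.lessThan_Suc Suc.IH unfolding wallis_factor[OF assms(1)] P_def R_def a_def b_def c_def q_def ..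
  also have "\<dots> = (P / (a * b) / (R / b) ^ 2) ^ 2 * (1 - q) / c"
    using abc R0 by (simp add: divide_simps) (simp add: power2_eq_square power4_eq_xxxx algebra_simps)
  finally show ?case
    unfolding P' R' c' .
qed

lemma euler_log_real_euler_prod:
  assumes "t > 0"
  shows "(\<lambda>K. \<Prod>k=1..K. 1 / (1 - exp (- t) ^ k)) \<longlonglongrightarrow> exp (euler_log_real t)"
proof -
  have "(\<lambda>K. \<Prod>k=1..K. 1 / (1 - exp (- complex_of_real t) ^ k)) \<longlonglongrightarrow> exp (lambert_log (exp (- complex_of_real t)))"
    by (rule euler_prod_tendsto) (use assms in simp)
  also have "exp (lambert_log (exp (- complex_of_real t))) = of_real (exp (euler_log_real t))"
    using euler_log_real_sums(2)[OF assms] by (simp add: euler_log_def exp_of_real)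
  also have "(\<lambda>K. \<Prod>k=1..K. 1 / (1 - exp (- complex_of_real t) ^ k)) = (\<lambda>K. of_real (\<Prod>k=1..K. 1 / (1 - exp (- t) ^ k)))"
    by (simp flip: exp_of_real)
  finally show ?thesis
    by (simp only: tendsto_of_real_iff)
qed

lemma wallis_term_ln_summable:
  assumes "x > 0"
  shows "summable (\<lambda>k. ln (1 + wallis_term k x))" and "\<bar>ln (1 + wallis_term k x)\<bar> \<le> 1 / (real k + 1) ^ 2"
proof -
  have le: "\<bar>ln (1 + wallis_term k x)\<bar> \<le> 1 / (real k + 1) ^ 2" for k
  proof -
    have "\<bar>ln (1 + wallis_term k x)\<bar> \<le> wallis_term k x"
      using wallis_term_bounds(1)[OF assms, of k] ln_add_one_self_le_self[of "wallis_term k x"] by simp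
    also have "\<dots> \<le> 1 / (real (2 * k + 1) * real (2 * k + 3))"
      by (rule wallis_term_bounds(2)[OF assms])
    also have "\<dots> \<le> 1 / (real k + 1) ^ 2"
      unfolding power2_eq_square by (intro divide_left_mono mult_mono mult_pos_pos) auto
    finally show ?thesis .
  qed
  then show "\<bar>ln (1 + wallis_term k x)\<bar> \<le> 1 / (real k + 1) ^ 2" .
  have "summable (\<lambda>m. 1 / (real m + 1) ^ 2)"
    using inverse_squares_sums by (simp add: sums_iff add.commute)
  then show "summable (\<lambda>k. ln (1 + wallis_term k x))"
    by (rule summable_comparison_test') (use le in auto)
qed

lemma euler_log_real_wallis:
  assumes "t > 0"
  shows "2 * euler_log_real t - 4 * euler_log_real (2 * t) + ln (1 - exp (- t)) = suminf (\<lambda>k. ln (1 + wallis_term k (t / 2)))"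
proof -
  define q where "q = exp (- t)"
  have q: "0 < q" "q < 1" using assms by (simp_all add: q_def)
  have q2: "q ^ 2 = exp (- (2 * t))" by (simp add: q_def power2_eq_square flip: exp_add)
  define S where "S = suminf (\<lambda>k. ln (1 + wallis_term k (t / 2)))"
  have pos: "1 + wallis_term k (t / 2) > 0" for k
    using wallis_term_bounds(1)[of "t / 2" k] assms by simp
  have "(\<lambda>K. \<Sum>k<K. ln (1 + wallis_term k (t / 2))) \<longlonglongrightarrow> S"
    unfolding S_def by (rule summable_LIMSEQ, rule wallis_term_ln_summable) (use assms in simp)
  then have "(\<lambda>K. exp (\<Sum>k<K. ln (1 + wallis_term k (t / 2)))) \<longlonglongrightarrow> exp S"
    by (rule tendsto_exp)
  then have lim1: "(\<lambda>K. \<Prod>k<K. 1 + wallis_term k (t / 2)) \<longlonglongrightarrow> exp S"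
    by (simp add: exp_sum exp_ln[OF pos])
  have P: "(\<lambda>K. \<Prod>k=1..2 * K. 1 / (1 - q ^ k)) \<longlonglongrightarrow> exp (euler_log_real t)"
    using LIMSEQ_subseq_LIMSEQ[OF euler_log_real_euler_prod[OF assms], of "\<lambda>K. 2 * K"]
    by (simp add: q_def strict_mono_def o_def)
  have R: "(\<lambda>K. \<Prod>k=1..K. 1 / (1 - (q ^ 2) ^ k)) \<longlonglongrightarrow> exp (euler_log_real (2 * t))"
    unfolding q2 by (rule euler_log_real_euler_prod) (use assms in simp)
  have "(\<lambda>K. q ^ (2 * K + 1)) \<longlonglongrightarrow> 0"
    using LIMSEQ_subseq_LIMSEQ[OF LIMSEQ_power_zero[of q], of "\<lambda>K. 2 * K + 1"] q
    by (simp add: strict_mono_def o_def)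
  then have "(\<lambda>K. ((\<Prod>k=1..2 * K. 1 / (1 - q ^ k)) / (\<Prod>k=1..K. 1 / (1 - (q ^ 2) ^ k)) ^ 2) ^ 2 * (1 - q) / (1 - q ^ (2 * K + 1)))
     \<longlonglongrightarrow> (exp (euler_log_real t) / exp (euler_log_real (2 * t)) ^ 2) ^ 2 * (1 - q) / (1 - 0)"
    by (intro tendsto_intros P R) auto
  then have "(\<lambda>K. \<Prod>k<K. 1 + wallis_term k (t / 2)) \<longlonglongrightarrow> (exp (euler_log_real t) / exp (euler_log_real (2 * t)) ^ 2) ^ 2 * (1 - q) / (1 - 0)"
    unfolding wallis_product[OF assms] q_def .
  from LIMSEQ_unique[OF lim1 this]
  have "exp S = (exp (euler_log_real t) / exp (euler_log_real (2 * t)) ^ 2) ^ 2 * (1 - q)" by simp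
  then have "ln (exp S) = ln ((exp (euler_log_real t) / exp (euler_log_real (2 * t)) ^ 2) ^ 2 * (1 - q))" by simp
  also have "\<dots> = 2 * euler_log_real t - 4 * euler_log_real (2 * t) + ln (1 - q)"
    using q by (simp add: ln_mult ln_div ln_realpow)
  finally show ?thesis by (simp add: S_def q_def)
qed

text \<open>
  Termwise limit in the logarithm of the product; the limiting product is that of Wallis.
\<close>

lemma wallis_ln_tendsto:
  "((\<lambda>t. suminf (\<lambda>k. ln (1 + wallis_term k (t / 2)))) \<longlongrightarrow> ln (pi / 2)) (at_right 0)"
proof -
  define b where "b k = ln (1 + 1 / (real (2 * k + 1) * real (2 * k + 3)))" for k
  have "((\<lambda>t. suminf (\<lambda>k. ln (1 + wallis_term k (t / 2)))) \<longlongrightarrow> suminf b) (at_right 0)"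
  proof (rule tannerys_theorem[THEN conjunct2, THEN conjunct2])
    fix k
    define c d where "c = real (2 * k + 1)" and "d = real (2 * k + 3)"
    have cd: "c > 0" "d > 0" by (simp_all add: c_def d_def)
    have "((\<lambda>t. sinh (t / 2) ^ 2 / (sinh (c * (t / 2)) * sinh (d * (t / 2)))) \<longlongrightarrow> 1 / (c * d)) (at_right 0)"
      using cd by (real_asymp simp: power2_eq_square)
    then have "((\<lambda>t. ln (1 + sinh (t / 2) ^ 2 / (sinh (c * (t / 2)) * sinh (d * (t / 2))))) \<longlongrightarrow> ln (1 + 1 / (c * d))) (at_right 0)"
    proof (intro tendsto_ln tendsto_add tendsto_const)
      have "0 < 1 / (c * d)" using cd by simp
      then show "1 + 1 / (c * d) \<noteq> 0" by linarith
    qed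
    then show "((\<lambda>t. ln (1 + wallis_term k (t / 2))) \<longlongrightarrow> b k) (at_right 0)"
      by (simp only: wallis_term_def b_def c_def d_def)
  next
    show "\<forall>\<^sub>F (k, t) in at_top \<times>\<^sub>F at_right 0. norm (ln (1 + wallis_term k (t / 2))) \<le> 1 / (real k + 1) ^ 2"
      using eventually_prodI[OF eventually_True eventually_at_right_less[of "0::real"]]
      by (rule eventually_mono) (auto intro: wallis_term_ln_summable(2))
    show "summable (\<lambda>m. 1 / (real m + 1) ^ 2)"
      using inverse_squares_sums by (simp add: sums_iff add.commute)
  qed simp
  moreover have "suminf b = ln (pi / 2)"
  proof -
    have "(\<lambda>n. ln (\<Prod>k=1..n. (4 * real k ^ 2) / (4 * real k ^ 2 - 1))) \<longlonglongrightarrow> ln (pi / 2)"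
      by (intro tendsto_ln wallis) simp
    also have "(\<lambda>n. ln (\<Prod>k=1..n. (4 * real k ^ 2) / (4 * real k ^ 2 - 1))) = (\<lambda>n. \<Sum>k<n. b k)"
    proof
      fix n
      have f: "(4 * real (Suc k) ^ 2) / (4 * real (Suc k) ^ 2 - 1) = 1 + 1 / (real (2 * k + 1) * real (2 * k + 3))" for k
      proof -
        have "4 * real (Suc k) ^ 2 - 1 = real (2 * k + 1) * real (2 * k + 3)"
          by (simp add: power2_eq_square algebra_simps)
        moreover have "real (2 * k + 1) * real (2 * k + 3) \<noteq> 0" by simp
        ultimately show ?thesis by (simp add: field_simps)
      qed
      have "(\<Prod>k=1..n. (4 * real k ^ 2) / (4 * real k ^ 2 - 1)) = (\<Prod>k<n. (4 * real (Suc k) ^ 2) / (4 * real (Suc k) ^ 2 - 1))"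
        by (rule prod.reindex_bij_witness[of _ Suc "\<lambda>k. k - 1"]) auto
      also have "\<dots> = (\<Prod>k<n. 1 + 1 / (real (2 * k + 1) * real (2 * k + 3)))"
        by (simp only: f)
      also have "ln \<dots> = (\<Sum>k<n. b k)"
        unfolding b_def
      proof (rule ln_prod)
        fix k
        have "0 < 1 / (real (2 * k + 1) * real (2 * k + 3))" by simp
        then show "1 + 1 / (real (2 * k + 1) * real (2 * k + 3)) \<noteq> 0" by linarith
      qed simp
      finally show "ln (\<Prod>k=1..n. (4 * real k ^ 2) / (4 * real k ^ 2 - 1)) = (\<Sum>k<n. b k)" .
    qed
    finally have "b sums ln (pi / 2)" by (simp add: sums_def)
    then show ?thesis by (simp add: sums_iff)
  qed
  ultimately show ?thesis by simp
qed

text \<open>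
  Iterating $d(t)=2d(2t)+o(1)$ towards $0$ halves the error at each step,
  $|d(t)|\le2^{-J}|d(2^{-J}t)|+\varepsilon$, and the first summand vanishes as $J\to\infty$ by the first assumption.
\<close>

lemma tendsto_zero_by_halving:
  fixes d :: "real \<Rightarrow> real"
  assumes small: "((\<lambda>t. t * d t) \<longlongrightarrow> 0) (at_right 0)"
    and rec: "((\<lambda>t. d t - 2 * d (2 * t)) \<longlongrightarrow> 0) (at_right 0)"
  shows "(d \<longlongrightarrow> 0) (at_right 0)"
proof (rule tendstoI)
  fix e :: real assume e: "e > 0"
  have "eventually (\<lambda>t. dist (d t - 2 * d (2 * t)) 0 < e / 2) (at_right 0)"
    using rec e by (intro tendstoD) auto
  then obtain b where b: "b > 0" "\<And>t. 0 < t \<Longrightarrow> t < b \<Longrightarrow> \<bar>d t - 2 * d (2 * t)\<bar> < e / 2"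
    by (auto simp: eventually_at_right_field)
  have "\<bar>d t\<bar> < e" if t: "0 < t" "t < b" for t
  proof -
    have iter: "\<bar>d t\<bar> \<le> \<bar>d (t / 2 ^ J)\<bar> / 2 ^ J + e / 2" for J
    proof -
      have "\<bar>d t\<bar> \<le> \<bar>d (t / 2 ^ J)\<bar> / 2 ^ J + (e / 2) * (1 - 1 / 2 ^ J)"
      proof (induction J)
        case (Suc J)
        define s where "s = t / 2 ^ Suc J"
        have s: "0 < s" "s \<le> t" using t by (simp_all add: s_def divide_le_eq mult_le_cancel_left1 del: power_Suc)
        have s2: "t / 2 ^ J = 2 * s" by (simp add: s_def)
        have "\<bar>2 * d (2 * s)\<bar> \<le> \<bar>d s\<bar> + e / 2"
          using b(2)[of s] s t by linarith
        then have "\<bar>d (2 * s)\<bar> / 2 ^ J \<le> ((\<bar>d s\<bar> + e / 2) / 2) / 2 ^ J"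
          by (intro divide_right_mono) (auto simp: abs_mult)
        then show ?case
          using Suc.IH unfolding s2 s_def[symmetric] by (simp add: field_simps)
      qed simp
      also have "(e / 2) * (1 - 1 / 2 ^ J) \<le> e / 2" using e by simp
      finally show ?thesis by simp
    qed
    have "filterlim (\<lambda>J. t / 2 ^ J) (at_right 0) sequentially"
      using t by real_asymp
    from filterlim_compose[OF small this]
    have "(\<lambda>J. \<bar>t / 2 ^ J * d (t / 2 ^ J)\<bar> / t + e / 2) \<longlonglongrightarrow> \<bar>0\<bar> / t + e / 2"
      using t by (intro tendsto_intros) auto
    moreover have "\<bar>d t\<bar> \<le> \<bar>t / 2 ^ J * d (t / 2 ^ J)\<bar> / t + e / 2" for J
      using iter[of J] t by (simp add: abs_mult)
    ultimately have "\<bar>d t\<bar> \<le> e / 2"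
      by (intro LIMSEQ_le_const[of _ "e / 2"]) auto
    then show ?thesis using e by simp
  qed
  then show "eventually (\<lambda>t. dist (d t) 0 < e) (at_right 0)"
    using b(1) by (auto simp: eventually_at_right_field)
qed

text \<open>
  The error $d(t)$ of the expansion satisfies $t\,d(t)\to0$ by the leading-order asymptotics, and
  $d(t)-2d(2t)\to0$ by the $q$-Wallis product. The constant $2\pi$ is the one for which the second limit is $0$.
\<close>

theorem euler_log_real_asymptotics:
  "((\<lambda>t. euler_log_real t - (pi ^ 2 / (6 * t) + ln (t / (2 * pi)) / 2)) \<longlongrightarrow> 0) (at_right 0)"
proof (rule tendsto_zero_by_halving)
  have "((\<lambda>t. t * euler_log_real t - (pi ^ 2 / 6 + t * ln (t / (2 * pi)) / 2)) \<longlongrightarrow> pi ^ 2 / 6 - (pi ^ 2 / 6 + 0)) (at_right 0)"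
  proof (intro tendsto_diff tendsto_add euler_log_real_times_tendsto tendsto_const)
    show "((\<lambda>t. t * ln (t / (2 * pi)) / 2) \<longlongrightarrow> 0) (at_right 0)" by real_asymp
  qed
  then have "((\<lambda>t. t * euler_log_real t - (pi ^ 2 / 6 + t * ln (t / (2 * pi)) / 2)) \<longlongrightarrow> 0) (at_right 0)"
    by simp
  then show "((\<lambda>t. t * (euler_log_real t - (pi ^ 2 / (6 * t) + ln (t / (2 * pi)) / 2))) \<longlongrightarrow> 0) (at_right 0)"
  proof (rule Lim_transform_eventually)
    show "\<forall>\<^sub>F t in at_right 0. t * euler_log_real t - (pi ^ 2 / 6 + t * ln (t / (2 * pi)) / 2)
        = t * (euler_log_real t - (pi ^ 2 / (6 * t) + ln (t / (2 * pi)) / 2))"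
      using eventually_at_right_less[of "0::real"] by eventually_elim (simp add: field_simps)
  qed
next
  define A where "A t = suminf (\<lambda>k. ln (1 + wallis_term k (t / 2)))" for t
  have "((\<lambda>t. A t / 2 + (ln (t / (1 - exp (- t))) / 2 + (ln 2 - ln (2 * pi) / 2))) \<longlongrightarrow> ln (pi / 2) / 2 + (0 + (ln 2 - ln (2 * pi) / 2))) (at_right 0)"
    unfolding A_def
  proof (intro tendsto_add tendsto_divide wallis_ln_tendsto tendsto_const)
    show "((\<lambda>t. ln (t / (1 - exp (- t))) / 2) \<longlongrightarrow> (0::real)) (at_right 0)" by real_asymp
  qed simp
  also have "ln (pi / 2) / 2 + (0 + (ln 2 - ln (2 * pi) / 2)) = 0"
    by (simp add: ln_div ln_mult field_simps)
  finally show "((\<lambda>t. (euler_log_real t - (pi ^ 2 / (6 * t) + ln (t / (2 * pi)) / 2)) -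
       2 * (euler_log_real (2 * t) - (pi ^ 2 / (6 * (2 * t)) + ln (2 * t / (2 * pi)) / 2))) \<longlongrightarrow> 0) (at_right 0)"
  proof (rule Lim_transform_eventually)
    show "\<forall>\<^sub>F t in at_right 0. A t / 2 + (ln (t / (1 - exp (- t))) / 2 + (ln 2 - ln (2 * pi) / 2)) =
       (euler_log_real t - (pi ^ 2 / (6 * t) + ln (t / (2 * pi)) / 2)) -
       2 * (euler_log_real (2 * t) - (pi ^ 2 / (6 * (2 * t)) + ln (2 * t / (2 * pi)) / 2))"
      using eventually_at_right_less[of "0::real"]
    proof eventually_elim
      case (elim t)
      have l: "ln (t / (1 - exp (- t))) = ln t - ln (1 - exp (- t))" "ln (t / (2 * pi)) = ln t - ln (2 * pi)"
        "ln (2 * t / (2 * pi)) = ln 2 + ln t - ln (2 * pi)"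
        using elim by (simp_all add: ln_div ln_mult)
      have A: "A t = 2 * euler_log_real t - 4 * euler_log_real (2 * t) + ln (1 - exp (- t))"
        unfolding A_def using euler_log_real_wallis[OF elim] by simp
      have p: "2 * (pi ^ 2 / (6 * (2 * t))) = pi ^ 2 / (6 * t)" by simp
      show ?case
        unfolding l A using p by argo
    qed
  qed
qed

section \<open>The circle method\<close>

text \<open>
  Cauchy's coefficient formula on the circle of radius $r$, by termwise integration. The series at the
  positive point of the circle is a majorant for all angles.
\<close>

lemma coefficient_integral:
  fixes c :: "nat \<Rightarrow> real" and F :: "real \<Rightarrow> complex"
  assumes r: "0 < r" and nn: "\<And>k. c k \<ge> 0" and summ: "summable (\<lambda>k. c k * r ^ k)"
    and F: "\<And>\<theta>. (\<lambda>k. of_real (c k) * (of_real r * cis \<theta>) ^ k) sums F \<theta>"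
  shows "(LINT \<theta>|lborel. indicator {-pi..pi} \<theta> *\<^sub>R (F \<theta> * cis (- (real n * \<theta>)))) = of_real (2 * pi * c n * r ^ n)"
    and "(\<lambda>\<theta>. indicator {-pi..pi} \<theta> *\<^sub>R (F \<theta> * cis (- (real n * \<theta>)))) \<in> borel_measurable borel"
proof -
  define f where "f k \<theta> = indicator {-pi..pi} \<theta> *\<^sub>R (of_real (c k * r ^ k) * cis ((real k - real n) * \<theta>))" for k \<theta>
  have cont: "continuous_on {-pi..pi} (\<lambda>\<theta>. of_real (c k * r ^ k) * cis ((real k - real n) * \<theta>))" for k
    by (intro continuous_intros)
  have int: "integrable lborel (f k)" for k
    unfolding f_def by (rule borel_integrable_compact[OF compact_Icc cont])
  have nrm: "norm (f k \<theta>) = (c k * r ^ k) * indicator {-pi..pi} \<theta>" for k \<theta>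
    using nn r by (simp add: f_def norm_mult norm_power split: split_indicator)
  have int_nrm: "(LINT \<theta>|lborel. norm (f k \<theta>)) = c k * r ^ k * (2 * pi)" for k
    unfolding nrm by simp
  have sm: "summable (\<lambda>k. norm (f k \<theta>))" for \<theta>
    unfolding nrm by (intro summable_mult2 summ)
  have val: "(LINT \<theta>|lborel. f k \<theta>) = (if k = n then of_real (2 * pi * c n * r ^ n) else 0)" for k
  proof (cases "k = n")
    case True
    have "f k = (\<lambda>\<theta>. indicator {-pi..pi} \<theta> *\<^sub>R complex_of_real (c n * r ^ n))"
      by (simp add: f_def fun_eq_iff True)
    then show ?thesis using True by (simp add: scaleR_conv_of_real)
  next
    case False
    define d where "d = real k - real n"
    define C where "C = complex_of_real (c k * r ^ k)"
    have d: "d \<noteq> 0" using False by (simp add: d_def)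
    define G where "G \<theta> = C * (cis (d * \<theta>) / (\<i> * of_real d))" for \<theta>
    have "(G has_vector_derivative (C * cis (d * \<theta>))) (at \<theta> within {-pi..pi})" for \<theta>
    proof -
      have "((\<lambda>\<theta>. exp (\<i> * of_real (d * \<theta>))) has_vector_derivative (\<i> * of_real d * exp (\<i> * of_real (d * \<theta>)))) (at \<theta> within {-pi..pi})"
      proof -
        have "((\<lambda>z. exp (\<i> * of_real d * z)) has_field_derivative (\<i> * of_real d * exp (\<i> * of_real d * of_real \<theta>))) (at (of_real \<theta>))"
          by (auto intro!: derivative_eq_intros)
        from has_vector_derivative_real_field[OF this]
        show ?thesis by (simp add: mult.assoc has_vector_derivative_at_within)
      qed
      from has_vector_derivative_mult_right[OF has_vector_derivative_divide[OF this, of "\<i> * of_real d"], of C]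
      show ?thesis
        unfolding G_def[abs_def] cis_conv_exp using d by simp
    qed
    then have "(LINT \<theta>|lborel. f k \<theta>) = G pi - G (- pi)"
      unfolding f_def d_def[symmetric] C_def[symmetric]
      by (intro integral_FTC_Icc) (auto intro!: continuous_intros)
    also have "cis (d * pi) = cis (d * (- pi))"
    proof -
      have "cis (d * pi - d * (- pi)) = cis (2 * pi * d)" by (simp add: algebra_simps)
      also have "\<dots> = 1" by (rule cis_multiple_2pi) (simp add: d_def)
      finally have "cis (d * pi) / cis (d * (- pi)) = 1" by (simp only: cis_divide)
      then show ?thesis by (simp add: divide_eq_1_iff)
    qed
    then have "G pi - G (- pi) = 0" by (simp add: G_def)
    finally show ?thesis using False by simp
  qed
  have eq: "indicator {-pi..pi} \<theta> *\<^sub>R (F \<theta> * cis (- (real n * \<theta>))) = suminf (\<lambda>k. f k \<theta>)" for \<theta>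
  proof -
    have "(\<lambda>k. indicator {-pi..pi} \<theta> *\<^sub>R ((of_real (c k) * (of_real r * cis \<theta>) ^ k) * cis (- (real n * \<theta>)))) sums (indicator {-pi..pi} \<theta> *\<^sub>R (F \<theta> * cis (- (real n * \<theta>))))"
      by (intro sums_scaleR_right sums_mult2 F)
    also have "(\<lambda>k. indicator {-pi..pi} \<theta> *\<^sub>R ((of_real (c k) * (of_real r * cis \<theta>) ^ k) * cis (- (real n * \<theta>)))) = (\<lambda>k. f k \<theta>)"
    proof
      fix k
      have "cis \<theta> ^ k * cis (- (real n * \<theta>)) = cis ((real k - real n) * \<theta>)"
        unfolding Complex.DeMoivre cis_mult by (simp add: left_diff_distrib)
      then show "indicator {-pi..pi} \<theta> *\<^sub>R ((of_real (c k) * (of_real r * cis \<theta>) ^ k) * cis (- (real n * \<theta>))) = f k \<theta>"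
        by (simp add: f_def power_mult_distrib mult.assoc)
    qed
    finally show ?thesis by (simp add: sums_iff)
  qed
  have "(\<lambda>k. LINT \<theta>|lborel. f k \<theta>) sums (LINT \<theta>|lborel. suminf (\<lambda>k. f k \<theta>))"
    by (rule sums_integral[OF int]) (use sm summ in \<open>auto simp: int_nrm intro!: summable_mult2\<close>)
  moreover have "(\<lambda>k. LINT \<theta>|lborel. f k \<theta>) sums of_real (2 * pi * c n * r ^ n)"
    unfolding val using sums_If_finite_set[of "{n}" "\<lambda>_. complex_of_real (2 * pi * c n * r ^ n)"] by simp
  ultimately have "(LINT \<theta>|lborel. suminf (\<lambda>k. f k \<theta>)) = of_real (2 * pi * c n * r ^ n)"
    by (rule sums_unique2)
  then show "(LINT \<theta>|lborel. indicator {-pi..pi} \<theta> *\<^sub>R (F \<theta> * cis (- (real n * \<theta>)))) = of_real (2 * pi * c n * r ^ n)"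
    by (simp only: eq)
  have "integrable lborel (\<lambda>\<theta>. suminf (\<lambda>k. f k \<theta>))"
    by (rule integrable_suminf[OF int]) (use sm summ in \<open>auto simp: int_nrm intro!: summable_mult2\<close>)
  then show "(\<lambda>\<theta>. indicator {-pi..pi} \<theta> *\<^sub>R (F \<theta> * cis (- (real n * \<theta>)))) \<in> borel_measurable borel"
    unfolding eq by (auto dest: borel_measurable_integrable)
qed

text \<open>
  A crude form of $\sin x\ge 2x/\pi$, from $\sin x\ge x-x^3/6$ at $x=|\theta|/2\le2$.
\<close>

lemma one_minus_cos_lower:
  fixes \<theta> :: real
  assumes "\<bar>\<theta>\<bar> \<le> pi"
  shows "\<theta> ^ 2 / 18 \<le> 1 - cos \<theta>"
proof -
  define x where "x = \<bar>\<theta>\<bar> / 2"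
  have x: "0 \<le> x" "x \<le> 2" using assms pi_less_4 by (auto simp: x_def)
  have "\<bar>sin x - (\<Sum>m<3. sin_coeff m * x ^ m)\<bar> \<le> inverse (fact 3) * \<bar>x\<bar> ^ 3"
    by (rule Maclaurin_sin_bound)
  also have "(\<Sum>m<3. sin_coeff m * x ^ m) = x"
    by (simp add: sin_coeff_def numeral_3_eq_3)
  also have "inverse (fact 3) * \<bar>x\<bar> ^ 3 = x ^ 3 / 6"
    using x by (simp add: fact_numeral field_simps)
  finally have "x - x ^ 3 / 6 \<le> sin x" by linarith
  moreover have "x ^ 3 / 6 \<le> 2 / 3 * x"
  proof -
    have "x * x ^ 2 \<le> x * 2 ^ 2" using x by (intro mult_left_mono power_mono) auto
    then show ?thesis by (simp add: power3_eq_cube power2_eq_square)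
  qed
  ultimately have "x / 3 \<le> sin x" by linarith
  then have "(x / 3) ^ 2 \<le> sin x ^ 2" using x by (intro power_mono) auto
  moreover have "1 - cos \<theta> = 2 * sin x ^ 2"
    using cos_double_sin[of x] by (simp add: x_def)
  ultimately show ?thesis by (simp add: x_def power_divide)
qed

lemma exp_minus_one_upper:
  fixes t :: real
  assumes "0 \<le> t" "t \<le> 1"
  shows "exp t - 1 \<le> 2 * t"
proof -
  have "exp t \<le> 1 + t + t ^ 2" using assms by (rule exp_bound)
  moreover have "t ^ 2 \<le> t" using assms by (simp add: power2_eq_square mult_left_le)
  ultimately show ?thesis by linarith
qed

text \<open>
  No term of $\log P(e^{-w})=\sum_m\frac{1}{m(e^{mw}-1)}$ has a larger real part than on the real axis. The term $m=1$ alone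
  already falls short by at least the stated amount: with $D=e^t-1$ and $y=e^t(1-\cos\theta)$ it loses
  $\frac{(2+D)y}{D(D^2+2y)}$.
\<close>

lemma Re_euler_log_bound:
  assumes t: "0 < t" "t \<le> 1" and th: "\<bar>\<theta>\<bar> \<le> pi"
  shows "Re (euler_log (Complex t (-\<theta>))) \<le> euler_log_real t - \<theta> ^ 2 / (2 * t * (36 * t ^ 2 + \<theta> ^ 2))"
proof -
  define w where "w = Complex t (-\<theta>)"
  define g where "g m = 1 / (real (Suc m) * (exp (real (Suc m) * t) - 1))" for m
  define f where "f m = Re (1 / (of_nat (Suc m) * (exp (of_nat (Suc m) * w) - 1)))" for m
  have s: "(\<lambda>m. g m - f m) sums (euler_log_real t - Re (euler_log w))"
    unfolding g_def f_def using t by (intro sums_diff euler_log_real_sums(1) sums_Re euler_log_sums) (simp_all add: w_def)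
  have "f m \<le> g m" for m
  proof -
    define k where "k = real (Suc m)"
    have k: "k > 0" by (simp add: k_def)
    have E: "exp (k * t) - 1 > 0" using k t by simp
    have "exp (k * t) - 1 \<le> norm (exp (of_nat (Suc m) * w) - 1)"
      using norm_triangle_ineq2[of "exp (of_nat (Suc m) * w)" 1] by (simp add: w_def k_def del: of_nat_Suc)
    then have "1 / (k * norm (exp (of_nat (Suc m) * w) - 1)) \<le> 1 / (k * (exp (k * t) - 1))"
      using k E by (intro divide_left_mono mult_left_mono mult_pos_pos) auto
    moreover have "f m \<le> norm (1 / (of_nat (Suc m) * (exp (of_nat (Suc m) * w) - 1)))"
      unfolding f_def by (rule complex_Re_le_cmod)
    ultimately show ?thesis
      unfolding g_def k_def by (simp add: norm_divide norm_mult del: of_nat_Suc)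
  qed
  then have "(\<Sum>m<1. g m - f m) \<le> suminf (\<lambda>m. g m - f m)"
    by (intro sum_le_suminf sums_summable[OF s]) auto
  then have le: "g 0 - f 0 \<le> euler_log_real t - Re (euler_log w)"
    using s by (simp add: sums_iff)
  define E D y where "E = exp t" and "D = E - 1" and "y = E * (1 - cos \<theta>)"
  have E: "E > 1" using t by (simp add: E_def)
  have D: "0 < D" "D \<le> 2 * t" using E exp_minus_one_upper[of t] t by (simp_all add: D_def E_def)
  have "1 * (\<theta> ^ 2 / 18) \<le> y"
    unfolding y_def using E one_minus_cos_lower[OF th] by (intro mult_mono) auto
  then have y: "\<theta> ^ 2 / 18 \<le> y" by simp
  then have y0: "y \<ge> 0" by (rule order_trans[rotated]) simp
  have f0: "f 0 = (D - y) / (D ^ 2 + 2 * y)"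
  proof -
    have ew: "exp w = Complex (E * cos \<theta>) (- (E * sin \<theta>))"
      by (simp add: w_def E_def complex_eq_iff Re_exp Im_exp)
    have "f 0 = Re (exp w - 1) / ((Re (exp w - 1)) ^ 2 + (Im (exp w - 1)) ^ 2)"
      by (simp add: f_def Re_divide)
    also have "Re (exp w - 1) = D - y"
      by (simp add: ew D_def y_def algebra_simps)
    also have "(D - y) ^ 2 + (Im (exp w - 1)) ^ 2 = D ^ 2 + 2 * y"
    proof -
      have "(D - y) ^ 2 + (Im (exp w - 1)) ^ 2 = (E * cos \<theta> - 1) ^ 2 + (E * sin \<theta>) ^ 2"
        by (simp add: ew D_def y_def algebra_simps)
      also have "\<dots> = E ^ 2 * ((cos \<theta>) ^ 2 + (sin \<theta>) ^ 2) - 2 * E * cos \<theta> + 1"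
        by (simp only: power2_eq_square) (simp only: algebra_simps)
      also have "\<dots> = D ^ 2 + 2 * y"
        by (simp add: D_def y_def power2_eq_square algebra_simps)
      finally show ?thesis .
    qed
    finally show ?thesis .
  qed
  have den: "D ^ 2 + 2 * y > 0" using D y0 by (simp add: add_pos_nonneg)
  have "g 0 - f 0 = 1 / D - (D - y) / (D ^ 2 + 2 * y)"
    by (simp add: f0 g_def D_def E_def)
  also have "\<dots> = (1 / D) * ((2 + D) * y / (D ^ 2 + 2 * y))"
    using D(1) den by (simp add: divide_simps) (simp add: algebra_simps power2_eq_square)
  also have "\<dots> \<ge> (1 / (2 * t)) * ((2 * y) / (D ^ 2 + 2 * y))"
  proof -
    have "2 * y \<le> (2 + D) * y" using D y0 by (intro mult_right_mono) auto
    then have "(2 * y) / (D ^ 2 + 2 * y) \<le> (2 + D) * y / (D ^ 2 + 2 * y)"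
      using den by (intro divide_right_mono) auto
    moreover have "1 / (2 * t) \<le> 1 / D" using D t by (intro divide_left_mono) auto
    ultimately show ?thesis
      using D(1) den y0 by (intro mult_mono) auto
  qed
  finally have "(1 / (2 * t)) * ((2 * y) / (D ^ 2 + 2 * y)) \<le> g 0 - f 0" .
  moreover have "\<theta> ^ 2 / (36 * t ^ 2 + \<theta> ^ 2) \<le> (2 * y) / (D ^ 2 + 2 * y)"
  proof -
    have "D ^ 2 \<le> (2 * t) ^ 2" using D by (intro power_mono) auto
    then have "\<theta> ^ 2 * D ^ 2 \<le> (18 * y) * (2 * t) ^ 2"
      using y y0 by (intro mult_mono) auto
    moreover have "36 * t ^ 2 + \<theta> ^ 2 > 0" using t by (simp add: add_pos_nonneg)
    ultimately show ?thesis
      using den by (simp add: divide_simps) (simp add: algebra_simps power2_eq_square)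
  qed
  then have "(1 / (2 * t)) * (\<theta> ^ 2 / (36 * t ^ 2 + \<theta> ^ 2)) \<le> (1 / (2 * t)) * ((2 * y) / (D ^ 2 + 2 * y))"
    using t by (intro mult_left_mono) auto
  ultimately have "\<theta> ^ 2 / (2 * t * (36 * t ^ 2 + \<theta> ^ 2)) \<le> g 0 - f 0"
    by simp
  with le show ?thesis by (simp add: w_def)
qed

text \<open>
  The exponent behaves like $u^2$ only while $tu^2$ is bounded. On the whole range $|\theta|=t^{3/2}|u|\le\pi<4$ its cube is, for $|u|\ge1$, still at
  least a multiple of $u^2$, and $e^{-y}\le27/y^3$ then gives an integrable majorant.
\<close>

lemma gaussian_range_decay:
  fixes t u :: real
  assumes t: "0 < t" and u: "t ^ 3 * u ^ 2 \<le> 16"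
  shows "exp (- (u ^ 2 / (72 + 2 * t * u ^ 2))) \<le> 10 ^ 8 / (1 + u ^ 2)"
proof (cases "\<bar>u\<bar> \<ge> 1")
  case False
  then have "u ^ 2 \<le> 1" by (simp add: abs_square_le_1)
  have "exp (- (u ^ 2 / (72 + 2 * t * u ^ 2))) \<le> 1" using t by simp
  also have "1 \<le> 10 ^ 8 / (1 + u ^ 2)" using \<open>u ^ 2 \<le> 1\<close> by (simp add: divide_simps add_pos_nonneg)
  finally show ?thesis .
next
  case True
  define v where "v = u ^ 2"
  have v: "v \<ge> 1" using True unfolding v_def by (metis abs_le_square_iff abs_1 power_one)
  define B where "B = 72 + 2 * t * v"
  have B: "B > 0" using t v by (simp add: B_def add_pos_pos)
  have cube: "(a + b) ^ 3 \<le> 4 * (a ^ 3 + b ^ 3)" if "a \<ge> 0" "b \<ge> 0" for a b :: real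
  proof -
    have "4 * (a ^ 3 + b ^ 3) - (a + b) ^ 3 = 3 * ((a + b) * (a - b) ^ 2)"
      by (simp add: power3_eq_cube power2_eq_square algebra_simps)
    moreover have "(a + b) * (a - b) ^ 2 \<ge> 0" using that by simp
    ultimately show ?thesis by linarith
  qed
  have "B ^ 3 \<le> 4 * (72 ^ 3 + (2 * t * v) ^ 3)"
    unfolding B_def by (rule cube) (use t v in auto)
  also have "(2 * t * v) ^ 3 = 8 * (t ^ 3 * v) * v ^ 2"
    by (simp add: power_mult_distrib power3_eq_cube power2_eq_square)
  also have "8 * (t ^ 3 * v) * v ^ 2 \<le> 8 * 16 * v ^ 2"
    using u by (intro mult_right_mono mult_left_mono) (auto simp: v_def)
  also have "4 * (72 ^ 3 + 8 * 16 * v ^ 2) \<le> 1493504 * v ^ 2"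
    using power_mono[of 1 v 2] v by simp
  finally have B3: "B ^ 3 \<le> 1493504 * v ^ 2" by simp
  define y where "y = v / B"
  have y: "y > 0" using v B by (simp add: y_def)
  have "(y / 3) ^ 3 \<le> (1 + y / 3) ^ 3" using y by (intro power_mono) auto
  also have "\<dots> \<le> exp (y / 3) ^ 3" using y exp_ge_add_one_self[of "y / 3"] by (intro power_mono) linarith+
  also have "\<dots> = exp y" by (simp flip: exp_of_nat_mult)
  finally have "y ^ 3 \<le> 27 * exp y" by (simp add: power_divide)
  then have "exp (- y) \<le> 27 / y ^ 3"
    using y by (simp add: exp_minus field_simps)
  also have "\<dots> = 27 * B ^ 3 / v ^ 3" by (simp add: y_def power_divide)
  also have "\<dots> \<le> 27 * (1493504 * v ^ 2) / v ^ 3"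
    using B3 v by (intro divide_right_mono mult_left_mono) auto
  also have "\<dots> = 40324608 / v" using v by (simp add: power3_eq_cube power2_eq_square)
  also have "\<dots> \<le> 10 ^ 8 / (1 + v)" using v by (simp add: field_simps)
  finally show ?thesis by (simp add: y_def B_def v_def)
qed

lemma exp_minus_Complex: "exp (- Complex t (-\<theta>)) = of_real (exp (- t)) * cis \<theta>"
proof -
  have "- Complex t (-\<theta>) = of_real (- t) + \<i> * of_real \<theta>"
    by (simp add: complex_eq_iff)
  then show ?thesis
    by (simp only: exp_add exp_of_real cis_conv_exp)
qed

lemma one_minus_exp_lower:
  assumes "0 < t" "t \<le> 1"
  shows "t / norm (1 - exp (- Complex t (-\<theta>))) \<le> 3"
proof -
  have e: "exp t - 1 \<ge> t" using exp_ge_add_one_self[of t] by linarith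
  have "exp t \<le> 3" using exp_le exp_le_cancel_iff[of t 1] assms by linarith
  have "1 - exp (- t) = (exp t - 1) / exp t" by (simp add: exp_minus field_simps)
  also have "\<dots> \<ge> t / 3"
    using e \<open>exp t \<le> 3\<close> assms by (intro frac_le) auto
  finally have "t / 3 \<le> 1 - exp (- t)" .
  also have "\<dots> \<le> norm (1 - exp (- Complex t (-\<theta>)))"
    using norm_triangle_ineq2[of 1 "exp (- Complex t (-\<theta>))"] by simp
  finally have "t / 3 \<le> norm (1 - exp (- Complex t (-\<theta>)))" .
  moreover have "t / 3 > 0" using assms by simp
  ultimately show ?thesis by (simp add: divide_simps)
qed

text \<open>
  The radius is $e^{-t}$ with $t$ the minimum of $\frac{\pi^2}{6t}+nt$, the saddle point of the integrand to leading order.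
\<close>

definition saddle :: "nat \<Rightarrow> real" where
  "saddle n = pi / sqrt (6 * real n)"

text \<open>
  The width $t^{3/2}$ of the saddle: the substitution $\theta=t^{3/2}u$ turns the integrand into a Gaussian in $u$.
\<close>

definition arc_scale :: "nat \<Rightarrow> real" where
  "arc_scale n = saddle n * sqrt (saddle n)"

definition basel :: real where
  "basel = pi ^ 2 / 6"

text \<open>
  The integrand of the coefficient formula for $P(q)/(1-q)$ at $q=e^{-w}$, $w=t-it^{3/2}u$, divided by the size $P(e^{-t})/t$ of
  $P(q)/(1-q)$ on the real axis.
\<close>

definition circle_integrand :: "nat \<Rightarrow> real \<Rightarrow> complex" where
  "circle_integrand n u = indicator {-pi..pi} (arc_scale n * u) *\<^sub>R
     (exp (euler_log (Complex (saddle n) (- (arc_scale n * u)))) / (1 - exp (- Complex (saddle n) (- (arc_scale n * u)))) * cis (- (real n * (arc_scale n * u))))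
     * of_real (saddle n * exp (- euler_log_real (saddle n)))"

lemma saddle_pos: "n \<ge> 1 \<Longrightarrow> saddle n > 0"
  by (simp add: saddle_def)

lemma saddle_le_1: "n \<ge> 3 \<Longrightarrow> saddle n \<le> 1"
proof -
  assume "n \<ge> 3"
  then have "sqrt 16 \<le> sqrt (6 * real n)" by (intro real_sqrt_le_mono) simp
  then have "4 \<le> sqrt (6 * real n)" by simp
  then show ?thesis using pi_less_4 by (simp add: saddle_def divide_simps)
qed

lemma saddle_tendsto: "saddle \<longlonglongrightarrow> 0"
  unfolding saddle_def[abs_def] by real_asymp

lemma saddle_equation: "n \<ge> 1 \<Longrightarrow> real n = basel / saddle n ^ 2"
  by (simp add: saddle_def basel_def power_divide)

lemma circle_integral:
  assumes n: "n \<ge> 1"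
  shows "(LINT u|lborel. circle_integrand n u)
      = of_real (2 * pi * real (partition_sum n) * exp (- saddle n) ^ n * exp (- euler_log_real (saddle n)) / sqrt (saddle n))"
    and "circle_integrand n \<in> borel_measurable borel"
proof -
  define F where "F \<theta> = exp (euler_log (Complex (saddle n) (-\<theta>))) / (1 - exp (- Complex (saddle n) (-\<theta>)))" for \<theta>
  define g where "g \<theta> = indicator {-pi..pi} \<theta> *\<^sub>R (F \<theta> * cis (- (real n * \<theta>)))" for \<theta>
  have tp: "saddle n > 0" by (rule saddle_pos[OF n])
  have F: "(\<lambda>k. of_real (real (partition_sum k)) * (of_real (exp (- saddle n)) * cis \<theta>) ^ k) sums F \<theta>" for \<theta>
    using partition_sum_sums[of "exp (- Complex (saddle n) (-\<theta>))"] tp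
    by (simp add: F_def euler_log_def flip: exp_minus_Complex)
  have "summable (\<lambda>k. complex_of_real (real (partition_sum k) * exp (- saddle n) ^ k))"
    using sums_summable[OF F[of 0]] by simp
  then have summ: "summable (\<lambda>k. real (partition_sum k) * exp (- saddle n) ^ k)"
    by (simp only: summable_complex_of_real)
  note ci = coefficient_integral[where r = "exp (- saddle n)" and c = "\<lambda>k. real (partition_sum k)" and F = F and n = n, OF _ _ summ F, simplified, folded g_def]
  have ig: "(LINT \<theta>|lborel. g \<theta>) = of_real (2 * pi * real (partition_sum n) * exp (- saddle n) ^ n)"
    using ci(1) by simp
  have hp: "arc_scale n > 0" using tp by (simp add: arc_scale_def)
  have ce: "circle_integrand n = (\<lambda>u. g (0 + arc_scale n * u) * of_real (saddle n * exp (- euler_log_real (saddle n))))"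
    by (simp add: circle_integrand_def g_def F_def fun_eq_iff)
  have "(LINT \<theta>|lborel. g \<theta>) = \<bar>arc_scale n\<bar> *\<^sub>R (LINT u|lborel. g (0 + arc_scale n * u))"
    by (rule lborel_integral_real_affine) (use hp in simp)
  then have "(LINT u|lborel. g (0 + arc_scale n * u)) = of_real (2 * pi * real (partition_sum n) * exp (- saddle n) ^ n / arc_scale n)"
    using hp unfolding ig by (simp add: scaleR_conv_of_real field_simps)
  then have "(LINT u|lborel. circle_integrand n u) = of_real (2 * pi * real (partition_sum n) * exp (- saddle n) ^ n / arc_scale n) * of_real (saddle n * exp (- euler_log_real (saddle n)))"
    unfolding ce by simp
  also have "\<dots> = of_real (2 * pi * real (partition_sum n) * exp (- saddle n) ^ n * exp (- euler_log_real (saddle n)) / sqrt (saddle n))"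
    unfolding of_real_mult[symmetric] using tp by (simp add: arc_scale_def)
  finally show "(LINT u|lborel. circle_integrand n u)
      = of_real (2 * pi * real (partition_sum n) * exp (- saddle n) ^ n * exp (- euler_log_real (saddle n)) / sqrt (saddle n))" .
  have [measurable]: "g \<in> borel_measurable borel"
    using ci(2) by (simp add: g_def[abs_def])
  show "circle_integrand n \<in> borel_measurable borel"
    unfolding ce by measurable
qed

lemma circle_integrand_bound:
  assumes n: "n \<ge> 3"
  shows "norm (circle_integrand n u) \<le> 3 * 10 ^ 8 * inverse (1 + u ^ 2)"
proof (cases "\<bar>arc_scale n * u\<bar> \<le> pi")
  case False
  then have "arc_scale n * u \<notin> {-pi..pi}" by (auto simp: abs_le_iff)
  then have "circle_integrand n u = 0" by (simp only: circle_integrand_def indicator_simps) simp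
  then show ?thesis by simp
next
  case True
  have tp: "saddle n > 0" "saddle n \<le> 1" using saddle_pos[of n] saddle_le_1[of n] n by auto
  define w where "w = Complex (saddle n) (- (arc_scale n * u))"
  have h2: "arc_scale n ^ 2 = saddle n ^ 3"
    using tp by (simp add: arc_scale_def power_mult_distrib power3_eq_cube power2_eq_square)
  have hu: "(arc_scale n * u) ^ 2 = saddle n ^ 3 * u ^ 2" by (simp add: power_mult_distrib h2)
  have "(arc_scale n * u) ^ 2 \<le> 4 ^ 2"
    using True pi_less_4 by (subst abs_le_square_iff[symmetric]) auto
  then have tu: "saddle n ^ 3 * u ^ 2 \<le> 16" unfolding hu by simp
  have "Re (euler_log w) \<le> euler_log_real (saddle n) - (arc_scale n * u) ^ 2 / (2 * saddle n * (36 * saddle n ^ 2 + (arc_scale n * u) ^ 2))"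
    unfolding w_def by (rule Re_euler_log_bound) (use tp True in auto)
  also have "(arc_scale n * u) ^ 2 / (2 * saddle n * (36 * saddle n ^ 2 + (arc_scale n * u) ^ 2)) = u ^ 2 / (72 + 2 * saddle n * u ^ 2)"
  proof -
    have "2 * saddle n * (36 * saddle n ^ 2 + saddle n ^ 3 * u ^ 2) = saddle n ^ 3 * (72 + 2 * saddle n * u ^ 2)"
      by (simp add: power3_eq_cube power2_eq_square algebra_simps)
    then show ?thesis unfolding hu using tp by simp
  qed
  finally have "exp (Re (euler_log w)) \<le> exp (euler_log_real (saddle n) - u ^ 2 / (72 + 2 * saddle n * u ^ 2))" by simp
  then have "exp (Re (euler_log w)) * exp (- euler_log_real (saddle n)) \<le> exp (euler_log_real (saddle n) - u ^ 2 / (72 + 2 * saddle n * u ^ 2)) * exp (- euler_log_real (saddle n))"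
    by (intro mult_right_mono) auto
  also have "\<dots> = exp (- (u ^ 2 / (72 + 2 * saddle n * u ^ 2)))"
    by (simp flip: exp_add)
  also have "\<dots> \<le> 10 ^ 8 / (1 + u ^ 2)"
    by (rule gaussian_range_decay) (use tp tu in auto)
  finally have 1: "exp (Re (euler_log w)) * exp (- euler_log_real (saddle n)) \<le> 10 ^ 8 / (1 + u ^ 2)" .
  have 2: "saddle n / norm (1 - exp (- w)) \<le> 3"
    unfolding w_def by (rule one_minus_exp_lower) (use tp in auto)
  have "norm (circle_integrand n u) = (exp (Re (euler_log w)) * exp (- euler_log_real (saddle n))) * (saddle n / norm (1 - exp (- w)))"
  proof -
    have "arc_scale n * u \<in> {-pi..pi}" using True by (auto simp: abs_le_iff)
    then have "indicator {-pi..pi} (arc_scale n * u) = (1 :: real)" by (simp only: indicator_simps)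
    then show ?thesis
      using tp by (simp add: circle_integrand_def norm_mult norm_divide flip: w_def)
  qed
  also have "\<dots> \<le> 10 ^ 8 / (1 + u ^ 2) * 3"
    using 1 2 tp by (intro mult_mono) (auto simp: add_pos_nonneg)
  finally show ?thesis by (simp add: divide_inverse)
qed

text \<open>
  With $\delta=\sqrt t\,u$ one has $w=t(1-i\delta)$. The polar parts and $n=\frac{\pi^2}{6t^2}$ combine to
  $\frac{\pi^2}{6}\left(\frac1w-\frac1t-\frac{i\theta}{t^2}\right)=-\frac{\pi^2}{6}\cdot\frac{u^2}{1-i\delta}$, and the remainders
  differ by $O(\delta)$.
\<close>

lemma circle_integrand_tendsto:
  "(\<lambda>n. circle_integrand n u) \<longlonglongrightarrow> of_real (exp (- (basel * u ^ 2)))"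
proof -
  define \<delta> where "\<delta> n = sqrt (saddle n) * u" for n
  define w where "w n = Complex (saddle n) (- (arc_scale n * u))" for n
  define E where "E n = (euler_log (w n) - of_real basel / w n) - (euler_log (of_real (saddle n)) - of_real basel / of_real (saddle n))" for n
  have d0: "\<delta> \<longlonglongrightarrow> 0"
    unfolding \<delta>_def using tendsto_mult[OF tendsto_real_sqrt[OF saddle_tendsto] tendsto_const[of u]] by simp
  have z: "(\<lambda>n. 1 - \<i> * of_real (\<delta> n)) \<longlonglongrightarrow> 1 - \<i> * of_real 0"
    by (intro tendsto_intros d0)
  have ev: "eventually (\<lambda>n. n \<ge> 3 \<and> \<bar>\<delta> n\<bar> < 1) sequentially"
  proof -
    have "eventually (\<lambda>n. \<bar>\<delta> n\<bar> < 1) sequentially"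
      using tendstoD[OF d0, of 1] by (simp add: dist_real_def)
    then show ?thesis
      using eventually_ge_at_top[of 3] by eventually_elim auto
  qed
  have w_eq: "w n = of_real (saddle n) * (1 - \<i> * of_real (\<delta> n))" for n
    by (simp add: w_def arc_scale_def \<delta>_def complex_eq_iff)
  have E0: "E \<longlonglongrightarrow> 0"
  proof (rule Lim_null_comparison)
    show "\<forall>\<^sub>F n in sequentially. norm (E n) \<le> 18 * \<bar>\<delta> n\<bar>"
      using ev
    proof eventually_elim
      case (elim n)
      have tp: "saddle n > 0" using saddle_pos[of n] elim by simp
      have hu: "\<bar>arc_scale n * u\<bar> = saddle n * \<bar>\<delta> n\<bar>" using tp by (simp add: arc_scale_def \<delta>_def abs_mult)
      have "norm (E n) \<le> 18 * \<bar>arc_scale n * u\<bar> / saddle n"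
        unfolding E_def w_def basel_def
        by (rule euler_log_vertical_difference) (use tp elim in \<open>auto simp: hu mult_le_cancel_left1\<close>)
      also have "\<dots> = 18 * \<bar>\<delta> n\<bar>" using tp by (simp add: hu)
      finally show ?case .
    qed
    show "(\<lambda>n. 18 * \<bar>\<delta> n\<bar>) \<longlonglongrightarrow> 0"
      using tendsto_mult[OF tendsto_const[of 18] tendsto_rabs[OF d0]] by simp
  qed
  have w0: "w \<longlonglongrightarrow> 0"
  proof -
    have "(\<lambda>n. of_real (saddle n) * (1 - \<i> * of_real (\<delta> n))) \<longlonglongrightarrow> of_real 0 * (1 - \<i> * of_real 0)"
      by (intro tendsto_intros z saddle_tendsto d0)
    then show ?thesis by (simp add: w_eq[abs_def])
  qed
  have "filterlim (\<lambda>n. - w n) (at 0) sequentially"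
    unfolding filterlim_at
  proof
    show "\<forall>\<^sub>F n in sequentially. - w n \<in> UNIV \<and> - w n \<noteq> 0"
      using eventually_ge_at_top[of 1]
    proof eventually_elim
      case (elim n)
      then have "Re (w n) \<noteq> 0" using saddle_pos[of n] by (simp add: w_def)
      then show ?case by auto
    qed
    show "(\<lambda>n. - w n) \<longlonglongrightarrow> 0" using tendsto_minus[OF w0] by simp
  qed
  from filterlim_compose[OF lim_exp_minus_1 this]
  have e1: "(\<lambda>n. (exp (- w n) - 1) / (- w n)) \<longlonglongrightarrow> 1" .
  have lim: "(\<lambda>n. exp (E n - of_real (basel * u ^ 2) / (1 - \<i> * of_real (\<delta> n)))
       * (1 / ((exp (- w n) - 1) / (- w n)) * (1 / (1 - \<i> * of_real (\<delta> n)))))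
     \<longlonglongrightarrow> exp (0 - of_real (basel * u ^ 2) / (1 - \<i> * of_real 0)) * (1 / 1 * (1 / (1 - \<i> * of_real 0)))"
    by (intro tendsto_intros E0 z e1 d0) auto
  have "(\<lambda>n. circle_integrand n u) \<longlonglongrightarrow> exp (0 - of_real (basel * u ^ 2) / (1 - \<i> * of_real 0)) * (1 / 1 * (1 / (1 - \<i> * of_real 0)))"
  proof (rule Lim_transform_eventually[OF lim])
    have "(\<lambda>n. arc_scale n * u) \<longlonglongrightarrow> 0 * sqrt 0 * u"
      unfolding arc_scale_def by (intro tendsto_intros saddle_tendsto)
    then have "eventually (\<lambda>n. \<bar>arc_scale n * u\<bar> < pi) sequentially"
      using tendstoD[of "\<lambda>n. arc_scale n * u" 0 sequentially pi] by simp
    then show "\<forall>\<^sub>F n in sequentially. exp (E n - of_real (basel * u ^ 2) / (1 - \<i> * of_real (\<delta> n)))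
       * (1 / ((exp (- w n) - 1) / (- w n)) * (1 / (1 - \<i> * of_real (\<delta> n)))) = circle_integrand n u"
      using ev
    proof eventually_elim
      case (elim n)
      have tp: "saddle n > 0" using saddle_pos[of n] elim by simp
      define z where "z = 1 - \<i> * complex_of_real (\<delta> n)"
      define T where "T = complex_of_real (saddle n)"
      have z0: "z \<noteq> 0" by (simp add: z_def complex_eq_iff)
      have T0: "T \<noteq> 0" using tp by (simp add: T_def)
      have wz: "w n = T * z" by (simp add: w_eq z_def T_def)
      have d2: "complex_of_real (u ^ 2) * T = (of_real (\<delta> n)) ^ 2"
        using tp by (simp add: T_def \<delta>_def power_mult_distrib flip: of_real_power of_real_mult)
      have nh: "complex_of_real (real n * (arc_scale n * u)) = of_real basel * of_real (\<delta> n) / T"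
      proof -
        have "real n * (arc_scale n * u) = basel * \<delta> n / saddle n"
          using tp saddle_equation[of n] elim by (simp add: arc_scale_def \<delta>_def power2_eq_square)
        then show ?thesis by (simp add: T_def)
      qed
      have "of_real basel / w n - of_real basel / T - \<i> * of_real (real n * (arc_scale n * u)) = - (of_real (basel * u ^ 2) / z)"
      proof -
        have "of_real basel / w n - of_real basel / T - \<i> * of_real (real n * (arc_scale n * u))
          = (of_real basel / (T * z)) * (1 - z - \<i> * of_real (\<delta> n) * z)"
          unfolding nh wz using z0 T0 by (simp add: field_simps)
        also have "1 - z - \<i> * of_real (\<delta> n) * z = - (of_real (\<delta> n) ^ 2)"
          by (simp add: z_def power2_eq_square algebra_simps)
        also have "\<dots> = - (complex_of_real (u ^ 2) * T)" by (simp only: d2)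
        finally show ?thesis using T0 by simp
      qed
      then have ex: "E n - of_real (basel * u ^ 2) / z = euler_log (w n) - of_real (euler_log_real (saddle n)) - \<i> * of_real (real n * (arc_scale n * u))"
        unfolding E_def unfolding euler_log_real_sums(2)[OF tp] unfolding T_def[symmetric] by (simp add: algebra_simps)
      have ex2: "exp (E n - of_real (basel * u ^ 2) / z) = exp (euler_log (w n)) * exp (- of_real (euler_log_real (saddle n))) * cis (- (real n * (arc_scale n * u)))"
        unfolding ex cis_conv_exp by (simp add: exp_diff exp_minus divide_inverse)
      have "exp (- w n) - 1 \<noteq> 0"
      proof
        assume "exp (- w n) - 1 = 0"
        then have "norm (exp (- w n)) = 1" by simp
        then show False using tp by (simp add: w_def)
      qed
      then have q: "1 / ((exp (- w n) - 1) / (- w n)) * (1 / z) = T / (1 - exp (- w n))"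
        unfolding wz using z0 by (simp add: divide_simps) (simp add: right_diff_distrib)
      have "circle_integrand n u = exp (euler_log (w n)) / (1 - exp (- w n)) * cis (- (real n * (arc_scale n * u))) * (T * exp (- of_real (euler_log_real (saddle n))))"
      proof -
        have "arc_scale n * u \<in> {-pi..pi}" using elim by (auto simp: abs_less_iff)
        then have "indicator {-pi..pi} (arc_scale n * u) = (1 :: real)" by (simp only: indicator_simps)
        moreover have "exp (- complex_of_real (euler_log_real (saddle n))) = of_real (exp (- euler_log_real (saddle n)))"
          by (simp only: exp_of_real[symmetric] of_real_minus)
        ultimately show ?thesis
          by (simp only: circle_integrand_def w_def T_def scaleR_one of_real_mult)
      qed
      then show ?case
        unfolding z_def[symmetric] ex2 q by simp
    qed
  qed
  also have "exp (0 - complex_of_real (basel * u ^ 2) / (1 - \<i> * of_real 0)) * (1 / 1 * (1 / (1 - \<i> * of_real 0)))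
      = of_real (exp (- (basel * u ^ 2)))"
    by (simp add: exp_of_real[symmetric])
  finally show ?thesis .
qed

lemma circle_integral_tendsto:
  "(\<lambda>n. 2 * pi * real (partition_sum n) * exp (- saddle n) ^ n * exp (- euler_log_real (saddle n)) / sqrt (saddle n)) \<longlonglongrightarrow> sqrt (6 / pi)"
proof -
  \<comment> \<open>The majorant is valid for \<open>n \<ge> 3\<close>, where the saddle point is at most \<open>1\<close>.\<close>
  have "(\<lambda>n. LINT u|lborel. circle_integrand (n + 3) u) \<longlonglongrightarrow> (LINT u|lborel. complex_of_real (exp (- (basel * u ^ 2))))"
  proof (rule integral_dominated_convergence)
    show "(\<lambda>u. complex_of_real (exp (- (basel * u ^ 2)))) \<in> borel_measurable lborel" by measurable
    show "circle_integrand (n + 3) \<in> borel_measurable lborel" for n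
      using circle_integral(2)[of "n + 3"] by simp
    have "set_integrable lborel (einterval (-\<infinity>) \<infinity>) (\<lambda>x::real. inverse (1 + x^2))"
      by (rule integrable_inverse_1_plus_square)
    then have "integrable lborel (\<lambda>x::real. inverse (1 + x^2))"
      by (simp add: set_integrable_def)
    then show "integrable lborel (\<lambda>u::real. 3 * 10 ^ 8 * inverse (1 + u ^ 2))"
      by (rule integrable_mult_right)
    show "AE u in lborel. (\<lambda>n. circle_integrand (n + 3) u) \<longlonglongrightarrow> complex_of_real (exp (- (basel * u ^ 2)))"
      by (intro AE_I2 LIMSEQ_ignore_initial_segment circle_integrand_tendsto)
    show "AE u in lborel. norm (circle_integrand (n + 3) u) \<le> 3 * 10 ^ 8 * inverse (1 + u ^ 2)" for n
      by (intro AE_I2 circle_integrand_bound) simp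
  qed
  also have "(\<lambda>n. LINT u|lborel. circle_integrand (n + 3) u)
     = (\<lambda>n. of_real (2 * pi * real (partition_sum (n + 3)) * exp (- saddle (n + 3)) ^ (n + 3) * exp (- euler_log_real (saddle (n + 3))) / sqrt (saddle (n + 3))))"
    using circle_integral(1) by (intro ext) simp
  also have "(LINT u|lborel. complex_of_real (exp (- (basel * u ^ 2)))) = of_real (sqrt (6 / pi))"
  proof -
    \<comment> \<open>The Gaussian limit is a multiple of the normal density with variance $3/\pi^2$.\<close>
    define \<sigma> where "\<sigma> = sqrt 3 / pi"
    have s2: "\<sigma> ^ 2 = 3 / pi ^ 2" by (simp add: \<sigma>_def power_divide)
    have e: "exp (- (basel * u ^ 2)) = sqrt (6 / pi) * normal_density 0 \<sigma> u" for u
    proof -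
      have "- ((u - 0) ^ 2) / (2 * \<sigma> ^ 2) = - (basel * u ^ 2)" unfolding s2 basel_def by simp
      moreover have "2 * pi * \<sigma> ^ 2 = 6 / pi" unfolding s2 by (simp add: power2_eq_square)
      ultimately show ?thesis unfolding normal_density_def by simp
    qed
    have "(LINT u|lborel. exp (- (basel * u ^ 2))) = sqrt (6 / pi)"
      unfolding e by (simp add: \<sigma>_def)
    then show ?thesis by (simp only: integral_complex_of_real)
  qed
  finally have "(\<lambda>n. 2 * pi * real (partition_sum (n + 3)) * exp (- saddle (n + 3)) ^ (n + 3) * exp (- euler_log_real (saddle (n + 3))) / sqrt (saddle (n + 3))) \<longlonglongrightarrow> sqrt (6 / pi)"
    by (simp only: tendsto_of_real_iff)
  then show ?thesis by (rule LIMSEQ_offset)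
qed

text \<open>
  The limit of the integrals is combined with the expansion of $\log P(e^{-t})$. At the saddle point $nt=\frac{\pi^2}{6t}$, so that
  the two exponential factors agree and their product is $e^{\pi\sqrt{6n}/3}$.
\<close>

theorem partition_sum_asymptotics:
  "(\<lambda>n. real (partition_sum n) * sqrt (real n) * exp (- (pi * sqrt (6 * real n) / 3))) \<longlonglongrightarrow> 1 / (2 * sqrt 2 * pi)"
proof -
  have "filterlim saddle (at_right 0) sequentially"
    unfolding saddle_def[abs_def] by real_asymp
  from filterlim_compose[OF euler_log_real_asymptotics this]
  have "(\<lambda>n. exp (euler_log_real (saddle n) - (pi ^ 2 / (6 * saddle n) + ln (saddle n / (2 * pi)) / 2))) \<longlonglongrightarrow> exp 0"
    by (rule tendsto_exp)
  from tendsto_mult[OF circle_integral_tendsto this]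
  have "(\<lambda>n. (2 * pi * real (partition_sum n) * exp (- saddle n) ^ n * exp (- euler_log_real (saddle n)) / sqrt (saddle n)) *
     exp (euler_log_real (saddle n) - (pi ^ 2 / (6 * saddle n) + ln (saddle n / (2 * pi)) / 2)) * (1 / (4 * sqrt 3 * sqrt pi))) \<longlonglongrightarrow> sqrt (6 / pi) * exp 0 * (1 / (4 * sqrt 3 * sqrt pi))"
    by (rule tendsto_mult_right)
  also have "sqrt (6 / pi) * exp 0 * (1 / (4 * sqrt 3 * sqrt pi)) = 1 / (2 * sqrt 2 * pi)"
  proof -
    have "sqrt 6 = sqrt 2 * sqrt 3" by (simp flip: real_sqrt_mult)
    then have "sqrt (6 / pi) * exp 0 * (1 / (4 * sqrt 3 * sqrt pi)) = sqrt 2 / (4 * (sqrt pi * sqrt pi))"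
      by (simp add: real_sqrt_divide)
    also have "\<dots> = 1 / (2 * sqrt 2 * pi)" by (simp add: divide_simps)
    finally show ?thesis .
  qed
  finally show ?thesis
  proof (rule Lim_transform_eventually)
    show "\<forall>\<^sub>F n in sequentially. (2 * pi * real (partition_sum n) * exp (- saddle n) ^ n * exp (- euler_log_real (saddle n)) / sqrt (saddle n)) *
     exp (euler_log_real (saddle n) - (pi ^ 2 / (6 * saddle n) + ln (saddle n / (2 * pi)) / 2)) * (1 / (4 * sqrt 3 * sqrt pi))
     = real (partition_sum n) * sqrt (real n) * exp (- (pi * sqrt (6 * real n) / 3))"
      using eventually_ge_at_top[of 1]
    proof eventually_elim
      case (elim n)
      have tp: "saddle n > 0" using saddle_pos elim by simp
      have e1: "exp (- saddle n) ^ n = exp (- (pi ^ 2 / (6 * saddle n)))"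
      proof -
        have "exp (- saddle n) ^ n = exp (- (real n * saddle n))" by (simp flip: exp_of_nat_mult)
        also have "real n * saddle n = pi ^ 2 / (6 * saddle n)"
          using saddle_equation[OF elim] tp by (simp add: basel_def power2_eq_square)
        finally show ?thesis .
      qed
      have e2: "exp (euler_log_real (saddle n) - (pi ^ 2 / (6 * saddle n) + ln (saddle n / (2 * pi)) / 2))
          = exp (euler_log_real (saddle n)) * exp (- (pi ^ 2 / (6 * saddle n))) / sqrt (saddle n / (2 * pi))"
      proof -
        have "exp (ln (saddle n / (2 * pi)) / 2) = sqrt (saddle n / (2 * pi))"
          using tp by (subst ln_sqrt[symmetric]) auto
        moreover have "exp (a - (b + c)) = exp a * exp (- b) / exp c" for a b c :: real
          by (simp add: exp_diff exp_add exp_minus divide_inverse)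
        ultimately show ?thesis by (simp only:)
      qed
      have e3: "exp (- (pi ^ 2 / (6 * saddle n))) * exp (- (pi ^ 2 / (6 * saddle n))) = exp (- (pi * sqrt (6 * real n) / 3))"
      proof -
        have "pi ^ 2 / (6 * saddle n) = pi * sqrt (6 * real n) / 6"
          by (simp add: saddle_def power2_eq_square)
        then show ?thesis by (simp flip: exp_add)
      qed
      have e4: "2 * pi / sqrt (saddle n) / sqrt (saddle n / (2 * pi)) * (1 / (4 * sqrt 3 * sqrt pi)) = sqrt (real n)"
      proof -
        define a b where "a = sqrt pi" and "b = sqrt (real n)"
        have ab: "a > 0" "b > 0" using elim by (simp_all add: a_def b_def)
        have pi2: "pi = a * a" by (simp add: a_def)
        have s6: "sqrt (6 * real n) = sqrt 2 * sqrt 3 * b"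
          by (simp add: b_def flip: real_sqrt_mult)
        have "sqrt (saddle n) * sqrt (saddle n / (2 * pi)) = saddle n / (sqrt 2 * a)"
          using tp by (simp add: real_sqrt_divide real_sqrt_mult a_def)
        then have "2 * pi / sqrt (saddle n) / sqrt (saddle n / (2 * pi)) = 2 * pi * (sqrt 2 * a) / saddle n"
          by (simp add: divide_divide_eq_left)
        also have "\<dots> = 2 * sqrt 2 * a * sqrt (6 * real n)" by (simp add: saddle_def)
        also have "\<dots> = 2 * (sqrt 2 * sqrt 2) * sqrt 3 * a * b" unfolding s6 by (simp only: mult_ac)
        finally show ?thesis
          using ab by (simp add: a_def[symmetric] b_def[symmetric])
      qed
      have "(2 * pi * real (partition_sum n) * exp (- saddle n) ^ n * exp (- euler_log_real (saddle n)) / sqrt (saddle n)) *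
         exp (euler_log_real (saddle n) - (pi ^ 2 / (6 * saddle n) + ln (saddle n / (2 * pi)) / 2)) * (1 / (4 * sqrt 3 * sqrt pi))
        = real (partition_sum n) * (exp (- (pi ^ 2 / (6 * saddle n))) * exp (- (pi ^ 2 / (6 * saddle n)))) * (exp (- euler_log_real (saddle n)) * exp (euler_log_real (saddle n))) *
          (2 * pi / sqrt (saddle n) / sqrt (saddle n / (2 * pi)) * (1 / (4 * sqrt 3 * sqrt pi)))"
        unfolding e1 e2 by simp
      also have "\<dots> = real (partition_sum n) * sqrt (real n) * exp (- (pi * sqrt (6 * real n) / 3))"
        unfolding e3 e4 by (simp flip: exp_add)
      finally show ?case .
    qed
  qed
qed

section \<open>Alternating sums over arithmetic progressions\<close>

lemma alternating_sum_bounds: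
  fixes g :: "nat \<Rightarrow> real"
  assumes "\<And>i. 0 \<le> g i" "\<And>i. g (Suc i) \<le> g i"
  shows "0 \<le> (\<Sum>i<L. (-1) ^ i * g i) \<and> (\<Sum>i<L. (-1) ^ i * g i) \<le> g 0"
  using assms
proof (induction L arbitrary: g)
  case (Suc L)
  have "(\<Sum>i<Suc L. (-1) ^ i * g i) = g 0 - (\<Sum>i<L. (-1) ^ i * g (Suc i))"
    by (subst sum.lessThan_Suc_shift) (simp add: sum_negf)
  moreover have "0 \<le> (\<Sum>i<L. (-1) ^ i * g (Suc i)) \<and> (\<Sum>i<L. (-1) ^ i * g (Suc i)) \<le> g (Suc 0)"
    by (rule Suc.IH) (use Suc.prems in auto)
  ultimately show ?case
    using Suc.prems(2)[of 0] by auto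
qed simp

definition progression_count :: "nat \<Rightarrow> nat \<Rightarrow> nat \<Rightarrow> nat" where
  "progression_count a d x = card {k. a + d * k \<le> x}"

lemma progression_count_finite:
  fixes a d x :: nat
  shows "d \<ge> 1 \<Longrightarrow> finite {k. a + d * k \<le> x}"
proof (rule finite_subset)
  assume d: "d \<ge> 1"
  show "{k. a + d * k \<le> x} \<subseteq> {..x}"
  proof
    fix k assume "k \<in> {k. a + d * k \<le> x}"
    moreover have "k \<le> d * k" using d by simp
    ultimately show "k \<in> {..x}" unfolding mem_Collect_eq atMost_iff by linarith
  qed
qed simp

lemma progression_count_bounds:
  assumes d: "d \<ge> 1"
  shows "real (progression_count a d x) \<le> real x / real d + 1"
    and "real (progression_count a d x) \<ge> (real x - real a) / real d"
proof -
  have "{k. a + d * k \<le> x} \<subseteq> {..x div d}"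
    using d by (auto simp: less_eq_div_iff_mult_less_eq mult.commute)
  then have "progression_count a d x \<le> x div d + 1"
    unfolding progression_count_def by (metis Suc_eq_plus1 card_atMost card_mono finite_atMost)
  moreover have "real (x div d) \<le> real x / real d"
    by (rule of_nat_div_le_of_nat)
  ultimately show "real (progression_count a d x) \<le> real x / real d + 1" by linarith
  show "real (progression_count a d x) \<ge> (real x - real a) / real d"
  proof (cases "a \<le> x")
    case True
    have "{..(x - a) div d} \<subseteq> {k. a + d * k \<le> x}"
    proof
      fix k assume "k \<in> {..(x - a) div d}"
      then have "d * k \<le> x - a" using d by (auto simp: less_eq_div_iff_mult_less_eq mult.commute)
      then show "k \<in> {k. a + d * k \<le> x}" using True by auto
    qed
    then have "(x - a) div d + 1 \<le> progression_count a d x"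
      unfolding progression_count_def by (metis Suc_eq_plus1 card_atMost card_mono progression_count_finite[OF d])
    moreover have "real (x - a) / real d - 1 \<le> real ((x - a) div d)"
    proof -
      have "x - a < d * ((x - a) div d + 1)"
        using dividend_less_times_div[of d "x - a"] d by simp
      then have "real (x - a) < real d * (real ((x - a) div d) + 1)"
        by (metis of_nat_1 of_nat_add of_nat_less_iff of_nat_mult)
      then show ?thesis using d by (simp add: field_simps)
    qed
    ultimately show ?thesis using True by (simp add: of_nat_diff)
  next
    case False
    then have "(real x - real a) / real d \<le> 0" using d by (simp add: divide_le_0_iff)
    then show ?thesis by (rule order_trans) simp
  qed
qed

text \<open>
  If $a_n/n$ increases, then the condition $\frac{a_n}{n}+dk\le\frac{x}{n}$ becomes harder with growing $n$.
\<close>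

lemma progression_count_antimono:
  assumes d: "d \<ge> 1" and n: "n \<ge> 1" and a: "a n * Suc n \<le> a (Suc n) * n"
  shows "progression_count (a (Suc n)) (d * Suc n) x \<le> progression_count (a n) (d * n) x"
  unfolding progression_count_def
proof (rule card_mono)
  show "finite {k. a n + d * n * k \<le> x}" using d n by (intro progression_count_finite) simp
  show "{k. a (Suc n) + d * Suc n * k \<le> x} \<subseteq> {k. a n + d * n * k \<le> x}"
  proof
    fix k assume k: "k \<in> {k. a (Suc n) + d * Suc n * k \<le> x}"
    have "Suc n * (a n + d * n * k) \<le> n * (a (Suc n) + d * Suc n * k)"
      using a by (simp add: algebra_simps)
    also have "\<dots> \<le> n * x" using k by (intro mult_left_mono) auto
    also have "\<dots> \<le> Suc n * x" by simp
    finally show "k \<in> {k. a n + d * n * k \<le> x}" by (simp only: mem_Collect_eq Suc_mult_le_cancel1)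
  qed
qed

lemma alternating_harmonic_tendsto: "(\<lambda>K. \<Sum>n<K. (-1) ^ n / real (Suc n)) \<longlonglongrightarrow> ln 2"
  using alternating_harmonic_series_sums by (simp add: sums_def)

text \<open>
  The $n$-th number of terms is asymptotic to $x/(dn)$, and by Leibniz' bound for alternating sums of decreasing terms the
  indices beyond $K$ contribute at most the $(K+1)$-st one, which is about $x/(d(K+1))$.
\<close>

theorem alternating_progression_density:
  assumes d: "d \<ge> 1" and a: "\<And>n. n \<ge> 1 \<Longrightarrow> a n * Suc n \<le> a (Suc n) * n" and an: "\<And>n. n \<le> a n"
  shows "(\<lambda>x. (\<Sum>n=1..x. (-1) ^ Suc n * real (progression_count (a n) (d * n) x)) / real x) \<longlonglongrightarrow> ln 2 / real d"
proof -
  define c where "c n x = real (progression_count (a (Suc n)) (d * Suc n) x)" for n x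
  have c0: "c n x \<ge> 0" for n x by (simp add: c_def)
  have cS: "c (Suc n) x \<le> c n x" for n x
    unfolding c_def of_nat_le_iff by (rule progression_count_antimono[OF d _ a]) simp_all
  have cup: "c n x \<le> real x / (real d * real (Suc n)) + 1" for n x
    unfolding c_def of_nat_mult[symmetric] by (rule progression_count_bounds(1)) (use d in simp)
  have clim: "(\<lambda>x. c n x / real x) \<longlonglongrightarrow> 1 / (real d * real (Suc n))" for n
  proof (rule tendsto_sandwich)
    define e where "e = real d * real (Suc n)"
    have e: "e > 0" using d by (simp add: e_def)
    show "\<forall>\<^sub>F x in sequentially. (real x - real (a (Suc n))) / e / real x \<le> c n x / real x"
      unfolding c_def e_def of_nat_mult[symmetric]
      by (intro always_eventually allI divide_right_mono progression_count_bounds(2)) (use d in simp_all)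
    show "\<forall>\<^sub>F x in sequentially. c n x / real x \<le> (real x / e + 1) / real x"
      unfolding e_def by (intro always_eventually allI divide_right_mono cup) simp
    show "(\<lambda>x. (real x - real (a (Suc n))) / e / real x) \<longlonglongrightarrow> 1 / (real d * real (Suc n))"
      unfolding e_def[symmetric] using e by (real_asymp simp: divide_inverse)
    show "(\<lambda>x. (real x / e + 1) / real x) \<longlonglongrightarrow> 1 / (real d * real (Suc n))"
      unfolding e_def[symmetric] using e by (real_asymp simp: divide_inverse)
  qed
  define S where "S K x = (\<Sum>n<K. (-1) ^ n * c n x)" for K x
  have S_eq: "(\<Sum>n=1..x. (-1) ^ Suc n * real (progression_count (a n) (d * n) x)) = S x x" for x
  proof -
    have "sum f {1..x} = (\<Sum>n<x. f (Suc n))" for f :: "nat \<Rightarrow> real"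
      by (rule sum.reindex_bij_witness[of _ Suc "\<lambda>n. n - 1"]) auto
    then show ?thesis
      by (simp add: S_def c_def)
  qed
  \<comment> \<open>Leibniz' bound, uniformly in the number of further terms\<close>
  have tail: "\<bar>S (K + L) x - S K x\<bar> \<le> c K x" for K L x
  proof -
    have "S (K + L) x - S K x = (\<Sum>n<L. (-1) ^ (K + n) * c (K + n) x)"
      unfolding S_def by (induction L) simp_all
    also have "\<dots> = (-1) ^ K * (\<Sum>n<L. (-1) ^ n * c (K + n) x)"
      by (simp add: sum_distrib_left power_add mult.assoc)
    also have "\<bar>\<dots>\<bar> = \<bar>\<Sum>n<L. (-1) ^ n * c (K + n) x\<bar>"
      by (simp add: abs_mult)
    also have "\<dots> \<le> c K x"
      using alternating_sum_bounds[of "\<lambda>n. c (K + n) x" L] c0 cS by auto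
    finally show ?thesis .
  qed
  define H where "H K = (\<Sum>n<K. (-1) ^ n / real (Suc n)) / real d" for K
  have Hlim: "H \<longlonglongrightarrow> ln 2 / real d"
    unfolding H_def[abs_def] by (rule tendsto_divide[OF alternating_harmonic_tendsto tendsto_const]) (use d in simp)
  show ?thesis
    unfolding S_eq
  proof (rule LIMSEQ_I)
    fix e :: real assume e: "e > 0"
    have "eventually (\<lambda>K. dist (H K) (ln 2 / real d) < e / 4) sequentially"
      using Hlim e by (intro tendstoD) auto
    moreover have "eventually (\<lambda>K. 1 / (real d * real (Suc K)) < e / 4) sequentially"
    proof -
      have "(\<lambda>K. 1 / (real d * real (Suc K))) \<longlonglongrightarrow> 0" using d by real_asymp
      then show ?thesis using e by (intro order_tendstoD(2)) auto
    qed
    ultimately have "eventually (\<lambda>K. dist (H K) (ln 2 / real d) < e / 4 \<and> 1 / (real d * real (Suc K)) < e / 4) sequentially"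
      by eventually_elim auto
    then obtain K where K: "dist (H K) (ln 2 / real d) < e / 4" "1 / (real d * real (Suc K)) < e / 4"
      by (metis (mono_tags, lifting) eventually_happens sequentially_bot)
    have "(\<lambda>x. S K x / real x) \<longlonglongrightarrow> (\<Sum>n<K. (-1) ^ n * (1 / (real d * real (Suc n))))"
      unfolding S_def sum_divide_distrib times_divide_eq_right[symmetric]
      by (intro tendsto_sum tendsto_mult tendsto_const clim)
    also have "(\<Sum>n<K. (-1) ^ n * (1 / (real d * real (Suc n)))) = H K"
      by (simp add: H_def sum_divide_distrib mult.commute del: of_nat_Suc)
    finally have "eventually (\<lambda>x. dist (S K x / real x) (H K) < e / 4) sequentially"
      using e by (intro tendstoD) auto
    moreover have "eventually (\<lambda>x. c K x / real x < e / 4) sequentially"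
      by (rule order_tendstoD(2)[OF clim K(2)])
    ultimately have "eventually (\<lambda>x. norm (S x x / real x - ln 2 / real d) < e) sequentially"
      using eventually_ge_at_top[of K]
    proof eventually_elim
      case (elim x)
      have "\<bar>S x x - S K x\<bar> / real x \<le> c K x / real x"
        using tail[of K "x - K" x] elim(3) by (intro divide_right_mono) auto
      then have "\<bar>S x x / real x - S K x / real x\<bar> \<le> c K x / real x"
        by (simp add: diff_divide_distrib[symmetric] abs_divide)
      then show ?case
        using elim K unfolding dist_real_def real_norm_def by linarith
    qed
    then show "\<exists>no. \<forall>x\<ge>no. norm (S x x / real x - ln 2 / real d) < e"
      by (simp add: eventually_sequentially)
  qed
qed

section \<open>Convolution with a sequence that has a mean value\<close>

text \<open>
  Summation by parts.
\<close>

lemma abel_convolution: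
  fixes p a :: "nat \<Rightarrow> real"
  defines "\<Delta> \<equiv> \<lambda>j. if j = 0 then p 0 else p j - p (j - 1)"
  shows "(\<Sum>k\<le>M. p k * a (M - k)) = (\<Sum>j\<le>M. \<Delta> j * (\<Sum>i\<le>M - j. a i))"
proof -
  have p: "p k = (\<Sum>j\<le>k. \<Delta> j)" for k
    by (induction k) (simp_all add: \<Delta>_def)
  have "(\<Sum>k\<le>M. p k * a (M - k)) = (\<Sum>k\<le>M. \<Sum>j\<le>k. \<Delta> j * a (M - k))"
    by (simp add: p[symmetric] sum_distrib_right[symmetric])
  also have "\<dots> = (\<Sum>j\<le>M. \<Sum>k=j..M. \<Delta> j * a (M - k))"
    unfolding sum.Sigma[OF finite_atMost ballI[OF finite_atMost]] sum.Sigma[OF finite_atMost ballI[OF finite_atLeastAtMost]]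
    by (rule sum.reindex_bij_witness[of _ "\<lambda>(j, k). (k, j)" "\<lambda>(k, j). (j, k)"]) auto
  also have "\<dots> = (\<Sum>j\<le>M. \<Delta> j * (\<Sum>i\<le>M - j. a i))"
  proof (intro sum.cong refl)
    fix j assume "j \<in> {..M}"
    then have "(\<Sum>k=j..M. a (M - k)) = (\<Sum>i\<le>M - j. a i)"
      by (intro sum.reindex_bij_witness[of _ "\<lambda>i. M - i" "\<lambda>k. M - k"]) auto
    then show "(\<Sum>k=j..M. \<Delta> j * a (M - k)) = \<Delta> j * (\<Sum>i\<le>M - j. a i)"
      by (simp add: sum_distrib_left[symmetric])
  qed
  finally show ?thesis .
qed

text \<open>
  After summation by parts the partial sums of $a$, which are close to $L(i+1)$, are averaged with the nonnegative weights $\Delta_j$.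
  For $a=1$ this gives $\sum_{k\le M}p(k)$ itself. A bounded error in finitely many partial sums costs $O(p(M))$, which is negligible.
\<close>

theorem convolution_with_mean_value:
  fixes p a :: "nat \<Rightarrow> real"
  assumes p0: "p 0 > 0" and mono: "\<And>k. p k \<le> p (Suc k)"
    and slow: "(\<lambda>M. p M / (\<Sum>k\<le>M. p k)) \<longlonglongrightarrow> 0"
    and mean: "(\<lambda>i. (\<Sum>l\<le>i. a l) / real (Suc i)) \<longlonglongrightarrow> L"
  shows "(\<lambda>M. (\<Sum>k\<le>M. p k * a (M - k)) / (\<Sum>k\<le>M. p k)) \<longlonglongrightarrow> L"
proof (rule LIMSEQ_I)
  fix e :: real assume e: "e > 0"
  define \<Delta> where "\<Delta> j = (if j = 0 then p 0 else p j - p (j - 1))" for j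
  have \<Delta>: "\<Delta> j \<ge> 0" for j
    using p0 mono[of "j - 1"] by (cases j) (auto simp: \<Delta>_def)
  define S where "S M = (\<Sum>k\<le>M. p k)" for M
  have ppos: "p k > 0" for k by (induction k) (use p0 mono in \<open>auto intro: less_le_trans\<close>)
  have Spos: "S M > 0" for M unfolding S_def by (intro sum_pos ppos) auto
  have tel: "(\<Sum>j\<le>M. \<Delta> j) = p M" for M
    by (induction M) (simp_all add: \<Delta>_def)
  define A where "A i = (\<Sum>l\<le>i. a l)" for i
  obtain i0 where i0: "\<And>i. i \<ge> i0 \<Longrightarrow> \<bar>A i / real (Suc i) - L\<bar> < e / 2"
    using LIMSEQ_D[OF mean, of "e / 2"] e by (auto simp: A_def)
  define C where "C = (\<Sum>i<i0. \<bar>A i - L * real (Suc i)\<bar>)"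
  have C0: "C \<ge> 0" by (simp add: C_def sum_nonneg)
  have dev: "\<bar>A i - L * real (Suc i)\<bar> \<le> e / 2 * real (Suc i) + C" for i
  proof (cases "i \<ge> i0")
    case True
    have "A i - L * real (Suc i) = (A i / real (Suc i) - L) * real (Suc i)"
      by (simp add: left_diff_distrib del: of_nat_Suc)
    then have "\<bar>A i - L * real (Suc i)\<bar> = \<bar>A i / real (Suc i) - L\<bar> * real (Suc i)"
      by (simp only: abs_mult abs_of_nat)
    also have "\<dots> \<le> e / 2 * real (Suc i)"
      using i0[OF True] by (intro mult_right_mono) auto
    finally show ?thesis using C0 by linarith
  next
    case False
    then have "\<bar>A i - L * real (Suc i)\<bar> \<le> C"
      unfolding C_def by (intro member_le_sum) auto
    moreover have "0 \<le> e / 2 * real (Suc i)" using e by simp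
    ultimately show ?thesis by linarith
  qed
  have SA: "S M = (\<Sum>j\<le>M. \<Delta> j * real (Suc (M - j)))" for M
    using abel_convolution[of p "\<lambda>_. 1" M] by (simp add: S_def \<Delta>_def)
  have conv: "(\<Sum>k\<le>M. p k * a (M - k)) = (\<Sum>j\<le>M. \<Delta> j * A (M - j))" for M
    unfolding A_def \<Delta>_def by (rule abel_convolution)
  have key: "\<bar>(\<Sum>k\<le>M. p k * a (M - k)) - L * S M\<bar> \<le> e / 2 * S M + C * p M" for M
  proof -
    have "(\<Sum>k\<le>M. p k * a (M - k)) - L * S M = (\<Sum>j\<le>M. \<Delta> j * (A (M - j) - L * real (Suc (M - j))))"
      unfolding conv SA by (simp add: sum_distrib_left sum_subtractf[symmetric] right_diff_distrib mult_ac del: of_nat_Suc)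
    also have "\<bar>\<dots>\<bar> \<le> (\<Sum>j\<le>M. \<bar>\<Delta> j * (A (M - j) - L * real (Suc (M - j)))\<bar>)"
      by (rule sum_abs)
    also have "\<dots> \<le> (\<Sum>j\<le>M. \<Delta> j * (e / 2 * real (Suc (M - j)) + C))"
    proof (rule sum_mono)
      fix j
      show "\<bar>\<Delta> j * (A (M - j) - L * real (Suc (M - j)))\<bar> \<le> \<Delta> j * (e / 2 * real (Suc (M - j)) + C)"
        unfolding abs_mult abs_of_nonneg[OF \<Delta>] by (rule mult_left_mono[OF dev \<Delta>])
    qed
    also have "\<dots> = e / 2 * S M + C * p M"
      unfolding SA tel[symmetric] by (simp add: sum_distrib_left sum.distrib[symmetric] distrib_left mult_ac del: of_nat_Suc)
    finally show ?thesis .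
  qed
  have "(\<lambda>M. C * (p M / S M)) \<longlonglongrightarrow> C * 0"
    using slow unfolding S_def by (intro tendsto_intros)
  then obtain M0 where M0: "\<And>M. M \<ge> M0 \<Longrightarrow> \<bar>C * (p M / S M)\<bar> < e / 2"
    using LIMSEQ_D[of "\<lambda>M. C * (p M / S M)" 0 "e / 2"] e by auto
  show "\<exists>no. \<forall>M\<ge>no. norm ((\<Sum>k\<le>M. p k * a (M - k)) / (\<Sum>k\<le>M. p k) - L) < e"
  proof (intro exI allI impI)
    fix M assume M: "M \<ge> M0"
    have "(\<Sum>k\<le>M. p k * a (M - k)) / S M - L = ((\<Sum>k\<le>M. p k * a (M - k)) - L * S M) / S M"
      using Spos[of M] by (simp add: field_simps)
    then have "\<bar>(\<Sum>k\<le>M. p k * a (M - k)) / S M - L\<bar> = \<bar>(\<Sum>k\<le>M. p k * a (M - k)) - L * S M\<bar> / S M"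
      using Spos[of M] by (simp add: abs_divide)
    also have "\<dots> \<le> (e / 2 * S M + C * p M) / S M"
      using Spos[of M] key[of M] by (intro divide_right_mono) auto
    also have "\<dots> = e / 2 + C * (p M / S M)"
      using Spos[of M] by (simp add: add_divide_distrib)
    also have "\<dots> < e" using M0[OF M] by linarith
    finally show "norm ((\<Sum>k\<le>M. p k * a (M - k)) / (\<Sum>k\<le>M. p k) - L) < e"
      by (simp add: S_def)
  qed
qed

section \<open>The mean value of the numerator coefficients\<close>

lemma sum_progression:
  fixes h :: "nat \<Rightarrow> real"
  assumes d: "d \<ge> 1"
  shows "(\<Sum>j\<le>x. h j * real_of_int (progression e d j)) = (\<Sum>k | e + d * k \<le> x. h (e + d * k))"
proof -
  have "(\<Sum>j\<le>x. h j * real_of_int (progression e d j)) = (\<Sum>j | j \<le> x \<and> e \<le> j \<and> d dvd (j - e). h j)"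
    by (rule sum.mono_neutral_cong_right) (auto simp: progression_def)
  also have "\<dots> = (\<Sum>k | e + d * k \<le> x. h (e + d * k))"
    by (rule sum.reindex_bij_witness[of _ "\<lambda>k. e + d * k" "\<lambda>j. (j - e) div d"]) (use d in auto)
  finally show ?thesis .
qed

lemma sum_progression_count:
  assumes "d \<ge> 1"
  shows "(\<Sum>j\<le>x. real_of_int (progression e d j)) = real (progression_count e d x)"
  using sum_progression[OF assms, of "\<lambda>_. 1" e x] by (simp add: progression_count_def)

lemma crank_start_eq: "real (crank_start m r) = real r * (real r + 1) / 2 + real r * real (nat \<bar>m\<bar>)"
proof -
  have "2 * (Suc r choose 2) = r * (r + 1)"
    by (induction r) (simp_all add: numeral_2_eq_2)
  then have "2 * real (Suc r choose 2) = real r * (real r + 1)"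
    by (metis of_nat_1 of_nat_add of_nat_mult of_nat_numeral)
  then show ?thesis by (simp add: crank_start_def)
qed

lemma crank_start_mono: "crank_start m n * Suc n \<le> crank_start m (Suc n) * n"
proof -
  have "real (crank_start m n * Suc n) \<le> real (crank_start m (Suc n) * n)"
    unfolding of_nat_mult crank_start_eq by (simp add: field_simps)
  then show ?thesis by (simp only: of_nat_le_iff)
qed

lemma crank_start_even: "crank_start m (2 * s) = s * (2 * s + 1) + 2 * s * nat \<bar>m\<bar>"
proof -
  have "real (crank_start m (2 * s)) = real (s * (2 * s + 1) + 2 * s * nat \<bar>m\<bar>)"
    unfolding crank_start_eq by (simp add: field_simps)
  then show ?thesis by (simp only: of_nat_eq_iff)
qed

lemma density_crank: "(\<lambda>x. (\<Sum>r=1..x. (-1) ^ Suc r * real (progression_count (crank_start m r) r x)) / real x) \<longlonglongrightarrow> ln 2"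
  using alternating_progression_density[of 1 "crank_start m"] crank_start_mono crank_start_ge by simp

lemma density_slater: "(\<lambda>x. (\<Sum>s=1..x. (-1) ^ Suc s * real (progression_count (slater_start m s) (2 * s) x)) / real x) \<longlonglongrightarrow> ln 2 / 2"
proof -
  have "slater_start m n * Suc n \<le> slater_start m (Suc n) * n" for n
    by (simp add: slater_start_def algebra_simps)
  moreover have "n \<le> slater_start m n" for n
    using slater_start_ge[of n m] by simp
  ultimately show ?thesis
    using alternating_progression_density[of 2 "slater_start m"] by simp
qed

lemma density_crank_even: "(\<lambda>x. (\<Sum>s=1..x. (-1) ^ Suc s * real (progression_count (crank_start m (2 * s)) (2 * s) x)) / real x) \<longlonglongrightarrow> ln 2 / 2"
proof -
  have "crank_start m (2 * n) * Suc n \<le> crank_start m (2 * Suc n) * n" for n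
    unfolding crank_start_even by (simp add: algebra_simps)
  moreover have "n \<le> crank_start m (2 * n)" for n
    using crank_start_ge[of "2 * n" m] by simp
  ultimately show ?thesis
    using alternating_progression_density[of 2 "\<lambda>n. crank_start m (2 * n)"] by simp
qed

text \<open>
  The weights $h=1$ and $h(j)=(-1)^j$ serve to separate the residue classes modulo $2$.
\<close>

lemma twisted_numer_sum:
  "(\<Sum>j\<le>x. h j * real_of_int (C1_numer m j)) =
     (\<Sum>r=1..x. (-1) ^ Suc r * (\<Sum>j\<le>x. h j * real_of_int (progression (crank_start m r) r j)))
     - (\<Sum>s=1..x. (-1) ^ Suc s * (\<Sum>j\<le>x. h j * real_of_int (progression (slater_start m s) (2 * s) j)))"
proof -
  have "(\<Sum>j\<le>x. h j * real_of_int (C1_numer m j)) =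
    (\<Sum>j\<le>x. (\<Sum>r=1..x. h j * ((-1) ^ Suc r * real_of_int (progression (crank_start m r) r j)))
       - (\<Sum>s=1..x. h j * ((-1) ^ Suc s * real_of_int (progression (slater_start m s) (2 * s) j))))"
  proof (rule sum.cong)
    fix j assume "j \<in> {..x}"
    then show "h j * real_of_int (C1_numer m j) =
      (\<Sum>r=1..x. h j * ((-1) ^ Suc r * real_of_int (progression (crank_start m r) r j)))
       - (\<Sum>s=1..x. h j * ((-1) ^ Suc s * real_of_int (progression (slater_start m s) (2 * s) j)))"
      by (simp only: atMost_iff C1_numer_eq[of j x] of_int_diff of_int_sum of_int_mult of_int_power of_int_minus of_int_1
          right_diff_distrib sum_distrib_left)
  qed simp
  also have "\<dots> = (\<Sum>r=1..x. \<Sum>j\<le>x. h j * ((-1) ^ Suc r * real_of_int (progression (crank_start m r) r j)))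
       - (\<Sum>s=1..x. \<Sum>j\<le>x. h j * ((-1) ^ Suc s * real_of_int (progression (slater_start m s) (2 * s) j)))"
    unfolding sum_subtractf by (subst (1 2) sum.swap) simp
  finally show ?thesis
    by (simp only: sum_distrib_left mult.left_commute)
qed

text \<open>
  The two series have the densities $\log2$ and $\frac12\log2$.
\<close>

lemma numer_mean: "(\<lambda>x. (\<Sum>j\<le>x. real_of_int (C1_numer m j)) / real x) \<longlonglongrightarrow> ln 2 / 2"
proof -
  let ?G = "\<lambda>x. \<Sum>s=1..x. (-1) ^ Suc s * real (progression_count (slater_start m s) (2 * s) x)"
  let ?F = "\<lambda>x. \<Sum>r=1..x. (-1) ^ Suc r * real (progression_count (crank_start m r) r x)"
  have "(\<Sum>j\<le>x. real_of_int (C1_numer m j)) =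
     (?F x)
     - (?G x)" for x
  proof -
    have "(\<Sum>r=1..x. (-1) ^ Suc r * (\<Sum>j\<le>x. 1 * real_of_int (progression (crank_start m r) r j)))
       = (?F x)"
      by (intro sum.cong refl) (simp add: sum_progression_count)
    moreover have "(\<Sum>s=1..x. (-1) ^ Suc s * (\<Sum>j\<le>x. 1 * real_of_int (progression (slater_start m s) (2 * s) j)))
       = (?G x)"
      by (intro sum.cong refl) (simp add: sum_progression_count)
    ultimately show ?thesis
      using twisted_numer_sum[of "\<lambda>_. 1" m x] by (simp only: mult_1)
  qed
  then have "(\<lambda>x. (\<Sum>j\<le>x. real_of_int (C1_numer m j)) / real x) \<longlonglongrightarrow> ln 2 - ln 2 / 2"
    using tendsto_diff[OF density_crank density_slater, of m m] by (simp only: diff_divide_distrib)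
  then show ?thesis by simp
qed

text \<open>
  On a progression of odd difference the signs alternate, and the sum is at most $1$ in absolute value; there are $O(\sqrt x)$ such
  progressions. On the progression with index $r=2s$ in the first series the sign $(-1)^j$ is constantly $(-1)^s$, which leaves the density $\frac12\log2$.
  In the second series all exponents are even, and its density $\frac12\log2$ cancels this.
\<close>

lemma numer_alternating_mean: "(\<lambda>x. (\<Sum>j\<le>x. (-1) ^ j * real_of_int (C1_numer m j)) / real x) \<longlonglongrightarrow> 0"
proof -
  let ?G = "\<lambda>x. \<Sum>s=1..x. (-1) ^ Suc s * real (progression_count (slater_start m s) (2 * s) x)"
  let ?F = "\<lambda>x. \<Sum>s=1..x. (-1) ^ Suc s * real (progression_count (crank_start m (2 * s)) (2 * s) x)"
  define R where "R r x = (\<Sum>j\<le>x. (-1) ^ j * real_of_int (progression (crank_start m r) r j))" for r x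
  define err where "err x = (\<Sum>r | r \<in> {1..x} \<and> odd r. R r x)" for x
  have R_eq: "R r x = (\<Sum>k | crank_start m r + r * k \<le> x. (-1) ^ (crank_start m r + r * k))" if "r \<ge> 1" for r x
    unfolding R_def by (rule sum_progression[OF that])
  have R_odd: "\<bar>R r x\<bar> \<le> (if crank_start m r \<le> x then 1 else 0)" if r: "r \<ge> 1" "odd r" for r x
  proof (cases "crank_start m r \<le> x")
    case False
    then have "{k. crank_start m r + r * k \<le> x} = {}" by auto
    then show ?thesis unfolding R_eq[OF r(1)] by simp
  next
    case True
    have "{k. crank_start m r + r * k \<le> x} = {..<Suc ((x - crank_start m r) div r)}"
      using True r by (auto simp: less_Suc_eq_le less_eq_div_iff_mult_less_eq mult.commute)
    then have "R r x = (\<Sum>k<Suc ((x - crank_start m r) div r). (-1) ^ (crank_start m r + r * k))"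
      unfolding R_eq[OF r(1)] by simp
    also have "\<dots> = (-1) ^ crank_start m r * (\<Sum>k<Suc ((x - crank_start m r) div r). (-1) ^ k * 1)"
      unfolding sum_distrib_left using r(2) by (intro sum.cong refl) (simp add: power_add power_mult)
    finally have "\<bar>R r x\<bar> = \<bar>\<Sum>k<Suc ((x - crank_start m r) div r). (-1) ^ k * 1 :: real\<bar>"
      by (simp only: abs_mult power_abs abs_minus_cancel abs_one power_one mult_1)
    also have "\<dots> \<le> 1"
      using alternating_sum_bounds[of "\<lambda>_. 1" "Suc ((x - crank_start m r) div r)"] by auto
    finally show ?thesis using True by simp
  qed
  have err_bound: "\<bar>err x\<bar> \<le> sqrt (2 * real x)" for x
  proof -
    have "\<bar>err x\<bar> \<le> (\<Sum>r | r \<in> {1..x} \<and> odd r. \<bar>R r x\<bar>)"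
      unfolding err_def by (rule sum_abs)
    also have "\<dots> \<le> (\<Sum>r | r \<in> {1..x} \<and> odd r. if crank_start m r \<le> x then 1 else 0)"
      by (intro sum_mono R_odd) auto
    also have "\<dots> \<le> (\<Sum>r\<in>{1..nat \<lfloor>sqrt (2 * real x)\<rfloor>}. 1 :: real)"
    proof (rule order_trans[OF eq_refl sum_mono2])
      show "(\<Sum>r | r \<in> {1..x} \<and> odd r. if crank_start m r \<le> x then 1 else 0) = (\<Sum>r | r \<in> {1..x} \<and> odd r \<and> crank_start m r \<le> x. 1 :: real)"
        by (rule sum.mono_neutral_cong_right) auto
      show "{r. r \<in> {1..x} \<and> odd r \<and> crank_start m r \<le> x} \<subseteq> {1..nat \<lfloor>sqrt (2 * real x)\<rfloor>}"
      proof
        fix r assume r: "r \<in> {r. r \<in> {1..x} \<and> odd r \<and> crank_start m r \<le> x}"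
        \<comment> \<open>The starting exponents grow quadratically, so only $O(\sqrt x)$ of them are at most \<open>x\<close>.\<close>
        have "2 * real (crank_start m r) = real r ^ 2 + real r + 2 * (real r * real (nat \<bar>m\<bar>))"
          unfolding crank_start_eq by (simp add: field_simps power2_eq_square)
        moreover have "0 \<le> real r * real (nat \<bar>m\<bar>)" by simp
        ultimately have "real r ^ 2 \<le> 2 * real (crank_start m r)" by linarith
        also have "\<dots> \<le> 2 * real x" using r by simp
        finally have "real r \<le> sqrt (2 * real x)" by (rule real_le_rsqrt)
        then show "r \<in> {1..nat \<lfloor>sqrt (2 * real x)\<rfloor>}" using r by (simp add: le_nat_floor)
      qed
    qed auto
    also have "\<dots> \<le> sqrt (2 * real x)" by (simp add: of_nat_nat) 
    finally show ?thesis .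
  qed
  have even_part: "(-1) ^ Suc (2 * s) * R (2 * s) x = (-1) ^ Suc s * real (progression_count (crank_start m (2 * s)) (2 * s) x)" if "s \<ge> 1" for s x
  proof -
    have "R (2 * s) x = (\<Sum>k | crank_start m (2 * s) + 2 * s * k \<le> x. (-1) ^ (crank_start m (2 * s) + 2 * s * k))"
      by (rule R_eq) (use that in simp)
    also have "\<dots> = (\<Sum>k | crank_start m (2 * s) + 2 * s * k \<le> x. (-1) ^ s)"
    proof (rule sum.cong)
      fix k
      have "even (crank_start m (2 * s) + 2 * s * k) = even s" unfolding crank_start_even by simp
      then show "(-1) ^ (crank_start m (2 * s) + 2 * s * k) = (-1 :: real) ^ s"
        by (simp only: uminus_power_if power_one)
    qed simp
    also have "\<dots> = (-1) ^ s * real (progression_count (crank_start m (2 * s)) (2 * s) x)"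
      by (simp add: progression_count_def)
    finally show ?thesis by simp
  qed
  have second: "(\<Sum>j\<le>x. (-1) ^ j * real_of_int (progression (slater_start m s) (2 * s) j)) = real (progression_count (slater_start m s) (2 * s) x)" if "s \<ge> 1" for s x
  proof -
    have "(\<Sum>j\<le>x. (-1) ^ j * real_of_int (progression (slater_start m s) (2 * s) j)) = (\<Sum>k | slater_start m s + 2 * s * k \<le> x. (-1) ^ (slater_start m s + 2 * s * k))"
      by (rule sum_progression) (use that in simp)
    also have "\<dots> = (\<Sum>k | slater_start m s + 2 * s * k \<le> x. 1)"
    proof (rule sum.cong)
      fix k
      have "even (slater_start m s + 2 * s * k)" unfolding slater_start_def by simp
      then show "(-1) ^ (slater_start m s + 2 * s * k) = (1 :: real)" by (simp only: uminus_power_if if_True power_one)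
    qed simp
    finally show ?thesis by (simp add: progression_count_def)
  qed
  have "(\<Sum>j\<le>x. (-1) ^ j * real_of_int (C1_numer m j)) = err x
     + (?F x)
     - (?G x)" for x
  proof -
    have "(\<Sum>r=1..x. (-1) ^ Suc r * R r x) = (\<Sum>r | r \<in> {1..x} \<and> odd r. (-1) ^ Suc r * R r x) + (\<Sum>r | r \<in> {1..x} \<and> even r. (-1) ^ Suc r * R r x)"
      by (subst sum.union_disjoint[symmetric]) (auto intro!: sum.cong)
    also have "(\<Sum>r | r \<in> {1..x} \<and> odd r. (-1) ^ Suc r * R r x) = err x"
      unfolding err_def by (intro sum.cong refl) auto
    also have "(\<Sum>r | r \<in> {1..x} \<and> even r. (-1) ^ Suc r * R r x) = (\<Sum>s=1..x div 2. (-1) ^ Suc (2 * s) * R (2 * s) x)"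
      by (rule sum.reindex_bij_witness[of _ "\<lambda>s. 2 * s" "\<lambda>r. r div 2"]) (auto elim!: evenE)
    also have "\<dots> = (\<Sum>s=1..x div 2. (-1) ^ Suc s * real (progression_count (crank_start m (2 * s)) (2 * s) x))"
      by (intro sum.cong refl even_part) simp
    also have "\<dots> = (?F x)"
    proof (rule sum.mono_neutral_left)
      show "\<forall>s\<in>{1..x} - {1..x div 2}. (-1) ^ Suc s * real (progression_count (crank_start m (2 * s)) (2 * s) x) = 0"
      proof
        fix s assume "s \<in> {1..x} - {1..x div 2}"
        then have "x < crank_start m (2 * s)" using crank_start_ge[of "2 * s" m] by auto
        then have "{k. crank_start m (2 * s) + 2 * s * k \<le> x} = {}" by auto
        then have "progression_count (crank_start m (2 * s)) (2 * s) x = 0" by (simp only: progression_count_def card.empty)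
        then show "(-1) ^ Suc s * real (progression_count (crank_start m (2 * s)) (2 * s) x) = 0" by simp
      qed
    qed auto
    finally have first: "(\<Sum>r=1..x. (-1) ^ Suc r * R r x) = err x + (?F x)" .
    have "(\<Sum>s=1..x. (-1) ^ Suc s * (\<Sum>j\<le>x. (-1) ^ j * real_of_int (progression (slater_start m s) (2 * s) j)))
      = (?G x)"
      by (intro sum.cong refl) (simp only: second atLeastAtMost_iff)
    then show ?thesis
      using twisted_numer_sum[of "\<lambda>j. (-1) ^ j" m x] first unfolding R_def by (simp only:)
  qed
  moreover have "(\<lambda>x. err x / real x) \<longlonglongrightarrow> 0"
  proof (rule Lim_null_comparison)
    show "\<forall>\<^sub>F x in sequentially. norm (err x / real x) \<le> sqrt (2 * real x) / real x"
      using err_bound by (intro always_eventually allI) (simp add: abs_divide divide_right_mono)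
    show "(\<lambda>x. sqrt (2 * real x) / real x) \<longlonglongrightarrow> 0" by real_asymp
  qed
  ultimately have "(\<lambda>x. (\<Sum>j\<le>x. (-1) ^ j * real_of_int (C1_numer m j)) / real x) \<longlonglongrightarrow> 0 + ln 2 / 2 - ln 2 / 2"
    using tendsto_diff[OF tendsto_add[OF _ density_crank_even] density_slater, of "\<lambda>x. err x / real x" 0 m m]
    by (simp only: diff_divide_distrib add_divide_distrib)
  then show ?thesis by simp
qed

text \<open>
  The residue class of $e$ is selected by the weight $\frac12(1+(-1)^e(-1)^j)$.
\<close>

lemma numer_parity_mean:
  assumes e: "e < 2"
  shows "(\<lambda>i. (\<Sum>l\<le>i. real_of_int (C1_numer m (2 * l + e))) / real (Suc i)) \<longlonglongrightarrow> ln 2 / 2"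
proof -
  define P Q where "P x = (\<Sum>j\<le>x. real_of_int (C1_numer m j)) / real x"
    and "Q x = (\<Sum>j\<le>x. (-1) ^ j * real_of_int (C1_numer m j)) / real x" for x
  have sub: "filterlim (\<lambda>i. 2 * i + e) sequentially sequentially"
    by (rule filterlim_subseq) (simp add: strict_mono_def)
  have P: "(\<lambda>i. P (2 * i + e)) \<longlonglongrightarrow> ln 2 / 2"
    using filterlim_compose[OF numer_mean sub] by (simp add: P_def)
  have Q: "(\<lambda>i. Q (2 * i + e)) \<longlonglongrightarrow> 0"
    using filterlim_compose[OF numer_alternating_mean sub] by (simp add: Q_def)
  have ratio: "(\<lambda>i. real (2 * i + e) / real (Suc i)) \<longlonglongrightarrow> 2"
    by real_asymp
  have "(\<lambda>i. (P (2 * i + e) + (-1) ^ e * Q (2 * i + e)) / 2 * (real (2 * i + e) / real (Suc i))) \<longlonglongrightarrow> (ln 2 / 2 + (-1) ^ e * 0) / 2 * 2"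
    by (intro tendsto_intros P Q ratio) simp
  then have "(\<lambda>i. (P (2 * i + e) + (-1) ^ e * Q (2 * i + e)) / 2 * (real (2 * i + e) / real (Suc i))) \<longlonglongrightarrow> ln 2 / 2"
    by simp
  then show ?thesis
  proof (rule Lim_transform_eventually)
    show "\<forall>\<^sub>F i in sequentially. (P (2 * i + e) + (-1) ^ e * Q (2 * i + e)) / 2 * (real (2 * i + e) / real (Suc i))
      = (\<Sum>l\<le>i. real_of_int (C1_numer m (2 * l + e))) / real (Suc i)"
      using eventually_ge_at_top[of 1]
    proof eventually_elim
      case (elim i)
      define x where "x = 2 * i + e"
      have x: "real x > 0" using elim by (simp add: x_def)
      have "(\<Sum>l\<le>i. real_of_int (C1_numer m (2 * l + e))) = (\<Sum>j | j \<le> x \<and> even (j + e). real_of_int (C1_numer m j))"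
      proof (rule sum.reindex_bij_witness[of _ "\<lambda>j. j div 2" "\<lambda>l. 2 * l + e"])
        fix l assume l: "l \<in> {..i}"
        show "(2 * l + e) div 2 = l" using e by simp
        show "2 * l + e \<in> {j. j \<le> x \<and> even (j + e)}" using l by (simp add: x_def)
      next
        fix j assume j: "j \<in> {j. j \<le> x \<and> even (j + e)}"
        then have "even (j + e)" "j \<le> 2 * i + e" by (simp_all only: mem_Collect_eq x_def)
        then show "2 * (j div 2) + e = j" "j div 2 \<in> {..i}"
          using e unfolding atMost_iff by presburger+
      qed simp
      also have "\<dots> = (\<Sum>j\<le>x. (1 + (-1) ^ e * (-1) ^ j) / 2 * real_of_int (C1_numer m j))"
        by (rule sum.mono_neutral_cong_left) (auto simp: uminus_power_if)
      also have "\<dots> = (\<Sum>j\<le>x. (real_of_int (C1_numer m j) + (-1) ^ e * ((-1) ^ j * real_of_int (C1_numer m j))) / 2)"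
        by (intro sum.cong refl) (simp add: algebra_simps)
      also have "\<dots> = ((\<Sum>j\<le>x. real_of_int (C1_numer m j)) + (-1) ^ e * (\<Sum>j\<le>x. (-1) ^ j * real_of_int (C1_numer m j))) / 2"
        by (simp only: sum_divide_distrib[symmetric] sum.distrib sum_distrib_left)
      also have "\<dots> = (P x * real x + (-1) ^ e * (Q x * real x)) / 2"
        using x by (simp add: P_def Q_def)
      also have "\<dots> = (P x + (-1) ^ e * Q x) / 2 * real x"
        by (simp add: algebra_simps)
      finally have "(\<Sum>l\<le>i. real_of_int (C1_numer m (2 * l + e))) = (P x + (-1) ^ e * Q x) / 2 * real x" .
      then show ?case by (simp only: x_def times_divide_eq_right)
    qed
  qed
qed

section \<open>The asymptotic formula\<close>

text \<open>
  Parts of size $1$ are allowed, so that a partition of $n$ extends to one of $n+1$.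
\<close>

lemma bounded_partitions_step_mono: "bounded_partitions (Suc K) n \<le> bounded_partitions (Suc K) (Suc n)"
proof (induction K arbitrary: n)
  case 0
  have "bounded_partitions (Suc 0) n = 1" for n
    by (induction n) (simp_all add: bounded_partitions.simps)
  then show ?case by simp
next
  case (Suc K)
  show ?case
  proof (induction n rule: less_induct)
    case (less n)
    define L where "L = Suc (Suc K)"
    have rec: "bounded_partitions L k = bounded_partitions (Suc K) k + (if L \<le> k then bounded_partitions L (k - L) else 0)" for k
      unfolding L_def by (rule bounded_partitions.simps)
    have "(if L \<le> n then bounded_partitions L (n - L) else 0) \<le> (if L \<le> Suc n then bounded_partitions L (Suc n - L) else 0)"
    proof (cases "L \<le> n")
      case True
      then have "n - L < n" "Suc n - L = Suc (n - L)" by (auto simp: L_def)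
      then show ?thesis using less.IH[of "n - L"] True by (simp add: L_def)
    qed simp
    then show ?case
      unfolding L_def[symmetric] rec[of n] rec[of "Suc n"] by (rule add_mono[OF Suc.IH])
  qed
qed

lemma partitions_mono: "partitions n \<le> partitions (Suc n)"
  using bounded_partitions_step_mono[of n n] bounded_partitions_stable[of n "Suc n"] bounded_partitions_stable[of "Suc n" "Suc n"] by simp

lemma partitions_0: "partitions 0 = 1"
  by (simp add: partitions_def bounded_partitions.simps)

text \<open>
  Consecutive partial sums are asymptotically equal by \<open>partition_sum_asymptotics\<close>.
\<close>

lemma partitions_over_sum: "(\<lambda>M. real (partitions M) / real (partition_sum M)) \<longlonglongrightarrow> 0"
proof -
  define X where "X n = real (partition_sum n) * sqrt (real n) * exp (- (pi * sqrt (6 * real n) / 3))" for n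
  have X: "X \<longlonglongrightarrow> 1 / (2 * sqrt 2 * pi)"
    unfolding X_def[abs_def] by (rule partition_sum_asymptotics)
  have XS: "(\<lambda>n. X (Suc n)) \<longlonglongrightarrow> 1 / (2 * sqrt 2 * pi)"
    using X by (rule LIMSEQ_Suc)
  have pos: "real (partition_sum n) > 0" for n
  proof -
    have "partitions 0 \<le> partition_sum n"
      unfolding partition_sum_def by (rule member_le_sum) auto
    then show ?thesis by (simp add: partitions_0)
  qed
  have r: "(\<lambda>n. sqrt (real (Suc n)) / sqrt (real n) * exp (pi * sqrt (6 * real n) / 3 - pi * sqrt (6 * real (Suc n)) / 3)) \<longlonglongrightarrow> 1"
    by real_asymp
  have "(\<lambda>n. 1 - X n / X (Suc n) * (sqrt (real (Suc n)) / sqrt (real n) * exp (pi * sqrt (6 * real n) / 3 - pi * sqrt (6 * real (Suc n)) / 3)))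
     \<longlonglongrightarrow> 1 - (1 / (2 * sqrt 2 * pi)) / (1 / (2 * sqrt 2 * pi)) * 1"
    by (intro tendsto_intros X XS r) simp
  then have "(\<lambda>n. 1 - X n / X (Suc n) * (sqrt (real (Suc n)) / sqrt (real n) * exp (pi * sqrt (6 * real n) / 3 - pi * sqrt (6 * real (Suc n)) / 3)))
     \<longlonglongrightarrow> 0" by simp
  then have "(\<lambda>n. real (partitions (Suc n)) / real (partition_sum (Suc n))) \<longlonglongrightarrow> 0"
  proof (rule Lim_transform_eventually)
    show "\<forall>\<^sub>F n in sequentially. 1 - X n / X (Suc n) * (sqrt (real (Suc n)) / sqrt (real n) * exp (pi * sqrt (6 * real n) / 3 - pi * sqrt (6 * real (Suc n)) / 3))
       = real (partitions (Suc n)) / real (partition_sum (Suc n))"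
      using eventually_ge_at_top[of 1]
    proof eventually_elim
      case (elim n)
      have "X n / X (Suc n) * (sqrt (real (Suc n)) / sqrt (real n) * exp (pi * sqrt (6 * real n) / 3 - pi * sqrt (6 * real (Suc n)) / 3))
         = real (partition_sum n) / real (partition_sum (Suc n))"
      proof -
        have cancel: "(s * r * exp (- a)) / (s' * r' * exp (- b)) * (r' / r * exp (a - b)) = s / s'"
          if "r > 0" "r' > 0" for s s' r r' a b :: real
          using that by (simp add: exp_diff exp_minus field_simps)
        show ?thesis
          unfolding X_def by (rule cancel) (use elim in simp_all)
      qed
      moreover have "real (partition_sum (Suc n)) = real (partition_sum n) + real (partitions (Suc n))"
        by (simp add: partition_sum_def)
      ultimately show ?case using pos[of "Suc n"] by (simp add: field_simps)
    qed
  qed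
  then show ?thesis by (rule LIMSEQ_imp_Suc)
qed

lemma N_C1_over_partition_sum:
  assumes e: "e < 2"
  shows "(\<lambda>M. real_of_int (N_C1 m (2 * M + e)) / real (partition_sum M)) \<longlonglongrightarrow> ln 2 / 2"
proof -
  have "(\<lambda>M. (\<Sum>k\<le>M. real (partitions k) * real_of_int (C1_numer m (2 * (M - k) + e))) / (\<Sum>k\<le>M. real (partitions k))) \<longlonglongrightarrow> ln 2 / 2"
  proof (rule convolution_with_mean_value)
    show "(\<lambda>M. real (partitions M) / (\<Sum>k\<le>M. real (partitions k))) \<longlonglongrightarrow> 0"
      using partitions_over_sum by (simp add: partition_sum_def)
    show "(\<lambda>i. (\<Sum>l\<le>i. real_of_int (C1_numer m (2 * l + e))) / real (Suc i)) \<longlonglongrightarrow> ln 2 / 2"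
      by (rule numer_parity_mean[OF e])
  qed (simp_all add: partitions_0 partitions_mono)
  moreover have "real_of_int (N_C1 m (2 * M + e)) = (\<Sum>k\<le>M. real (partitions k) * real_of_int (C1_numer m (2 * (M - k) + e)))" for M
  proof -
    have "(2 * M + e) div 2 = M" using e by simp
    moreover have "2 * M + e - 2 * k = 2 * (M - k) + e" if "k \<le> M" for k using that by simp
    ultimately show ?thesis
      by (simp add: N_C1_convolution)
  qed
  ultimately show ?thesis
    by (simp add: partition_sum_def)
qed

lemma parity_tendsto:
  fixes f :: "nat \<Rightarrow> real"
  assumes "\<And>e. e < 2 \<Longrightarrow> (\<lambda>M. f (2 * M + e)) \<longlonglongrightarrow> L"
  shows "f \<longlonglongrightarrow> L"
proof (rule LIMSEQ_I)
  fix d :: real assume d: "d > 0"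
  obtain M0 where M0: "\<And>M. M \<ge> M0 \<Longrightarrow> norm (f (2 * M) - L) < d"
    using LIMSEQ_D[OF assms[of 0] d] by auto
  obtain M1 where M1: "\<And>M. M \<ge> M1 \<Longrightarrow> norm (f (2 * M + 1) - L) < d"
    using LIMSEQ_D[OF assms[of 1] d] by auto
  have "norm (f n - L) < d" if n: "n \<ge> 2 * max M0 M1 + 1" for n
  proof (cases "even n")
    case True
    then have "n = 2 * (n div 2)" by simp
    moreover have "n div 2 \<ge> M0" using n by auto
    ultimately show ?thesis using M0 by metis
  next
    case False
    then have "n = 2 * (n div 2) + 1" by simp
    moreover have "n div 2 \<ge> M1" using n by auto
    ultimately show ?thesis using M1 by metis
  qed
  then show "\<exists>no. \<forall>n\<ge>no. norm (f n - L) < d" by blast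
qed

theorem theorem1p1:
  fixes m :: int
  shows "(\<lambda>n::nat. real_of_int (N_C1 m n)) \<sim>[at_top]
           (\<lambda>n. ln 2 / (4 * pi * sqrt (real n)) * exp (pi * sqrt (real n) / sqrt 3))"
proof (rule asymp_equivI', rule parity_tendsto)
  fix e :: nat assume e: "e < 2"
  define G where "G n = ln 2 / (4 * pi * sqrt (real n)) * exp (pi * sqrt (real n) / sqrt 3)" for n
  define X where "X n = real (partition_sum n) * sqrt (real n) * exp (- (pi * sqrt (6 * real n) / 3))" for n
  define Y where "Y M = exp (pi * sqrt (6 * real M) / 3) / sqrt (real M) / G (2 * M + e)" for M
  have Y: "Y \<longlonglongrightarrow> 4 * sqrt 2 * pi / ln 2"
  proof -
    have "(\<lambda>M. exp (pi * sqrt (6 * real M) / 3 - pi * sqrt (2 * real M + real e) / sqrt 3)) \<longlonglongrightarrow> 1"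
    proof -
      have s6: "pi * sqrt (6 * real M) / 3 = pi * sqrt (2 * real M) / sqrt 3" for M
      proof -
        have "6 * real M = 3 * (2 * real M)" by simp
        then have "sqrt (6 * real M) = sqrt 3 * sqrt (2 * real M)" by (simp only: real_sqrt_mult)
        then show ?thesis by (simp add: field_simps)
      qed
      have "(\<lambda>M. sqrt (2 * real M) - sqrt (2 * real M + real e)) \<longlonglongrightarrow> 0"
        by real_asymp
      then have "(\<lambda>M. exp (pi / sqrt 3 * (sqrt (2 * real M) - sqrt (2 * real M + real e)))) \<longlonglongrightarrow> exp (pi / sqrt 3 * 0)"
        by (intro tendsto_intros)
      then show ?thesis
        unfolding s6 by (simp add: right_diff_distrib)
    qed
    moreover have "(\<lambda>M. sqrt (2 * real M + real e) / sqrt (real M)) \<longlonglongrightarrow> sqrt 2"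
      by (real_asymp simp: powr_half_sqrt)
    ultimately have "(\<lambda>M. exp (pi * sqrt (6 * real M) / 3 - pi * sqrt (2 * real M + real e) / sqrt 3)
       * (sqrt (2 * real M + real e) / sqrt (real M)) * (4 * pi / ln 2)) \<longlonglongrightarrow> 1 * sqrt 2 * (4 * pi / ln 2)"
      by (intro tendsto_intros)
    moreover have "exp (pi * sqrt (6 * real M) / 3 - pi * sqrt (2 * real M + real e) / sqrt 3)
       * (sqrt (2 * real M + real e) / sqrt (real M)) * (4 * pi / ln 2) = Y M" for M
      by (simp add: Y_def G_def exp_diff mult_ac)
    ultimately show ?thesis
      by (simp add: mult_ac)
  qed
  have "(\<lambda>M. real_of_int (N_C1 m (2 * M + e)) / real (partition_sum M) * X M * Y M) \<longlonglongrightarrow>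
     ln 2 / 2 * (1 / (2 * sqrt 2 * pi)) * (4 * sqrt 2 * pi / ln 2)"
    unfolding X_def by (intro tendsto_mult N_C1_over_partition_sum[OF e] partition_sum_asymptotics Y)
  also have "ln 2 / 2 * (1 / (2 * sqrt 2 * pi)) * (4 * sqrt 2 * pi / ln 2) = (1 :: real)"
    by simp
  finally show "(\<lambda>M. real_of_int (N_C1 m (2 * M + e)) / (ln 2 / (4 * pi * sqrt (real (2 * M + e))) * exp (pi * sqrt (real (2 * M + e)) / sqrt 3))) \<longlonglongrightarrow> 1"
  proof (rule Lim_transform_eventually)
    show "\<forall>\<^sub>F M in sequentially. real_of_int (N_C1 m (2 * M + e)) / real (partition_sum M) * X M * Y M
       = real_of_int (N_C1 m (2 * M + e)) / (ln 2 / (4 * pi * sqrt (real (2 * M + e))) * exp (pi * sqrt (real (2 * M + e)) / sqrt 3))"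
      using eventually_ge_at_top[of 1]
    proof eventually_elim
      case (elim M)
      have "partitions 0 \<le> partition_sum M"
        unfolding partition_sum_def by (rule member_le_sum) auto
      then have S: "real (partition_sum M) > 0" by (simp add: partitions_0)
      have "exp (- (pi * sqrt (6 * real M) / 3)) * exp (pi * sqrt (6 * real M) / 3) = 1"
        by (simp flip: exp_add)
      then show ?case
        unfolding G_def[symmetric] using S elim by (simp add: X_def Y_def field_simps)
    qed
  qed
qed

end
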